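(* Let $1\le k<\ell\le L$ and let $\bm{X}_{k,\ell}\in\mathbb{R}^{N\times N}$ be the $(k,\ell)$ block of $\mathrm{K}(\bm{\mathcal{M}}_L)=(\bm{I}-\bm{\mathcal{M}}_L)^{-1}$, i.e. $$\bm{X}_{k,\ell}=\left(\prod_{i=k}^{\ell-1}\mathrm{K}(\bm{A}_i)\bm{W}_i\right)\mathrm{K}(\bm{A}_\ell)$$ (factors ordered from left to right by increasing $i$). Assume that each coupling matrix $\bm{W}_m$ represents the removal or restoration of a single edge, with index $i_m$. Let $[a,b]$ be the smallest interval containing the spectrum of $\bm{I}-\bm{A}_m$ for every $m=k,\dots,\ell$, and set $C=\frac{(1+\sqrt{b/a})^2}{2b}$. Let $[\bm{c}_\ell]_{\max}$ be the maximum entry of the Katz centrality vector $\bm{c}_\ell=\mathrm{K}(\bm{A}_\ell)\bm{1}$ of $\bm{A}_\ell$, and let $g_{\max}$ be the maximum degree of the network. Then $$\|\bm{X}_{k,\ell}\bm{1}\|_2\le \bar{C}\,\lambda^{\sum_{m=k}^{\ell-2}(d(i_m,i_{m+1})-1)},$$ with $$\lambda=\frac{\sqrt{\frac{1+c_\alpha}{1-c_\alpha}}-1}{\sqrt{\frac{1+c_\alpha}{1-c_\alpha}}+1},\qquad \bar{C}=\frac{1}{1-c_\alpha}\bigl(2(1+\alpha g_{\max})C\bigr)^{\frac{\ell}{2}}[\bm{c}_\ell]_{\max}.$$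
   Context: Setting. A spatial network with $N$ edges, undirected and unweighted, is observed at $L$ time points. Its edge-level representation is the line graph: the vertices (indices $1,\dots,N$) are the edges of the network, and the edge adjacency matrix is $\widetilde{\bm{A}}=\bm{B}^\top\bm{B}-2\bm{I}\in\{0,1\}^{N\times N}$, with $\bm{B}$ the unweighted $0/1$ node-edge incidence matrix. At time $\ell\in\{1,\dots,L\}$ the network is described by the symmetric matrix $\widetilde{\bm{A}}_\ell\in\{0,1\}^{N\times N}$, obtained from the line graph adjacency matrix $\widetilde{\bm{A}}$ of the intact network by setting to zero the rows and columns of those edges that are removed (broken) at time $\ell$, i.e. $\widetilde{\bm{A}}_\ell=\bm{D}_\ell\widetilde{\bm{A}}\bm{D}_\ell$ with $\bm{D}_\ell$ diagonal with entries in $\{0,1\}$ marking the edges intact at time $\ell$. Scaling. For fixed $c_\alpha\in(0,1)$ set $\alpha=c_\alpha/\max_{\ell=1,\dots,L}\rho(\widetilde{\bm{A}}_\ell)$, with $\rho$ the spectral radius, and $\bm{A}_\ell=\alpha\widetilde{\bm{A}}_\ell$. Hence the spectrum of each $\bm{I}-\bm{A}_\ell$ lies in $[1-c_\alpha,1+c_\alpha]$. Coupling matrices. $\bm{W}_\ell=\bm{A}_{\ell+1}-\bm{A}_\ell$ for $\ell=1,\dots,L-1$. When a single edge with index $i_\ell$ is removed or restored between times $\ell$ and $\ell+1$, $\bm{W}_\ell=\pm(\bm{e}_{i_\ell}\bm{a}_{i_\ell}^\top+\bm{a}_{i_\ell}\bm{e}_{i_\ell}^\top)$, with sign $-$ for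 removal and $+$ for restoration, where $\bm{a}_{i_\ell}$ is the $i_\ell$-th column of the layer matrix in which edge $i_\ell$ is present ($\bm{A}_\ell$ for a removal, $\bm{A}_{\ell+1}$ for a restoration). Supra-adjacency matrix. $\bm{\mathcal{M}}_L\in\mathbb{R}^{NL\times NL}$ is the block upper bidiagonal matrix with diagonal blocks $\bm{A}_1,\dots,\bm{A}_L$, block superdiagonal $\bm{W}_1,\dots,\bm{W}_{L-1}$, and all other blocks zero. Notation. $\mathrm{K}(\bm{A})=(\bm{I}-\bm{A})^{-1}$; $\bm{1}$ is the all-ones vector; $d(i,j)$ is the shortest-path distance (number of steps) between the vertices $i$ and $j$ of the line graph of the intact network; degrees (in $g_{\max}$) are also vertex degrees in this line graph. An empty sum equals $0$. *)

theory Defs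
  imports
    "Jordan_Normal_Form.Spectral_Radius"
    "Jordan_Normal_Form.Gauss_Jordan_Elimination"
    "HOL-Library.Extended_Nat"
    "HOL-Library.Extended_Real"
    "HOL-Analysis.L2_Norm"
begin

text \<open>
  Matrices are those of Jordan_Normal_Form, so vertices of the line graph (edges of the network)
  are numbered from \<open>0\<close> to \<open>N - 1\<close>. Time points are numbered from \<open>1\<close> to \<open>L\<close>.
\<close>

text \<open>
  Incidence matrix of a network with \<open>V\<close> nodes and \<open>N\<close> edges. Two ones per column exclude
  self-loops; distinct columns exclude parallel edges. Together they make \<open>line_adj B\<close> below
  a \<open>0/1\<close> matrix.
\<close>
definition incidence_mat :: "nat \<Rightarrow> nat \<Rightarrow> real mat \<Rightarrow> bool" where
  "incidence_mat V N B \<longleftrightarrow>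
     B \<in> carrier_mat V N \<and> elements_mat B \<subseteq> {0, 1} \<and>
     (\<forall>e<N. card {v. v < V \<and> B $$ (v, e) = 1} = 2) \<and>
     inj_on (col B) {..<N}"

definition line_adj :: "real mat \<Rightarrow> real mat" where
  "line_adj B = transpose_mat B * B - 2 \<cdot>\<^sub>m 1\<^sub>m (dim_col B)"

definition intact_mat :: "nat \<Rightarrow> nat set \<Rightarrow> real mat" where
  "intact_mat N S = mat N N (\<lambda>(i, j). if i = j \<and> i \<in> S then 1 else 0)"

text \<open>\<open>S t\<close> is the set of edges intact at time \<open>t\<close>.\<close>

definition unscaled_layer :: "real mat \<Rightarrow> (nat \<Rightarrow> nat set) \<Rightarrow> nat \<Rightarrow> real mat" where
  "unscaled_layer B S t =
     intact_mat (dim_col B) (S t) * line_adj B * intact_mat (dim_col B) (S t)"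

definition scaling :: "real \<Rightarrow> real mat \<Rightarrow> (nat \<Rightarrow> nat set) \<Rightarrow> nat \<Rightarrow> real" where
  "scaling c B S L =
     c / Max ((\<lambda>t. spectral_radius (map_mat complex_of_real (unscaled_layer B S t))) ` {1..L})"

definition layer :: "real \<Rightarrow> real mat \<Rightarrow> (nat \<Rightarrow> nat set) \<Rightarrow> nat \<Rightarrow> nat \<Rightarrow> real mat" where
  "layer c B S L t = scaling c B S L \<cdot>\<^sub>m unscaled_layer B S t"

definition coupling :: "(nat \<Rightarrow> real mat) \<Rightarrow> nat \<Rightarrow> real mat" where
  "coupling A t = A (t + 1) - A t"

text \<open>Row and column \<open>(t - 1) * N + i\<close> belong to vertex \<open>i\<close> at time \<open>t\<close>.\<close>

definition supra_adj :: "nat \<Rightarrow> nat \<Rightarrow> (nat \<Rightarrow> real mat) \<Rightarrow> (nat \<Rightarrow> real mat) \<Rightarrow> real mat" where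
  "supra_adj N L A W = mat (N * L) (N * L) (\<lambda>(p, q).
     let s = p div N + 1; t = q div N + 1; i = p mod N; j = q mod N
     in if t = s then A s $$ (i, j)
        else if t = s + 1 then W s $$ (i, j)
        else 0)"

definition block_mat :: "nat \<Rightarrow> real mat \<Rightarrow> nat \<Rightarrow> nat \<Rightarrow> real mat" where
  "block_mat N M s t = mat N N (\<lambda>(i, j). M $$ ((s - 1) * N + i, (t - 1) * N + j))"

definition katz :: "real mat \<Rightarrow> real mat" where
  "katz A = the (mat_inverse (1\<^sub>m (dim_row A) - A))"

definition ones :: "nat \<Rightarrow> real vec" where
  "ones n = vec n (\<lambda>_. 1)"

definition norm2 :: "real vec \<Rightarrow> real" where
  "norm2 v = L2_set (vec_index v) {..<dim_vec v}"

text \<open>Edge \<open>i\<close> is the only one whose state differs between \<open>S\<close> and \<open>S'\<close>.\<close>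

definition removal :: "nat set \<Rightarrow> nat set \<Rightarrow> nat \<Rightarrow> bool" where
  "removal S S' i \<longleftrightarrow> i \<in> S \<and> S' = S - {i}"

definition restoration :: "nat set \<Rightarrow> nat set \<Rightarrow> nat \<Rightarrow> bool" where
  "restoration S S' i \<longleftrightarrow> i \<notin> S \<and> S' = insert i S"

text \<open>The distance is \<open>\<infinity>\<close> (infimum of the empty set) when no path exists.\<close>

definition graph_dist :: "real mat \<Rightarrow> nat \<Rightarrow> nat \<Rightarrow> enat" where
  "graph_dist A i j = (INF n \<in> {n. (i, j) \<in>
     {(u, v). u < dim_row A \<and> v < dim_row A \<and> A $$ (u, v) \<noteq> 0} ^^ n}. enat n)"

definition max_degree :: "real mat \<Rightarrow> nat" where
  "max_degree A = Max ((\<lambda>i. card {j. j < dim_row A \<and> A $$ (i, j) \<noteq> 0}) ` {..<dim_row A})"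

text \<open>
  The spectrum is taken over the complex numbers; the condition says that it is real and that
  \<open>{a..b}\<close> is the least closed interval containing all the spectra.
\<close>
definition smallest_spectral_interval :: "real \<Rightarrow> real \<Rightarrow> real mat set \<Rightarrow> bool" where
  "smallest_spectral_interval a b \<M> \<longleftrightarrow>
     (let \<sigma> = (\<Union>M\<in>\<M>. spectrum (map_mat complex_of_real M))
      in \<sigma> \<subseteq> complex_of_real ` {a..b} \<and>
         (\<forall>a' b'. \<sigma> \<subseteq> complex_of_real ` {a'..b'} \<longrightarrow> {a..b} \<subseteq> {a'..b'}))"

text \<open>
  Power of a base in \<open>(0, 1)\<close> with an exponent in \<open>(-\<infinity>, \<infinity>]\<close>. The exponent is \<open>\<infinity>\<close> when some of the
  distances summed in it are infinite; the power is then \<open>0\<close>.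
\<close>
definition epowr :: "real \<Rightarrow> ereal \<Rightarrow> real" where
  "epowr x s = (if s = \<infinity> then 0 else x powr real_of_ereal s)"

end

theory Submission
  imports Defs
    "HOL-Analysis.Function_Topology"
begin

text \<open>
  Write \<open>K\<^sub>m = (1 - A\<^sub>m)\<^sup>-\<^sup>1\<close>. Back substitution gives the blocks \<open>z\<^sub>l = K\<^sub>l 1\<close> and
  \<open>z\<^sub>m = K\<^sub>m W\<^sub>m z\<^sub>m\<^sub>+\<^sub>1\<close> of block column \<open>l\<close> applied to the all-ones vector, and \<open>z\<^sub>k = X 1\<close>. As
  \<open>W\<^sub>m\<close> has rank two, \<open>z\<^sub>m\<close> depends on \<open>z\<^sub>m\<^sub>+\<^sub>1\<close> only through the pair of its entry at the changed edge
  \<open>i\<^sub>m\<close> and its inner product with the column \<open>a\<close> of that edge. The pairs of consecutive steps are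
  related by a matrix of size two whose entries are values of the resolvent form of one layer at
  unit vectors and columns. If the edge is absent from this layer, the other layer, whose spectrum
  also lies in \<open>[-c, c]\<close>, borders it by \<open>a\<close>; the discriminant of its quadratic form then bounds
  \<open>\<Sum> \<alpha>\<^sub>j\<^sup>2 / (c\<^sup>2 - e\<^sub>j\<^sup>2)\<close> by \<open>1\<close>, where \<open>\<alpha>\<^sub>j\<close> are the coordinates of \<open>a\<close> in an eigenbasis with
  eigenvalues \<open>e\<^sub>j\<close>. Since low powers of the layer cannot connect distant vertices, polynomials of
  Chebyshev type adapted to the weights \<open>1\<close>, \<open>sqrt (c\<^sup>2 - x\<^sup>2)\<close> and \<open>c\<^sup>2 - x\<^sup>2\<close> give the decay in
  the distance. Each edge contributes the factor \<open>sqrt (2 C)\<close> from the side where it is present and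
  \<open>sqrt (1 + \<alpha> gmax)\<close> from the side where it is absent, so that every step costs \<open>sqrt (2 (1 + \<alpha> gmax) C)\<close>.
\<close>

section \<open>Orthonormal eigenbases of real symmetric matrices\<close>

text \<open>The exponent \<open>d - 1\<close> is forced by two successive edges that are both absent
  from the layer between them. Their columns live on neighbours of the edges, so only the moments of
  order below \<open>d - 2\<close> vanish; the weighted bound on bordering columns regains one of
  the two lost powers. In the other cases the rate for \<open>d\<close> is at least as good, and one
  power goes into the constants. An edge changes its state at its step, so of the two layers around
  the step exactly one contains it; this is why the two kinds of factors always pair up. All layers
  are handled on the symmetric interval with \<open>c = 1 - a\<close>: nonnegativity of the layers
  controls the negative eigenvalues, so that \<open>b <= 1 + c\<close>. As \<open>C\<close>
  decreases in \<open>b\<close>, it is at least its value at \<open>b = 1 + c\<close>, which is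
  exactly the constant in Chebyshev's approximation of \<open>1 / (1 - x)\<close> on
  \<open>[-c, c]\<close>. The rate belonging to \<open>c\<close> is then enlarged to the one
  belonging to \<open>ca\<close>. Two cases escape the polynomials: \<open>c = 0\<close>, where the
  layers \<open>k..l\<close> vanish, and infinite distance, where a limit is taken.\<close>

definition dot :: "nat \<Rightarrow> (nat \<Rightarrow> real) \<Rightarrow> (nat \<Rightarrow> real) \<Rightarrow> real" where
  "dot N u v = (\<Sum>i<N. u i * v i)"

definition mapply :: "nat \<Rightarrow> (nat \<Rightarrow> nat \<Rightarrow> real) \<Rightarrow> (nat \<Rightarrow> real) \<Rightarrow> nat \<Rightarrow> real" where
  "mapply N A x i = (\<Sum>j<N. A i j * x j)"

lemma dot_commute: "dot N u v = dot N v u"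
  by (simp add: dot_def mult.commute)

lemma dot_add_right: "dot N u (\<lambda>i. v i + w i) = dot N u v + dot N u w"
  by (simp add: dot_def algebra_simps sum.distrib)

lemma dot_add_left: "dot N (\<lambda>i. v i + w i) u = dot N v u + dot N w u"
  by (simp add: dot_def algebra_simps sum.distrib)

lemma dot_diff_right: "dot N u (\<lambda>i. v i - w i) = dot N u v - dot N u w"
  by (simp add: dot_def algebra_simps sum_subtractf)

lemma dot_diff_left: "dot N (\<lambda>i. v i - w i) u = dot N v u - dot N w u"
  by (simp add: dot_def algebra_simps sum_subtractf)

lemma dot_scale_right: "dot N u (\<lambda>i. c * v i) = c * dot N u v"
  by (simp add: dot_def sum_distrib_left mult_ac)

lemma dot_scale_left: "dot N (\<lambda>i. c * v i) u = c * dot N v u"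
  by (simp add: dot_def sum_distrib_left mult_ac)

lemma dot_sum_right: "dot N u (\<lambda>i. \<Sum>k\<in>K. f k i) = (\<Sum>k\<in>K. dot N u (f k))"
  unfolding dot_def by (simp add: sum_distrib_left) (rule sum.swap)

lemma dot_sum_left: "dot N (\<lambda>i. \<Sum>k\<in>K. f k i) u = (\<Sum>k\<in>K. dot N (f k) u)"
  using dot_sum_right[of N u f K] by (simp add: dot_commute)

lemmas dot_linear = dot_add_left dot_add_right dot_diff_left dot_diff_right
  dot_scale_left dot_scale_right dot_sum_left dot_sum_right

lemma dot_cong:
  assumes "\<And>i. i < N \<Longrightarrow> u i = u' i" "\<And>i. i < N \<Longrightarrow> v i = v' i"
  shows "dot N u v = dot N u' v'"
  using assms by (simp add: dot_def)

lemma dot_self_nonneg: "0 \<le> dot N u u"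
  by (simp add: dot_def sum_nonneg)

lemma dot_self_eq_0: "dot N u u = 0 \<longleftrightarrow> (\<forall>i<N. u i = 0)"
  by (auto simp: dot_def sum_nonneg_eq_0_iff)

lemma dot_unit_right: "j < N \<Longrightarrow> dot N u (\<lambda>i. if i = j then c else 0) = u j * c"
  by (simp add: dot_def sum.delta' if_distrib cong: if_cong)

lemma dot_unit_left: "j < N \<Longrightarrow> dot N (\<lambda>i. if i = j then c else 0) u = c * u j"
  by (simp add: dot_commute[of N _ u] dot_unit_right)

lemma mapply_add: "mapply N A (\<lambda>i. x i + y i) = (\<lambda>i. mapply N A x i + mapply N A y i)"
  by (rule ext) (simp add: mapply_def algebra_simps sum.distrib)

lemma mapply_diff: "mapply N A (\<lambda>i. x i - y i) = (\<lambda>i. mapply N A x i - mapply N A y i)"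
  by (rule ext) (simp add: mapply_def algebra_simps sum_subtractf)

lemma mapply_scale: "mapply N A (\<lambda>i. c * x i) = (\<lambda>i. c * mapply N A x i)"
  by (rule ext) (simp add: mapply_def sum_distrib_left mult_ac)

lemma mapply_cong: "(\<And>i. i < N \<Longrightarrow> x i = y i) \<Longrightarrow> mapply N A x = mapply N A y"
  by (rule ext) (simp add: mapply_def)

lemma dot_mapply_sym:
  assumes "\<And>i j. i < N \<Longrightarrow> j < N \<Longrightarrow> A i j = A j i"
  shows "dot N u (mapply N A v) = dot N (mapply N A u) v"
proof -
  have "dot N u (mapply N A v) = (\<Sum>i<N. \<Sum>j<N. u i * A i j * v j)"
    by (simp add: dot_def mapply_def sum_distrib_left mult_ac)
  also have "\<dots> = (\<Sum>j<N. \<Sum>i<N. u i * A i j * v j)" by (rule sum.swap)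
  also have "\<dots> = dot N (mapply N A u) v"
    unfolding dot_def mapply_def sum_distrib_right
    by (intro sum.cong refl) (simp add: assms mult_ac)
  finally show ?thesis .
qed

text \<open>First-order optimality: along \<open>t = - s * b\<close> with small \<open>s\<close> the
  linear term dominates. It turns the maximality of a Rayleigh quotient into an eigenvalue
  equation.\<close>

lemma linear_coeff_zero:
  fixes b c :: real
  assumes "\<And>t. 0 \<le> 2 * t * b + t\<^sup>2 * c"
  shows "b = 0"
proof (rule ccontr)
  assume b: "b \<noteq> 0"
  define s where "s = 1 / (\<bar>c\<bar> + 1)"
  have s: "0 < s" "s * c < 1" by (auto simp: s_def divide_simps)
  have "0 \<le> b\<^sup>2 * s * (s * c - 2)"
    using assms[of "- s * b"] by (simp add: power2_eq_square algebra_simps)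
  moreover have "b\<^sup>2 * s * (s * c - 2) < 0"
    using b s by (intro mult_pos_neg) auto
  ultimately show False by simp
qed

lemma quadratic_discriminant_le:
  fixes p b q :: real
  assumes "\<And>t. 0 \<le> p * t\<^sup>2 + 2 * t * b + q" "0 < p"
  shows "b\<^sup>2 \<le> p * q"
proof -
  have "0 \<le> p * (p * (- b / p)\<^sup>2 + 2 * (- b / p) * b + q)"
    using assms(1)[of "- b / p"] assms(2) by (intro mult_nonneg_nonneg) auto
  also have "\<dots> = p * q - b\<^sup>2"
    using assms(2) by (simp add: field_simps power2_eq_square)
  finally show ?thesis by simp
qed

lemma continuous_on_coordinate: "continuous_on S (\<lambda>x :: nat \<Rightarrow> real. x i)"
  by (rule continuous_on_subset[OF continuous_on_product_coordinates]) simp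

text \<open>Vectors are functions on all of \<open>nat\<close>; forcing the coordinates from
  \<open>N\<close> on to be zero makes the set a closed subset of a product of compact intervals, so
  that Tychonoff applies.\<close>

lemma compact_orthogonal_sphere:
  "compact {x. (\<forall>i\<ge>N. x i = 0) \<and> dot N x x = 1 \<and> (\<forall>k<K. dot N (q k) x = 0)}"
proof -
  let ?S = "{x. (\<forall>i\<ge>N. x i = 0) \<and> dot N x x = 1 \<and> (\<forall>k<K. dot N (q k) x = 0)}"
  define X where "X i = (if i < N then {-1..1} else {0 :: real})" for i
  let ?F = "{x. dot N x x = 1} \<inter> (\<Inter>k\<in>{..<K}. {x. dot N (q k) x = 0})"
  have "compactin (product_topology (\<lambda>i. euclidean) UNIV) (PiE UNIV X)"
    by (auto simp: compactin_PiE X_def compactin_euclidean_iff)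
  hence comp: "compact (PiE UNIV X)"
    by (simp add: euclidean_product_topology compactin_euclidean_iff)
  have "closed ?F"
    unfolding dot_def
    by (intro closed_Int closed_INT ballI closed_Collect_eq continuous_intros
        continuous_on_coordinate)
  moreover have "?S = PiE UNIV X \<inter> ?F"
  proof (rule Set.set_eqI)
    fix x
    have "\<bar>x i\<bar> \<le> 1" if "dot N x x = 1" "i < N" for i
    proof -
      have "x i * x i \<le> dot N x x"
        unfolding dot_def using that(2) by (intro member_le_sum) auto
      hence "(x i)\<^sup>2 \<le> 1" using that(1) by (simp add: power2_eq_square)
      thus ?thesis by (simp add: abs_square_le_1)
    qed
    hence "(\<forall>i<N. - 1 \<le> x i \<and> x i \<le> 1)" if "dot N x x = 1"
      using that by (metis abs_le_iff minus_le_iff)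
    thus "x \<in> ?S \<longleftrightarrow> x \<in> PiE UNIV X \<inter> ?F"
      by (auto simp: X_def PiE_iff split: if_splits)
  qed
  ultimately show ?thesis using comp by (simp add: compact_Int_closed)
qed

text \<open>The squared lengths of the projections of the \<open>N\<close> standard unit vectors
  onto the span of the \<open>q k\<close> add up to \<open>K < N\<close>, so one of them is shorter
  than 1. The rest of that unit vector is nonzero and orthogonal to the span.\<close>

lemma exists_orthogonal_unit:
  assumes orth: "\<And>k l. k < K \<Longrightarrow> l < K \<Longrightarrow> dot N (q k) (q l) = of_bool (k = l)"
    and "K < N"
  shows "\<exists>x. (\<forall>i\<ge>N. x i = 0) \<and> dot N x x = 1 \<and> (\<forall>k<K. dot N (q k) x = 0)"
proof -
  have "(\<Sum>i<N. \<Sum>k<K. q k i * q k i) = (\<Sum>k<K. dot N (q k) (q k))"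
    unfolding dot_def by (rule sum.swap)
  also have "\<dots> = real K" by (simp add: orth)
  also have "\<dots> < (\<Sum>i<N. 1)" using assms(2) by simp
  finally obtain i where i: "i < N" "(\<Sum>k<K. q k i * q k i) < 1"
    by (metis (no_types, lifting) lessThan_iff linorder_not_less sum_mono)
  define v where "v j = (if j = i then 1 else 0) - (\<Sum>k<K. q k i * q k j)" for j
  have v: "v = (\<lambda>j. (if j = i then 1 else 0) - (\<Sum>k<K. q k i * q k j))"
    by (rule ext) (simp add: v_def)
  have vq: "dot N (q k) v = 0" if "k < K" for k
  proof -
    have "dot N (q k) v = q k i - (\<Sum>l<K. q l i * dot N (q k) (q l))"
      unfolding v by (simp add: dot_linear dot_unit_right i)
    also have "(\<Sum>l<K. q l i * dot N (q k) (q l)) = (\<Sum>l<K. if l = k then q l i else 0)"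
      using that by (intro sum.cong refl) (auto simp: orth)
    finally show ?thesis using that by simp
  qed
  have "dot N v v = dot N (\<lambda>j. if j = i then 1 else 0) v - (\<Sum>k<K. q k i * dot N (q k) v)"
    unfolding v by (simp only: dot_diff_left dot_sum_left dot_scale_left)
  also have "\<dots> = v i" using i vq by (simp add: dot_unit_left)
  also have "\<dots> > 0" using i by (simp add: v_def)
  finally have pos: "dot N v v > 0" .
  define x where "x j = (if j < N then 1 / sqrt (dot N v v) * v j else 0)" for j
  have x: "dot N u x = dot N u v / sqrt (dot N v v)" for u
    using dot_scale_right[of N u "1 / sqrt (dot N v v)" v]
    by (simp add: x_def dot_def)
  have "dot N x x = 1"
    using pos by (simp add: x dot_commute[of N x v])
  thus ?thesis
    by (intro exI[of _ x]) (auto simp: x vq x_def)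
qed

text \<open>A maximiser \<open>x\<close> of the Rayleigh quotient on the orthogonal complement of
  the known eigenvectors is an eigenvector: the residual \<open>y = A x - r x\<close> stays in that
  complement, and the first variation in direction \<open>y\<close> is a multiple of
  \<open>dot N y y\<close>.\<close>

lemma exists_orthogonal_eigenvector:
  assumes sym: "\<And>i j. i < N \<Longrightarrow> j < N \<Longrightarrow> A i j = A j i"
    and orth: "\<And>k l. k < K \<Longrightarrow> l < K \<Longrightarrow> dot N (q k) (q l) = of_bool (k = l)"
    and eig: "\<And>k i. k < K \<Longrightarrow> i < N \<Longrightarrow> mapply N A (q k) i = e k * q k i"
    and "K < N"
  shows "\<exists>x r. dot N x x = 1 \<and> (\<forall>k<K. dot N (q k) x = 0) \<and> (\<forall>i<N. mapply N A x i = r * x i)"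
proof -
  let ?S = "{x. (\<forall>i\<ge>N. x i = 0) \<and> dot N x x = 1 \<and> (\<forall>k<K. dot N (q k) x = 0)}"
  have "continuous_on ?S (\<lambda>x. dot N x (mapply N A x))"
    unfolding dot_def mapply_def by (intro continuous_intros continuous_on_coordinate)
  moreover have "?S \<noteq> {}" using exists_orthogonal_unit[OF orth assms(4)] by blast
  ultimately have "\<exists>x\<in>?S. \<forall>y\<in>?S. dot N y (mapply N A y) \<le> dot N x (mapply N A x)"
    by (intro continuous_attains_sup[OF compact_orthogonal_sphere])
  then obtain x where x: "x \<in> ?S"
    and max: "\<And>y. y \<in> ?S \<Longrightarrow> dot N y (mapply N A y) \<le> dot N x (mapply N A x)"
    by blast
  define r where "r = dot N x (mapply N A x)"
  have rayleigh: "dot N v (mapply N A v) \<le> r * dot N v v"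
    if v: "\<And>k. k < K \<Longrightarrow> dot N (q k) v = 0" for v
  proof (cases "dot N v v = 0")
    case True
    hence "\<forall>i<N. v i = 0" by (simp add: dot_self_eq_0)
    hence "dot N v (mapply N A v) = 0" by (simp add: dot_def)
    thus ?thesis using True by simp
  next
    case False
    hence pos: "dot N v v > 0" using dot_self_nonneg[of N v] by linarith
    define c where "c = 1 / sqrt (dot N v v)"
    have cc: "c * c * dot N v v = 1" using pos by (simp add: c_def)
    define u where "u j = (if j < N then c * v j else 0)" for j
    have u: "dot N w u = c * dot N w v" for w
      using dot_scale_right[of N w c v] by (simp add: u_def dot_def)
    have "mapply N A u = (\<lambda>i. c * mapply N A v i)"
      using mapply_cong[of N u "\<lambda>i. c * v i" A] by (simp add: u_def mapply_scale)
    hence "dot N u (mapply N A u) = c * c * dot N v (mapply N A v)"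
      by (simp add: dot_linear dot_commute[of N u] u dot_commute[of N _ v])
    moreover have "u \<in> ?S"
      using cc by (auto simp: u v dot_commute[of N u v] mult_ac) (auto simp: u_def)
    ultimately have "c * c * dot N v (mapply N A v) \<le> r"
      using max[of u] by (simp add: r_def)
    hence "(c * c * dot N v (mapply N A v)) * dot N v v \<le> r * dot N v v"
      using pos by (intro mult_right_mono) auto
    moreover have "(c * c * dot N v (mapply N A v)) * dot N v v
        = dot N v (mapply N A v) * (c * c * dot N v v)"
      by (simp only: mult_ac)
    ultimately show ?thesis by (simp add: cc)
  qed
  define y where "y i = mapply N A x i - r * x i" for i
  have y: "y = (\<lambda>i. mapply N A x i - r * x i)" by (rule ext) (simp add: y_def)
  have qy: "dot N (q k) y = 0" if "k < K" for k
  proof -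
    have "dot N (q k) (mapply N A x) = dot N (mapply N A (q k)) x"
      by (rule dot_mapply_sym[OF sym])
    also have "\<dots> = dot N (\<lambda>i. e k * q k i) x"
      using eig that by (intro dot_cong) auto
    also have "\<dots> = 0" using x that by (simp add: dot_linear)
    finally show ?thesis using x that unfolding y by (simp add: dot_linear)
  qed
  have "0 \<le> 2 * t * (- dot N y y) + t\<^sup>2 * (r * dot N y y - dot N y (mapply N A y))" for t
  proof -
    let ?v = "\<lambda>i. x i + t * y i"
    have "dot N ?v (mapply N A ?v) \<le> r * dot N ?v ?v"
      using x qy by (intro rayleigh) (simp add: dot_linear)
    moreover have "dot N ?v ?v = 1 + 2 * t * dot N x y + t\<^sup>2 * dot N y y"
      using x by (simp add: dot_linear dot_commute[of N y x] power2_eq_square algebra_simps)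
    moreover have Axy: "dot N y (mapply N A x) = dot N y y + r * dot N x y"
      using dot_diff_right[of N y "mapply N A x" "\<lambda>i. r * x i"]
      by (simp add: dot_scale_right dot_commute[of N x y] flip: y)
    have "dot N ?v (mapply N A ?v)
        = r + 2 * t * (dot N y y + r * dot N x y) + t\<^sup>2 * dot N y (mapply N A y)"
    proof -
      have "dot N x (mapply N A y) = dot N y (mapply N A x)"
        using dot_mapply_sym[OF sym, where u = x and v = y] by (simp add: dot_commute)
      thus ?thesis
        unfolding mapply_add mapply_scale dot_linear r_def[symmetric] Axy
        by (simp add: power2_eq_square algebra_simps)
    qed
    ultimately have "r + 2 * t * (dot N y y + r * dot N x y) + t\<^sup>2 * dot N y (mapply N A y)
        \<le> r * (1 + 2 * t * dot N x y + t\<^sup>2 * dot N y y)" by simp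
    thus ?thesis by (simp add: algebra_simps)
  qed
  hence "dot N y y = 0" using linear_coeff_zero by fastforce
  hence "\<forall>i<N. mapply N A x i = r * x i" by (simp add: dot_self_eq_0 y_def)
  thus ?thesis using x by blast
qed

definition eigenbasis ::
  "nat \<Rightarrow> (nat \<Rightarrow> nat \<Rightarrow> real) \<Rightarrow> (nat \<Rightarrow> real) \<Rightarrow> (nat \<Rightarrow> nat \<Rightarrow> real) \<Rightarrow> bool" where
  "eigenbasis N A e q \<longleftrightarrow>
     (\<forall>k<N. \<forall>l<N. dot N (q k) (q l) = of_bool (k = l)) \<and>
     (\<forall>k<N. \<forall>i<N. mapply N A (q k) i = e k * q k i)"

lemma exists_eigenbasis:
  assumes sym: "\<And>i j. i < N \<Longrightarrow> j < N \<Longrightarrow> A i j = A j i"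
  shows "\<exists>e q. eigenbasis N A e q"
proof -
  have "\<exists>e q. (\<forall>k<K. \<forall>l<K. dot N (q k) (q l) = of_bool (k = l)) \<and>
      (\<forall>k<K. \<forall>i<N. mapply N A (q k) i = e k * q k i)" if "K \<le> N" for K
    using that
  proof (induction K)
    case 0
    show ?case by simp
  next
    case (Suc K)
    from Suc.IH[OF Suc_leD[OF Suc.prems]]
    obtain e q where IH: "\<And>k l. k < K \<Longrightarrow> l < K \<Longrightarrow> dot N (q k) (q l) = of_bool (k = l)"
      "\<And>k i. k < K \<Longrightarrow> i < N \<Longrightarrow> mapply N A (q k) i = e k * q k i" by metis
    have "K < N" using Suc.prems by simp
    hence "\<exists>x r. dot N x x = 1 \<and> (\<forall>k<K. dot N (q k) x = 0) \<and>
        (\<forall>i<N. mapply N A x i = r * x i)"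
      using exists_orthogonal_eigenvector[where A = A and q = q and e = e] sym IH by presburger
    then obtain x r where x: "dot N x x = 1" "\<And>k. k < K \<Longrightarrow> dot N (q k) x = 0"
      "\<And>i. i < N \<Longrightarrow> mapply N A x i = r * x i" by blast
    have "dot N x (q k) = 0" if "k < K" for k
      using x(2)[OF that] by (simp add: dot_commute)
    with IH x show ?case
      by (intro exI[of _ "e(K := r)"] exI[of _ "q(K := x)"]) (simp add: less_Suc_eq all_conj_distrib)
  qed
  thus ?thesis unfolding eigenbasis_def by blast
qed

text \<open>Orthonormal rows of a square matrix imply orthonormal columns, since a right inverse is
  a left inverse.\<close>

lemma eigenbasis_complete:
  assumes "eigenbasis N A e q" "i < N" "j < N"
  shows "(\<Sum>k<N. q k i * q k j) = of_bool (i = j)"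
proof -
  define Q where "Q = mat N N (\<lambda>(k, i). q k i)"
  have Q: "Q \<in> carrier_mat N N" "transpose_mat Q \<in> carrier_mat N N" by (auto simp: Q_def)
  have "Q * transpose_mat Q = 1\<^sub>m N"
    using assms(1)
    by (intro eq_matI) (auto simp: Q_def eigenbasis_def dot_def scalar_prod_def atLeast0LessThan)
  hence "transpose_mat Q * Q = 1\<^sub>m N" by (rule mat_mult_left_right_inverse[OF Q])
  hence "(transpose_mat Q * Q) $$ (i, j) = of_bool (i = j)" using assms by simp
  thus ?thesis using assms by (simp add: Q_def scalar_prod_def atLeast0LessThan)
qed

section \<open>Polynomials of Chebyshev type on a symmetric interval\<close>

text \<open>This is the root \<open>r < 1\<close> of \<open>1 / c = (r + 1 / r) / 2\<close> (inverse
  Joukowski map): Chebyshev polynomials on \<open>[-c, c]\<close> grow like \<open>1 / r ^ n\<close>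
  at the point 1.\<close>

definition chebyshev_rate :: "real \<Rightarrow> real" where
  "chebyshev_rate c = (sqrt ((1 + c) / (1 - c)) - 1) / (sqrt ((1 + c) / (1 - c)) + 1)"

lemma chebyshev_rate_bounds:
  assumes "0 < c" "c < 1"
  shows "0 < chebyshev_rate c" "chebyshev_rate c < 1"
proof -
  define s where "s = sqrt ((1 + c) / (1 - c))"
  have "1 < s" using assms by (simp add: s_def field_simps)
  thus "0 < chebyshev_rate c" "chebyshev_rate c < 1"
    by (simp_all add: chebyshev_rate_def flip: s_def)
qed

lemma chebyshev_rate_eq:
  assumes "0 < c" "c < 1"
  shows "c = 2 * chebyshev_rate c / (1 + (chebyshev_rate c)\<^sup>2)"
proof -
  define s where "s = sqrt ((1 + c) / (1 - c))"
  have s2: "s\<^sup>2 = (1 + c) / (1 - c)" and s0: "s > 0" using assms by (auto simp: s_def)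
  have rate: "chebyshev_rate c = (s - 1) / (s + 1)" by (simp add: chebyshev_rate_def s_def)
  have "1 + (chebyshev_rate c)\<^sup>2 = 2 * (s\<^sup>2 + 1) / (s + 1)\<^sup>2"
    using s0 unfolding rate power_divide by (simp add: add_divide_eq_iff)
      (simp add: power2_eq_square algebra_simps)
  hence "2 * chebyshev_rate c / (1 + (chebyshev_rate c)\<^sup>2)
      = 2 * ((s - 1) / (s + 1) * (s + 1)\<^sup>2) / (2 * (s\<^sup>2 + 1))"
    by (simp add: rate)
  also have "(s - 1) / (s + 1) * (s + 1)\<^sup>2 = s\<^sup>2 - 1"
  proof -
    have "(s - 1) / (s + 1) * (s + 1)\<^sup>2 = (s - 1) * (s + 1)"
      using s0 by (simp add: power2_eq_square)
    thus ?thesis by (simp add: power2_eq_square algebra_simps)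
  qed
  also have "2 * (s\<^sup>2 - 1) / (2 * (s\<^sup>2 + 1)) = (s\<^sup>2 - 1) / (s\<^sup>2 + 1)"
    by (rule mult_divide_mult_cancel_left) simp
  also have "\<dots> = c" using assms unfolding s2 by (simp add: field_simps)
  finally show ?thesis by simp
qed

lemma chebyshev_rate_mono:
  assumes "0 \<le> c" "c \<le> d" "d < 1"
  shows "chebyshev_rate c \<le> chebyshev_rate d"
proof -
  have "(1 + c) / (1 - c) \<le> (1 + d) / (1 - d)" using assms by (simp add: frac_le)
  hence le: "sqrt ((1 + c) / (1 - c)) \<le> sqrt ((1 + d) / (1 - d))" by simp
  have "(s - 1) / (s + 1) \<le> (t - 1) / (t + 1)" if "0 \<le> s" "s \<le> t" for s t :: real
    using that by (simp add: divide_simps algebra_simps)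
  from this[OF _ le] show ?thesis using assms by (simp add: chebyshev_rate_def)
qed

text \<open>The Chebyshev recurrence in the variable \<open>x / c\<close>, with free initial
  polynomials so that one recursion serves all three weights.\<close>

fun cheb :: "real \<Rightarrow> real poly \<Rightarrow> real poly \<Rightarrow> nat \<Rightarrow> real poly" where
  "cheb c P Q 0 = P"
| "cheb c P Q (Suc 0) = Q"
| "cheb c P Q (Suc (Suc n)) = [:0, 2 / c:] * cheb c P Q (Suc n) - cheb c P Q n"

lemma degree_cheb:
  assumes "degree P \<le> d" "degree Q \<le> Suc d"
  shows "degree (cheb c P Q n) \<le> d + n"
proof -
  have "degree (cheb c P Q n) \<le> d + n \<and> degree (cheb c P Q (Suc n)) \<le> Suc (d + n)"
  proof (induction n)
    case (Suc n)
    have "degree ([:0, 2 / c:] * cheb c P Q (Suc n)) \<le> Suc (Suc (d + n))"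
      using degree_mult_le[of "[:0, 2 / c:]" "cheb c P Q (Suc n)"] Suc by (simp split: if_splits)
    with Suc show ?case by (simp add: degree_diff_le)
  qed (use assms in simp)
  thus ?thesis ..
qed

text \<open>The factor \<open>s\<close> is 1 for real parts and \<open>sin t\<close> for imaginary
  parts; it avoids dividing by \<open>sin t\<close>.\<close>

lemma poly_cheb:
  assumes "c \<noteq> 0" "s * poly P (c * y) = f 0" "s * poly Q (c * y) = f 1"
    and rec: "\<And>n. f (n + 2) = 2 * y * f (n + 1) - f n"
  shows "s * poly (cheb c P Q n) (c * y) = f n"
proof -
  have "s * poly (cheb c P Q n) (c * y) = f n \<and> s * poly (cheb c P Q (Suc n)) (c * y) = f (Suc n)"
  proof (induction n)
    case (Suc n)
    thus ?case using assms(1) rec[of n] by (simp add: algebra_simps)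
  qed (use assms in simp)
  thus ?thesis ..
qed

text \<open>At \<open>x = 1\<close> the recurrence has the solutions \<open>r ^ n\<close> and
  \<open>1 / r ^ n\<close>; the condition on \<open>P\<close> and \<open>Q\<close> removes the
  decaying one.\<close>

lemma poly_cheb_at_1:
  assumes "0 < r" "c = 2 * r / (1 + r\<^sup>2)" "poly P 1 = r * poly Q 1"
  shows "poly (cheb c P Q n) 1 = poly P 1 / r ^ n"
proof -
  have c: "c \<noteq> 0" using assms by (simp add: add_pos_nonneg less_imp_neq[symmetric])
  have y: "1 / c = (1 + r\<^sup>2) / (2 * r)" using assms by simp
  have "1 * poly (cheb c P Q n) (c * (1 / c)) = poly P 1 / r ^ n"
  proof (rule poly_cheb[OF c])
    show "1 * poly Q (c * (1 / c)) = poly P 1 / r ^ 1" using assms c by simp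
  next
    fix n
    show "poly P 1 / r ^ (n + 2) = 2 * (1 / c) * (poly P 1 / r ^ (n + 1)) - poly P 1 / r ^ n"
      unfolding y using assms(1) by (simp add: field_simps power2_eq_square)
  qed (use c in simp)
  thus ?thesis using c by simp
qed

lemma cos_recurrence: "cos (a + 2 * t) = 2 * cos t * cos (a + t) - cos (a :: real)"
proof -
  have "cos ((a + t) + t) + cos ((a + t) - t) = 2 * cos t * cos (a + t)"
    unfolding cos_add[of "a + t" t] cos_diff[of "a + t" t] by simp
  thus ?thesis by (simp add: algebra_simps)
qed

lemma sin_recurrence: "sin (a + 2 * t) = 2 * cos t * sin (a + t) - sin (a :: real)"
proof -
  have "sin ((a + t) + t) + sin ((a + t) - t) = 2 * cos t * sin (a + t)"
    unfolding sin_add[of "a + t" t] sin_diff[of "a + t" t] by simp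
  thus ?thesis by (simp add: algebra_simps)
qed

lemma abs_cos_sin_combination_le:
  fixes a u v D :: real
  assumes "u\<^sup>2 + v\<^sup>2 = D\<^sup>2" "0 \<le> D"
  shows "\<bar>cos a * u + sin a * v\<bar> \<le> D"
proof -
  have "(x * u + y * v)\<^sup>2 + (x * v - y * u)\<^sup>2 = (x\<^sup>2 + y\<^sup>2) * (u\<^sup>2 + v\<^sup>2)" for x y
    by (simp add: power2_eq_square algebra_simps)
  from this[of "cos a" "sin a"]
  have "(cos a * u + sin a * v)\<^sup>2 + (cos a * v - sin a * u)\<^sup>2 = D\<^sup>2" by (simp add: assms(1) sin_cos_squared_add2)
  hence "(cos a * u + sin a * v)\<^sup>2 \<le> D\<^sup>2" by (smt (verit) zero_le_power2)
  thus ?thesis using assms(2) by (metis abs_le_square_iff abs_of_nonneg)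
qed

text \<open>
  With \<open>c = 2 r / (1 + r\<^sup>2)\<close> and \<open>x = c cos t\<close> one has \<open>(1 + r\<^sup>2) (1 - x) = \<bar>exp (i t) - r\<bar>\<^sup>2\<close>. The
  polynomials below are the real or imaginary parts (the latter divided by \<open>sin t\<close>) of
  \<open>exp (i a) (exp (i t) - r)\<^sup>2\<close> and \<open>exp (i a) (exp (i t) - r)\<close>, with \<open>a\<close> a multiple of \<open>t\<close>.
\<close>
locale chebyshev_interval =
  fixes c r :: real
  assumes r: "0 < r" "r < 1" and c_eq: "c = 2 * r / (1 + r\<^sup>2)"
begin

lemma one_plus_r2: "1 + r\<^sup>2 > 0" by (simp add: add_pos_nonneg)

lemma c_pos: "0 < c" using r one_plus_r2 by (simp add: c_eq)

lemma c_less_1: "c < 1"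
proof -
  have "0 < (1 - r)\<^sup>2" using r by simp
  hence "2 * r < 1 + r\<^sup>2" by (simp add: power2_eq_square algebra_simps)
  thus ?thesis using one_plus_r2 by (simp add: c_eq)
qed

definition gap :: "real \<Rightarrow> real" where "gap t = 1 - 2 * r * cos t + r\<^sup>2"

lemma gap_eq: "(1 + r\<^sup>2) * (1 - c * cos t) = gap t"
  using one_plus_r2 by (simp add: c_eq gap_def field_simps)

lemma gap_sum_squares: "gap t = (cos t - r)\<^sup>2 + (sin t)\<^sup>2"
proof -
  have "(cos t - r)\<^sup>2 + (sin t)\<^sup>2 = ((cos t)\<^sup>2 + (sin t)\<^sup>2) - 2 * r * cos t + r\<^sup>2"
    by (simp add: power2_eq_square algebra_simps)
  thus ?thesis by (simp add: gap_def)
qed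

lemma gap_nonneg: "0 \<le> gap t" by (simp add: gap_sum_squares)

text \<open>\<open>u\<close> and \<open>v\<close> are the real and imaginary parts of the square of
  \<open>exp (i t) - r\<close>, whose modulus is \<open>gap t\<close>.\<close>

lemma double_bound:
  defines "u \<equiv> \<lambda>t. (cos t - r)\<^sup>2 - (sin t)\<^sup>2" and "v \<equiv> \<lambda>t. 2 * sin t * (cos t - r)"
  shows "(u t)\<^sup>2 + (v t)\<^sup>2 = (gap t)\<^sup>2"
proof -
  have "(x\<^sup>2 - y\<^sup>2)\<^sup>2 + (2 * y * x)\<^sup>2 = (x\<^sup>2 + y\<^sup>2)\<^sup>2" for x y :: real
    by (simp add: power2_eq_square algebra_simps)
  thus ?thesis unfolding gap_sum_squares u_def v_def .
qed

lemma cos_arccos_cover: "\<bar>x\<bar> \<le> c \<Longrightarrow> \<exists>t. x = c * cos t"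
  using c_pos by (intro exI[of _ "arccos (x / c)"]) (simp add: abs_le_iff field_simps)

text \<open>The values on \<open>[-c, c]\<close> are the real parts for the angle
  \<open>a = (n - 2) t\<close>. Divided by \<open>(1 - x) * poly R 1\<close>, this is the error of
  Chebyshev's classical approximation of \<open>1 / (1 - x)\<close> in degree
  \<open>n - 1\<close>.\<close>

lemma exists_poly_T:
  assumes "1 \<le> n"
  shows "\<exists>R. degree R \<le> n \<and> poly R 1 = (1 - r\<^sup>2)\<^sup>2 / (2 * r ^ n) \<and>
    (\<forall>x. \<bar>x\<bar> \<le> c \<longrightarrow> \<bar>poly R x\<bar> \<le> (1 + r\<^sup>2) * (1 - x))"
proof -
  obtain m where n: "n = Suc m" using assms by (cases n) auto
  define P where "P = [:- 2 * r, (1 + r\<^sup>2) / c:]"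
  define Q where "Q = [:r\<^sup>2 - 1, - 2 * r / c, 2 / c\<^sup>2:]"
  have c2: "c * (1 + r\<^sup>2) = 2 * r" and c0: "c \<noteq> 0"
    using c_pos one_plus_r2 by (auto simp: c_eq)
  have inv: "1 / c = (1 + r\<^sup>2) / (2 * r)" by (simp add: c_eq)
  have P1: "poly P 1 = (1 - r\<^sup>2)\<^sup>2 / (2 * r)"
  proof -
    have "poly P 1 = (1 + r\<^sup>2) * (1 / c) - 2 * r" by (simp add: P_def)
    also have "\<dots> = (1 - r\<^sup>2)\<^sup>2 / (2 * r)"
      unfolding inv using r by (simp add: field_simps power2_eq_square)
    finally show ?thesis .
  qed
  have Q1: "r * poly Q 1 = poly P 1"
  proof -
    have "poly Q 1 = r\<^sup>2 - 1 - 2 * r * (1 / c) + 2 * (1 / c)\<^sup>2"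
      by (simp add: Q_def power_divide)
    also have "\<dots> = (1 - r\<^sup>2)\<^sup>2 / (2 * r\<^sup>2)"
      unfolding inv power_divide using r by (simp add: field_simps power2_eq_square)
    finally show ?thesis using r by (simp add: P1 power2_eq_square)
  qed
  have "degree (cheb c P Q m) \<le> 1 + m"
    by (rule degree_cheb) (auto simp: P_def Q_def)
  moreover have "poly (cheb c P Q m) 1 = (1 - r\<^sup>2)\<^sup>2 / (2 * r ^ n)"
    using poly_cheb_at_1[OF r(1) c_eq Q1[symmetric], of m] P1 by (simp add: n mult_ac)
  moreover have "\<bar>poly (cheb c P Q m) x\<bar> \<le> (1 + r\<^sup>2) * (1 - x)" if x: "\<bar>x\<bar> \<le> c" for x
  proof -
    obtain t where t: "x = c * cos t" using cos_arccos_cover[OF x] by blast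
    define g where "g a = cos (a + 2 * t) - 2 * r * cos (a + t) + r\<^sup>2 * cos a" for a
    have g_rec: "g (a + 2 * t) = 2 * cos t * g (a + t) - g a" for a
    proof -
      have 1: "cos (a + 2 * t + 2 * t) = 2 * cos t * cos (a + t + 2 * t) - cos (a + 2 * t)"
        using cos_recurrence[of "a + 2 * t" t] by (simp add: algebra_simps)
      have 2: "cos (a + 2 * t + t) = 2 * cos t * cos (a + t + t) - cos (a + t)"
        using cos_recurrence[of "a + t" t] by (simp add: algebra_simps)
      show ?thesis
        unfolding g_def 1 2 cos_recurrence[of a t] by (simp add: algebra_simps)
    qed
    have g_bound: "\<bar>g a\<bar> \<le> gap t" for a
    proof -
      have "g a = cos a * ((cos t - r)\<^sup>2 - (sin t)\<^sup>2) + sin a * - (2 * sin t * (cos t - r))"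
        unfolding g_def cos_add mult_2 sin_add by (simp add: power2_eq_square algebra_simps)
      thus ?thesis
        using double_bound[of t] by (simp only: abs_cos_sin_combination_le gap_nonneg power2_minus)
    qed
    have "1 * poly (cheb c P Q m) (c * cos t) = g (real m * t - t)"
    proof (rule poly_cheb[OF c0])
      show "1 * poly P (c * cos t) = g (real 0 * t - t)"
        using c0 by (simp add: P_def g_def field_simps)
      show "1 * poly Q (c * cos t) = g (real 1 * t - t)"
        using c0 cos_double_cos[of t] by (simp add: Q_def g_def power2_eq_square algebra_simps)
      fix k
      show "g (real (k + 2) * t - t) = 2 * cos t * g (real (k + 1) * t - t) - g (real k * t - t)"
        using g_rec[of "real k * t - t"] by (simp add: algebra_simps)
    qed
    thus ?thesis using g_bound t gap_eq[of t] by simp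
  qed
  ultimately show ?thesis by (intro exI[of _ "cheb c P Q m"]) (simp add: n)
qed

text \<open>Imaginary parts, for \<open>a = (n - 1) t\<close>: with \<open>x = c cos t\<close> the
  weight \<open>sqrt (c^2 - x^2)\<close> equals \<open>c * abs (sin t)\<close> and pays for the
  division by \<open>sin t\<close>.\<close>

lemma exists_poly_U:
  "\<exists>R. degree R \<le> n \<and> poly R 1 = (1 - r\<^sup>2) / r ^ n \<and>
    (\<forall>x. \<bar>x\<bar> \<le> c \<longrightarrow> \<bar>poly R x\<bar> * sqrt (c\<^sup>2 - x\<^sup>2) \<le> c * ((1 + r\<^sup>2) * (1 - x)))"
proof -
  define P where "P = [:1 - r\<^sup>2:]"
  define Q where "Q = [:- 2 * r, 2 / c:]"
  have c0: "c \<noteq> 0" using c_pos by simp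
  have inv: "1 / c = (1 + r\<^sup>2) / (2 * r)" by (simp add: c_eq)
  have "poly Q 1 = 2 * (1 / c) - 2 * r" by (simp add: Q_def)
  also have "\<dots> = (1 - r\<^sup>2) / r"
    unfolding inv using r by (simp add: field_simps power2_eq_square)
  finally have Q1: "poly P 1 = r * poly Q 1" using r by (simp add: P_def)
  have "degree (cheb c P Q n) \<le> 0 + n"
    by (rule degree_cheb) (auto simp: P_def Q_def)
  moreover have "poly (cheb c P Q n) 1 = (1 - r\<^sup>2) / r ^ n"
    using poly_cheb_at_1[OF r(1) c_eq Q1, of n] by (simp add: P_def)
  moreover have "\<bar>poly (cheb c P Q n) x\<bar> * sqrt (c\<^sup>2 - x\<^sup>2) \<le> c * ((1 + r\<^sup>2) * (1 - x))"
    if x: "\<bar>x\<bar> \<le> c" for x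
  proof -
    obtain t where t: "x = c * cos t" using cos_arccos_cover[OF x] by blast
    define g where "g a = sin (a + 2 * t) - 2 * r * sin (a + t) + r\<^sup>2 * sin a" for a
    have g_rec: "g (a + 2 * t) = 2 * cos t * g (a + t) - g a" for a
    proof -
      have 1: "sin (a + 2 * t + 2 * t) = 2 * cos t * sin (a + t + 2 * t) - sin (a + 2 * t)"
        using sin_recurrence[of "a + 2 * t" t] by (simp add: algebra_simps)
      have 2: "sin (a + 2 * t + t) = 2 * cos t * sin (a + t + t) - sin (a + t)"
        using sin_recurrence[of "a + t" t] by (simp add: algebra_simps)
      show ?thesis
        unfolding g_def 1 2 sin_recurrence[of a t] by (simp add: algebra_simps)
    qed
    have g_bound: "\<bar>g a\<bar> \<le> gap t" for a
    proof -
      have "g a = cos a * (2 * sin t * (cos t - r)) + sin a * ((cos t - r)\<^sup>2 - (sin t)\<^sup>2)"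
        unfolding g_def sin_add mult_2 cos_add by (simp add: power2_eq_square algebra_simps)
      thus ?thesis
        using double_bound[of t] by (simp only: abs_cos_sin_combination_le gap_nonneg add.commute)
    qed
    have "sin t * poly (cheb c P Q n) (c * cos t) = g (real n * t - t)"
    proof (rule poly_cheb[OF c0])
      show "sin t * poly P (c * cos t) = g (real 0 * t - t)"
        by (simp add: P_def g_def algebra_simps)
      show "sin t * poly Q (c * cos t) = g (real 1 * t - t)"
        using c0 sin_double[of t] by (simp add: Q_def g_def algebra_simps)
      fix k
      show "g (real (k + 2) * t - t) = 2 * cos t * g (real (k + 1) * t - t) - g (real k * t - t)"
        using g_rec[of "real k * t - t"] by (simp add: algebra_simps)
    qed
    hence "\<bar>sin t\<bar> * \<bar>poly (cheb c P Q n) x\<bar> \<le> gap t"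
      using g_bound[of "real n * t - t"] by (simp add: t flip: abs_mult)
    moreover have "sqrt (c\<^sup>2 - x\<^sup>2) = c * \<bar>sin t\<bar>"
    proof -
      have "c\<^sup>2 - x\<^sup>2 = (c * sin t)\<^sup>2"
        by (simp add: t power_mult_distrib sin_squared_eq algebra_simps)
      thus ?thesis using c_pos by (simp add: abs_mult)
    qed
    moreover have "(1 + r\<^sup>2) * (1 - x) = gap t" by (simp add: t gap_eq)
    ultimately show ?thesis using c_pos by (simp add: mult_ac)
  qed
  ultimately show ?thesis by (intro exI[of _ "cheb c P Q n"]) simp
qed

text \<open>Here the weight is \<open>c^2\<close> times the square of \<open>sin t\<close>. One
  factor \<open>sin t\<close> pays for the division, the other is itself at most
  \<open>sqrt (gap t)\<close>; hence a single factor \<open>exp (i t) - r\<close> in the polynomial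
  suffices to reach \<open>gap t\<close>.\<close>

lemma exists_poly_V:
  "\<exists>R. degree R \<le> n \<and> poly R 1 = 1 / r ^ n \<and>
    (\<forall>x. \<bar>x\<bar> \<le> c \<longrightarrow> \<bar>poly R x\<bar> * (c\<^sup>2 - x\<^sup>2) \<le> c\<^sup>2 * ((1 + r\<^sup>2) * (1 - x)))"
proof -
  define P where "P = [:1 :: real:]"
  define Q where "Q = [:- r, 2 / c:]"
  have c0: "c \<noteq> 0" using c_pos by simp
  have inv: "1 / c = (1 + r\<^sup>2) / (2 * r)" by (simp add: c_eq)
  have "poly Q 1 = 2 * (1 / c) - r" by (simp add: Q_def)
  also have "\<dots> = 1 / r"
    unfolding inv using r by (simp add: field_simps power2_eq_square)
  finally have Q1: "poly P 1 = r * poly Q 1" using r by (simp add: P_def)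
  have "degree (cheb c P Q n) \<le> 0 + n"
    by (rule degree_cheb) (auto simp: P_def Q_def)
  moreover have "poly (cheb c P Q n) 1 = 1 / r ^ n"
    using poly_cheb_at_1[OF r(1) c_eq Q1, of n] by (simp add: P_def)
  moreover have "\<bar>poly (cheb c P Q n) x\<bar> * (c\<^sup>2 - x\<^sup>2) \<le> c\<^sup>2 * ((1 + r\<^sup>2) * (1 - x))"
    if x: "\<bar>x\<bar> \<le> c" for x
  proof -
    obtain t where t: "x = c * cos t" using cos_arccos_cover[OF x] by blast
    define g where "g a = sin (a + t) - r * sin a" for a
    have g_rec: "g (a + 2 * t) = 2 * cos t * g (a + t) - g a" for a
    proof -
      have 1: "sin (a + 2 * t + t) = 2 * cos t * sin (a + t + t) - sin (a + t)"
        using sin_recurrence[of "a + t" t] by (simp add: algebra_simps)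
      show ?thesis
        unfolding g_def 1 sin_recurrence[of a t] by (simp add: algebra_simps)
    qed
    have g_bound: "\<bar>g a\<bar> \<le> sqrt (gap t)" for a
    proof -
      have "g a = cos a * sin t + sin a * (cos t - r)"
        unfolding g_def sin_add by (simp add: algebra_simps)
      thus ?thesis
        by (simp only:) (rule abs_cos_sin_combination_le,
          simp_all add: gap_nonneg, simp add: gap_sum_squares)
    qed
    have "sin t * poly (cheb c P Q n) (c * cos t) = g (real n * t)"
    proof (rule poly_cheb[OF c0])
      show "sin t * poly P (c * cos t) = g (real 0 * t)"
        by (simp add: P_def g_def)
      show "sin t * poly Q (c * cos t) = g (real 1 * t)"
        using c0 sin_double[of t] by (simp add: Q_def g_def algebra_simps)
      fix k
      show "g (real (k + 2) * t) = 2 * cos t * g (real (k + 1) * t) - g (real k * t)"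
        using g_rec[of "real k * t"] by (simp add: algebra_simps)
    qed
    hence "\<bar>sin t\<bar> * \<bar>poly (cheb c P Q n) x\<bar> \<le> sqrt (gap t)"
      using g_bound[of "real n * t"] by (simp add: t flip: abs_mult)
    moreover have "\<bar>sin t\<bar> \<le> sqrt (gap t)"
      by (simp add: gap_sum_squares real_le_rsqrt)
    ultimately have "(\<bar>sin t\<bar> * \<bar>poly (cheb c P Q n) x\<bar>) * \<bar>sin t\<bar> \<le> sqrt (gap t) * sqrt (gap t)"
      by (intro mult_mono) (auto simp: gap_nonneg)
    hence "\<bar>poly (cheb c P Q n) x\<bar> * (sin t)\<^sup>2 \<le> gap t"
      using gap_nonneg[of t] by (simp add: power2_eq_square mult_ac)
    hence "c\<^sup>2 * (\<bar>poly (cheb c P Q n) x\<bar> * (sin t)\<^sup>2) \<le> c\<^sup>2 * gap t"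
      by (intro mult_left_mono) auto
    moreover have "c\<^sup>2 - x\<^sup>2 = c\<^sup>2 * (sin t)\<^sup>2"
      by (simp add: t power_mult_distrib sin_squared_eq algebra_simps)
    moreover have "(1 + r\<^sup>2) * (1 - x) = gap t" by (simp add: t gap_eq)
    ultimately show ?thesis by (simp add: mult_ac)
  qed
  ultimately show ?thesis by (intro exI[of _ "cheb c P Q n"]) simp
qed

end

lemma chebyshev_interval_rate:
  "0 < c \<Longrightarrow> c < 1 \<Longrightarrow> chebyshev_interval c (chebyshev_rate c)"
  using chebyshev_rate_bounds chebyshev_rate_eq by unfold_locales auto

section \<open>Resolvent forms of symmetric matrices\<close>

locale symmetric_system =
  fixes N :: nat and A :: "nat \<Rightarrow> nat \<Rightarrow> real" and e :: "nat \<Rightarrow> real" and q :: "nat \<Rightarrow> nat \<Rightarrow> real"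
  assumes sym: "\<And>i j. i < N \<Longrightarrow> j < N \<Longrightarrow> A i j = A j i"
    and basis: "eigenbasis N A e q"
begin

definition coord :: "nat \<Rightarrow> (nat \<Rightarrow> real) \<Rightarrow> real" where "coord k v = dot N (q k) v"

lemma coord_linear:
  "coord k (\<lambda>i. v i + w i) = coord k v + coord k w"
  "coord k (\<lambda>i. v i - w i) = coord k v - coord k w"
  "coord k (\<lambda>i. c * v i) = c * coord k v"
  by (simp_all add: coord_def dot_linear)

lemma coord_cong: "(\<And>i. i < N \<Longrightarrow> v i = w i) \<Longrightarrow> coord k v = coord k w"
  unfolding coord_def by (rule dot_cong) auto

lemma coord_basis: "k < N \<Longrightarrow> l < N \<Longrightarrow> coord k (q l) = of_bool (k = l)"
  using basis by (simp add: coord_def eigenbasis_def)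

lemma coord_combination:
  assumes "k < N"
  shows "coord k (\<lambda>i. \<Sum>l<N. b l * q l i) = b k"
proof -
  have "coord k (\<lambda>i. \<Sum>l<N. b l * q l i) = (\<Sum>l<N. b l * coord k (q l))"
    by (simp add: coord_def dot_linear)
  also have "\<dots> = (\<Sum>l<N. if k = l then b l else 0)"
    using assms by (intro sum.cong refl) (simp add: coord_basis)
  finally show ?thesis using assms by simp
qed

lemma expansion:
  assumes "i < N"
  shows "v i = (\<Sum>k<N. coord k v * q k i)"
proof -
  have "(\<Sum>k<N. coord k v * q k i) = (\<Sum>k<N. \<Sum>j<N. v j * (q k j * q k i))"
    unfolding coord_def dot_def sum_distrib_right by (simp only: mult_ac)
  also have "\<dots> = (\<Sum>j<N. v j * (\<Sum>k<N. q k j * q k i))"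
    unfolding sum_distrib_left by (rule sum.swap)
  also have "\<dots> = (\<Sum>j<N. if j = i then v j else 0)"
    using assms by (intro sum.cong refl) (simp add: eigenbasis_complete[OF basis])
  finally show ?thesis using assms by simp
qed

lemma dot_eq_coords: "dot N u v = (\<Sum>k<N. coord k u * coord k v)"
proof -
  have "dot N u v = dot N (\<lambda>i. \<Sum>k<N. coord k u * q k i) v"
    by (rule dot_cong) (use expansion in auto)
  also have "\<dots> = (\<Sum>k<N. coord k u * coord k v)"
    by (simp only: dot_linear) (simp add: coord_def)
  finally show ?thesis .
qed

lemma eq_iff_coords: "(\<forall>i<N. v i = w i) \<longleftrightarrow> (\<forall>k<N. coord k v = coord k w)"
proof
  assume "\<forall>k<N. coord k v = coord k w"
  thus "\<forall>i<N. v i = w i" using expansion[of _ v] expansion[of _ w] by simp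
qed (use coord_cong in blast)

lemma coord_mapply: "k < N \<Longrightarrow> coord k (mapply N A v) = e k * coord k v"
proof -
  assume k: "k < N"
  have "coord k (mapply N A v) = dot N (mapply N A (q k)) v"
    unfolding coord_def by (rule dot_mapply_sym) (rule sym)
  also have "\<dots> = dot N (\<lambda>i. e k * q k i) v"
    using basis k by (intro dot_cong) (auto simp: eigenbasis_def)
  finally show ?thesis by (simp add: dot_linear coord_def)
qed

lemma quadratic_form_basis:
  assumes "k < N"
  shows "dot N (q k) (mapply N A (q k)) = e k"
  using coord_mapply[OF assms, of "q k"] coord_basis[OF assms assms] by (simp add: coord_def)

lemma coord_mapply_funpow: "k < N \<Longrightarrow> coord k ((mapply N A ^^ m) v) = e k ^ m * coord k v"
  by (induction m) (simp_all add: coord_mapply mult_ac)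

lemma quadratic_form: "dot N v (mapply N A v) = (\<Sum>k<N. e k * (coord k v)\<^sup>2)"
  unfolding dot_eq_coords by (intro sum.cong refl) (simp add: coord_mapply power2_eq_square mult_ac)

lemma dot_self_coords: "dot N v v = (\<Sum>k<N. (coord k v)\<^sup>2)"
  by (simp add: dot_eq_coords power2_eq_square)

lemma quadratic_form_le:
  assumes "\<And>k. k < N \<Longrightarrow> \<bar>e k\<bar> \<le> c"
  shows "\<bar>dot N v (mapply N A v)\<bar> \<le> c * dot N v v"
proof -
  have "\<bar>dot N v (mapply N A v)\<bar> \<le> (\<Sum>k<N. \<bar>e k * (coord k v)\<^sup>2\<bar>)"
    unfolding quadratic_form by (rule sum_abs)
  also have "\<dots> \<le> (\<Sum>k<N. c * (coord k v)\<^sup>2)"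
    using assms by (intro sum_mono) (simp add: abs_mult mult_right_mono)
  finally show ?thesis by (simp add: dot_self_coords sum_distrib_left)
qed

text \<open>The eigenvector is compared with its absolute value, as in the Perron--Frobenius theorem.\<close>
lemma eigenvalue_lower_bound:
  assumes nonneg: "\<And>i j. i < N \<Longrightarrow> j < N \<Longrightarrow> 0 \<le> A i j"
    and le: "\<And>k. k < N \<Longrightarrow> e k \<le> c" and "k < N"
  shows "- c \<le> e k"
proof -
  let ?v = "\<lambda>i. \<bar>q k i\<bar>"
  have qk: "dot N (q k) (mapply N A (q k)) = e k"
    by (rule quadratic_form_basis) fact
  have "- dot N (q k) (mapply N A (q k)) \<le> dot N ?v (mapply N A ?v)"
    unfolding dot_def mapply_def sum_distrib_left sum_negf[symmetric]
  proof (intro sum_mono)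
    fix i j assume "i \<in> {..<N}" "j \<in> {..<N}"
    hence "\<bar>q k i * (A i j * q k j)\<bar> = \<bar>q k i\<bar> * (A i j * \<bar>q k j\<bar>)"
      using nonneg by (simp add: abs_mult)
    thus "- (q k i * (A i j * q k j)) \<le> \<bar>q k i\<bar> * (A i j * \<bar>q k j\<bar>)" by linarith
  qed
  also have "\<dots> \<le> c * dot N ?v ?v"
    unfolding quadratic_form dot_self_coords sum_distrib_left
    by (intro sum_mono mult_right_mono) (auto simp: le)
  also have "dot N ?v ?v = dot N (q k) (q k)" by (simp add: dot_def)
  also have "\<dots> = 1" using coord_basis[OF assms(3,3)] by (simp add: coord_def)
  finally show ?thesis by (simp add: qk)
qed

text \<open>The bilinear form of the resolvent \<open>(1 - A)\<^sup>-\<^sup>1\<close>.\<close>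
definition res :: "(nat \<Rightarrow> real) \<Rightarrow> (nat \<Rightarrow> real) \<Rightarrow> real" where
  "res u v = (\<Sum>k<N. coord k u * coord k v / (1 - e k))"

lemma res_commute: "res u v = res v u"
  by (simp add: res_def mult.commute)

lemma res_add_right: "res u (\<lambda>i. v i + w i) = res u v + res u w"
  by (simp add: res_def coord_linear algebra_simps add_divide_distrib sum.distrib)

lemma res_scale_right: "res u (\<lambda>i. c * v i) = c * res u v"
  by (simp add: res_def coord_linear sum_distrib_left mult_ac)

lemma res_cong:
  assumes "\<And>i. i < N \<Longrightarrow> u i = u' i" "\<And>i. i < N \<Longrightarrow> v i = v' i"
  shows "res u v = res u' v'"
  unfolding res_def using coord_cong[OF assms(1)] coord_cong[OF assms(2)] by simp

lemma dot_solution: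
  assumes "\<And>k. k < N \<Longrightarrow> e k \<noteq> 1"
    and sol: "\<And>i. i < N \<Longrightarrow> z i - mapply N A z i = w i"
  shows "dot N u z = res u w"
  unfolding dot_eq_coords res_def
proof (intro sum.cong refl)
  fix k assume "k \<in> {..<N}"
  hence k: "k < N" by simp
  have "coord k w = coord k (\<lambda>i. z i - mapply N A z i)"
    by (rule coord_cong) (simp add: sol)
  hence "coord k w = (1 - e k) * coord k z"
    using k by (simp add: coord_linear coord_mapply algebra_simps)
  thus "coord k u * coord k z = coord k u * coord k w / (1 - e k)"
    using assms(1)[OF k] by simp
qed

lemma exists_solution:
  assumes "\<And>k. k < N \<Longrightarrow> e k \<noteq> 1"
  shows "\<exists>z. \<forall>i<N. z i - mapply N A z i = w i"
proof
  let ?z = "\<lambda>i. \<Sum>k<N. coord k w / (1 - e k) * q k i"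
  show "\<forall>i<N. ?z i - mapply N A ?z i = w i"
  proof (rule eq_iff_coords[THEN iffD2], intro allI impI)
    fix k assume k: "k < N"
    hence "coord k (\<lambda>i. ?z i - mapply N A ?z i) = (1 - e k) * (coord k w / (1 - e k))"
      by (simp only: coord_linear coord_mapply coord_combination left_diff_distrib mult_1)
    thus "coord k (\<lambda>i. ?z i - mapply N A ?z i) = coord k w"
      using assms[OF k] by simp
  qed
qed

text \<open>The resolvent identity \<open>(1 - A)^-1 A = (1 - A)^-1 - 1\<close>. It eliminates every
  column that has the form \<open>A e_j\<close>.\<close>

lemma res_mapply_right:
  assumes "\<And>k. k < N \<Longrightarrow> e k \<noteq> 1"
  shows "res u (mapply N A v) = res u v - dot N u v"
  unfolding res_def dot_eq_coords sum_subtractf[symmetric]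
proof (intro sum.cong refl)
  fix k assume "k \<in> {..<N}"
  thus "coord k u * coord k (mapply N A v) / (1 - e k)
      = coord k u * coord k v / (1 - e k) - coord k u * coord k v"
    using assms[of k] by (simp add: coord_mapply field_simps)
qed

lemma res_kernel:
  assumes "\<And>k. k < N \<Longrightarrow> e k \<noteq> 1" "\<And>i. i < N \<Longrightarrow> mapply N A v i = 0"
  shows "res u v = dot N u v"
proof -
  have "res u (mapply N A v) = 0"
    unfolding res_def using coord_cong[of "mapply N A v" "\<lambda>i. 0"] assms(2)
    by (simp add: coord_def dot_def)
  thus ?thesis using res_mapply_right[OF assms(1)] by simp
qed

text \<open>
  Testing the equation with the negative part of the solution shows that this part has
  nonpositive energy.
\<close>
lemma solution_nonneg:
  assumes nonneg: "\<And>i j. i < N \<Longrightarrow> j < N \<Longrightarrow> 0 \<le> A i j"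
    and less: "\<And>k. k < N \<Longrightarrow> e k < 1"
    and sol: "\<And>i. i < N \<Longrightarrow> z i - mapply N A z i = w i"
    and w: "\<And>i. i < N \<Longrightarrow> 0 \<le> w i" and "i < N"
  shows "0 \<le> z i"
proof -
  define zp where "zp i = max 0 (z i)" for i
  define zm where "zm i = max 0 (- z i)" for i
  have z: "z = (\<lambda>i. zp i - zm i)" by (auto simp: zp_def zm_def)
  have "0 \<le> dot N zm w"
    unfolding dot_def using w by (intro sum_nonneg) (auto simp: zm_def)
  also have "dot N zm w = dot N zm (\<lambda>i. z i - mapply N A z i)"
    by (rule dot_cong) (simp_all add: sol)
  also have "\<dots> = dot N zm zp - dot N zm zm - dot N zm (mapply N A zp) + dot N zm (mapply N A zm)"
    by (subst z, subst z) (simp add: mapply_diff dot_linear)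
  also have "dot N zm zp = 0"
    unfolding dot_def by (rule sum.neutral) (auto simp: zm_def zp_def)
  finally have "dot N zm (mapply N A zp) + dot N zm zm \<le> dot N zm (mapply N A zm)" by simp
  moreover have "0 \<le> dot N zm (mapply N A zp)"
    unfolding dot_def mapply_def
    by (intro sum_nonneg mult_nonneg_nonneg) (auto simp: zm_def zp_def nonneg)
  ultimately have "(\<Sum>k<N. (1 - e k) * (coord k zm)\<^sup>2) \<le> 0"
    by (simp add: quadratic_form dot_self_coords left_diff_distrib sum_subtractf)
  moreover have pos: "\<And>k. k \<in> {..<N} \<Longrightarrow> 0 \<le> (1 - e k) * (coord k zm)\<^sup>2"
    using less by (simp add: less_imp_le)
  ultimately have "(\<Sum>k<N. (1 - e k) * (coord k zm)\<^sup>2) = 0"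
    by (meson antisym sum_nonneg)
  hence "\<forall>k\<in>{..<N}. (1 - e k) * (coord k zm)\<^sup>2 = 0"
    using pos by (subst (asm) sum_nonneg_eq_0_iff) auto
  hence "\<forall>k<N. coord k zm = 0" using less by force
  hence "dot N zm zm = 0" by (simp add: dot_self_coords)
  hence "zm i = 0" using assms(5) by (simp add: dot_self_eq_0)
  thus ?thesis by (simp add: zm_def)
qed

lemma res_nonneg:
  assumes nonneg: "\<And>i j. i < N \<Longrightarrow> j < N \<Longrightarrow> 0 \<le> A i j"
    and less: "\<And>k. k < N \<Longrightarrow> e k < 1"
    and "\<And>i. i < N \<Longrightarrow> 0 \<le> u i" "\<And>i. i < N \<Longrightarrow> 0 \<le> v i"
  shows "0 \<le> res u v"
proof -
  have ne: "e k \<noteq> 1" if "k < N" for k using less[OF that] by simp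
  obtain z where z: "\<And>i. i < N \<Longrightarrow> z i - mapply N A z i = v i"
    using exists_solution[OF ne] by blast
  have "0 \<le> dot N u z"
    unfolding dot_def
    using assms(3) solution_nonneg[OF nonneg less z assms(4)] by (intro sum_nonneg) simp
  also have "dot N u z = res u v" by (rule dot_solution[OF ne z])
  finally show ?thesis .
qed

text \<open>Write \<open>R(1) - R(x) = (1 - x) Q(x)\<close>. Dividing by \<open>1 - x\<close> splits
  off \<open>Q\<close>, whose degree is below \<open>n\<close>, and the vanishing moments annihilate
  it.\<close>

lemma sum_resolvent_eq:
  assumes ne: "\<And>k. k < N \<Longrightarrow> e k \<noteq> 1"
    and moments: "\<And>m. m < n \<Longrightarrow> (\<Sum>k<N. w k * e k ^ m) = 0"
    and R: "degree R \<le> n" "poly R 1 \<noteq> 0"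
  shows "(\<Sum>k<N. w k / (1 - e k)) = (\<Sum>k<N. w k * poly R (e k) / (1 - e k)) / poly R 1"
proof -
  define Q where "Q = synthetic_div R 1"
  have Q: "poly R 1 - poly R x = (1 - x) * poly Q x" for x
  proof -
    have "R + Polynomial.smult 1 Q = pCons (poly R 1) Q"
      using synthetic_div_correct[of R 1] by (simp add: Q_def)
    hence "poly R x + poly Q x = poly R 1 + x * poly Q x"
      by (metis poly_add poly_pCons smult_1_left)
    thus ?thesis by (simp add: algebra_simps)
  qed
  have "(\<Sum>k<N. w k * poly Q (e k)) = (\<Sum>k<N. \<Sum>m\<le>degree Q. coeff Q m * (w k * e k ^ m))"
    by (simp add: poly_altdef sum_distrib_left mult_ac)
  also have "\<dots> = (\<Sum>m\<le>degree Q. coeff Q m * (\<Sum>k<N. w k * e k ^ m))"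
    unfolding sum_distrib_left by (rule sum.swap)
  also have "\<dots> = 0"
  proof (intro sum.neutral ballI)
    fix m assume "m \<in> {..degree Q}"
    \<comment> \<open>For \<open>n = 0\<close> the degree of \<open>Q\<close> is 0 and not below
      \<open>n\<close>; here \<open>R\<close> is constant and \<open>Q\<close> vanishes.\<close>
    moreover have "Q = 0" if "n = 0"
      using R(1) that by (simp add: Q_def synthetic_div_eq_0_iff)
    ultimately have "m < n \<or> coeff Q m = 0"
      using R(1) by (cases "n = 0") (auto simp: Q_def degree_synthetic_div)
    thus "coeff Q m * (\<Sum>k<N. w k * e k ^ m) = 0" using moments by auto
  qed
  finally have Q0: "(\<Sum>k<N. w k * poly Q (e k)) = 0" .
  have "poly R 1 * (\<Sum>k<N. w k / (1 - e k)) = (\<Sum>k<N. w k * poly R (e k) / (1 - e k) + w k * poly Q (e k))"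
    unfolding sum_distrib_left
  proof (intro sum.cong refl)
    fix k assume "k \<in> {..<N}"
    hence ne': "1 - e k \<noteq> 0" using ne by simp
    have "poly R 1 = poly R (e k) + (1 - e k) * poly Q (e k)" using Q[of "e k"] by simp
    thus "poly R 1 * (w k / (1 - e k)) = w k * poly R (e k) / (1 - e k) + w k * poly Q (e k)"
      using ne' by (simp only:) (simp add: divide_simps, simp add: algebra_simps)
  qed
  thus ?thesis using R(2) Q0 by (simp add: sum.distrib field_simps)
qed

end

section \<open>Decay of resolvent forms when the spectrum lies in \<open>[-c, c]\<close>\<close>

locale contraction = symmetric_system N A e q + chebyshev_interval c r
  for N A e q c r +
  assumes spectrum: "\<And>k. k < N \<Longrightarrow> \<bar>e k\<bar> \<le> c"
begin

lemma e_less_1: "k < N \<Longrightarrow> e k < 1"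
  using spectrum[of k] c_less_1 by simp

lemma e_neq_1: "k < N \<Longrightarrow> e k \<noteq> 1"
  using e_less_1[of k] by simp

text \<open>
  The moments \<open>u \<bullet> A\<^sup>m v\<close> with \<open>m < n\<close> vanish when the supports of \<open>u\<close> and \<open>v\<close> have distance at
  least \<open>n\<close> in the graph of \<open>A\<close>.
\<close>
definition separated :: "nat \<Rightarrow> (nat \<Rightarrow> real) \<Rightarrow> (nat \<Rightarrow> real) \<Rightarrow> bool" where
  "separated n u v \<longleftrightarrow> (\<forall>m<n. dot N u ((mapply N A ^^ m) v) = 0)"

lemma res_eq_poly:
  assumes "separated n u v" "degree R \<le> n" "poly R 1 \<noteq> 0"
  shows "res u v = (\<Sum>k<N. coord k u * coord k v * poly R (e k) / (1 - e k)) / poly R 1"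
  unfolding res_def
proof (rule sum_resolvent_eq[OF e_neq_1 _ assms(2,3)])
  fix m assume "m < n"
  have "(\<Sum>k<N. coord k u * coord k v * e k ^ m) = dot N u ((mapply N A ^^ m) v)"
    unfolding dot_eq_coords
    by (intro sum.cong refl) (simp add: coord_mapply_funpow mult_ac)
  thus "(\<Sum>k<N. coord k u * coord k v * e k ^ m) = 0"
    using assms(1) \<open>m < n\<close> by (simp add: separated_def)
qed

text \<open>\<open>f\<close> and \<open>g\<close> are the coordinates of \<open>u\<close> and
  \<open>v\<close>, divided by the square root weight where one is available. As their squares sum
  to at most 1, the arithmetic-geometric mean inequality replaces Cauchy-Schwarz.\<close>

lemma abs_res_le:
  assumes sep: "separated n u v" and R: "degree R \<le> n" "poly R 1 > 0"
    and fg: "(\<Sum>k<N. (f k)\<^sup>2) \<le> 1" "(\<Sum>k<N. (g k)\<^sup>2) \<le> 1" and "0 \<le> K"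
    and le: "\<And>k. k < N \<Longrightarrow> \<bar>coord k u * coord k v * poly R (e k)\<bar> \<le> \<bar>f k\<bar> * \<bar>g k\<bar> * (K * (1 - e k))"
  shows "\<bar>res u v\<bar> \<le> K / poly R 1"
proof -
  have "\<bar>\<Sum>k<N. coord k u * coord k v * poly R (e k) / (1 - e k)\<bar>
      \<le> (\<Sum>k<N. \<bar>coord k u * coord k v * poly R (e k) / (1 - e k)\<bar>)"
    by (rule sum_abs)
  also have "\<dots> \<le> (\<Sum>k<N. K * (((f k)\<^sup>2 + (g k)\<^sup>2) / 2))"
  proof (intro sum_mono)
    fix k assume "k \<in> {..<N}"
    hence k: "k < N" by simp
    hence pos: "0 < 1 - e k" using e_less_1 by simp
    have "\<bar>coord k u * coord k v * poly R (e k) / (1 - e k)\<bar> \<le> \<bar>f k\<bar> * \<bar>g k\<bar> * K"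
      using le[OF k] pos by (simp add: abs_divide divide_le_eq mult_ac)
    also have "\<dots> \<le> ((f k)\<^sup>2 + (g k)\<^sup>2) / 2 * K"
      using sum_squares_bound[of "\<bar>f k\<bar>" "\<bar>g k\<bar>"] \<open>0 \<le> K\<close> by (intro mult_right_mono) auto
    also have "\<dots> = K * (((f k)\<^sup>2 + (g k)\<^sup>2) / 2)" by (rule mult.commute)
    finally show "\<bar>coord k u * coord k v * poly R (e k) / (1 - e k)\<bar>
      \<le> K * (((f k)\<^sup>2 + (g k)\<^sup>2) / 2)" .
  qed
  also have "\<dots> = K * (((\<Sum>k<N. (f k)\<^sup>2) + (\<Sum>k<N. (g k)\<^sup>2)) / 2)"
    by (simp only: sum_distrib_left[symmetric] sum_divide_distrib[symmetric] sum.distrib)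
  also have "\<dots> \<le> K * 1" using fg \<open>0 \<le> K\<close> by (intro mult_left_mono) auto
  finally have "\<bar>\<Sum>k<N. coord k u * coord k v * poly R (e k) / (1 - e k)\<bar> \<le> K" by simp
  thus ?thesis
    using R by (simp add: res_eq_poly[OF sep R(1)] abs_divide divide_right_mono)
qed

lemma res_decay_T:
  assumes "separated n u v" "1 \<le> n" "dot N u u \<le> 1" "dot N v v \<le> 1"
  shows "\<bar>res u v\<bar> \<le> 2 * (1 + r\<^sup>2) / (1 - r\<^sup>2)\<^sup>2 * r ^ n"
proof -
  obtain R where R: "degree R \<le> n" "poly R 1 = (1 - r\<^sup>2)\<^sup>2 / (2 * r ^ n)"
    and le: "\<And>x. \<bar>x\<bar> \<le> c \<Longrightarrow> \<bar>poly R x\<bar> \<le> (1 + r\<^sup>2) * (1 - x)"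
    using exists_poly_T[OF assms(2)] by blast
  have "r\<^sup>2 < 1" using r by (simp add: power_less_one_iff)
  hence R1: "0 < poly R 1" using r by (simp add: R)
  have "\<bar>res u v\<bar> \<le> (1 + r\<^sup>2) / poly R 1"
  proof (rule abs_res_le[OF assms(1) R(1) R1])
    show "(\<Sum>k<N. (coord k u)\<^sup>2) \<le> 1" "(\<Sum>k<N. (coord k v)\<^sup>2) \<le> 1"
      using assms by (simp_all add: dot_self_coords)
    fix k assume "k < N"
    thus "\<bar>coord k u * coord k v * poly R (e k)\<bar>
        \<le> \<bar>coord k u\<bar> * \<bar>coord k v\<bar> * ((1 + r\<^sup>2) * (1 - e k))"
      unfolding abs_mult by (intro mult_left_mono le spectrum) auto
  qed (use one_plus_r2 in simp)
  also have "\<dots> = 2 * (1 + r\<^sup>2) / (1 - r\<^sup>2)\<^sup>2 * r ^ n"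
    using r by (simp add: R)
  finally show ?thesis .
qed

text \<open>Division by zero gives 0, so eigenvalues \<open>c\<close> and \<open>-c\<close> would
  not be seen by the sum; the first conjunct states what a finite sum would imply there.\<close>

definition weighted_le_1 :: "(nat \<Rightarrow> real) \<Rightarrow> bool" where
  "weighted_le_1 u \<longleftrightarrow> (\<forall>k<N. \<bar>e k\<bar> = c \<longrightarrow> coord k u = 0) \<and>
     (\<Sum>k<N. (coord k u)\<^sup>2 / (c\<^sup>2 - (e k)\<^sup>2)) \<le> 1"

lemma gap_e_nonneg: "k < N \<Longrightarrow> 0 \<le> c\<^sup>2 - (e k)\<^sup>2"
  using power_mono[of "\<bar>e k\<bar>" c 2] spectrum[of k] by simp

lemma weighted_le_1_imp:
  assumes "weighted_le_1 u"
  defines "f \<equiv> \<lambda>k. coord k u / sqrt (c\<^sup>2 - (e k)\<^sup>2)"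
  shows "(\<Sum>k<N. (f k)\<^sup>2) \<le> 1" "\<And>k. k < N \<Longrightarrow> \<bar>coord k u\<bar> = \<bar>f k\<bar> * sqrt (c\<^sup>2 - (e k)\<^sup>2)"
proof -
  have "(\<Sum>k<N. (f k)\<^sup>2) = (\<Sum>k<N. (coord k u)\<^sup>2 / (c\<^sup>2 - (e k)\<^sup>2))"
    using gap_e_nonneg by (intro sum.cong refl) (simp add: f_def power_divide)
  thus "(\<Sum>k<N. (f k)\<^sup>2) \<le> 1" using assms by (simp add: weighted_le_1_def)
  fix k assume k: "k < N"
  show "\<bar>coord k u\<bar> = \<bar>f k\<bar> * sqrt (c\<^sup>2 - (e k)\<^sup>2)"
  proof (cases "\<bar>e k\<bar> = c")
    case True
    thus ?thesis using assms k by (simp add: weighted_le_1_def f_def)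
  next
    case False
    hence "\<bar>e k\<bar> < c" using spectrum[OF k] by simp
    hence "0 < c\<^sup>2 - (e k)\<^sup>2" using power_strict_mono[of "\<bar>e k\<bar>" c 2] by simp
    thus ?thesis by (simp add: f_def abs_divide)
  qed
qed

lemma res_decay_U:
  assumes "separated n u v" "weighted_le_1 u" "dot N v v \<le> 1"
  shows "\<bar>res u v\<bar> \<le> 2 / (1 - r\<^sup>2) * r ^ Suc n"
proof -
  obtain R where R: "degree R \<le> n" "poly R 1 = (1 - r\<^sup>2) / r ^ n"
    and le: "\<And>x. \<bar>x\<bar> \<le> c \<Longrightarrow> \<bar>poly R x\<bar> * sqrt (c\<^sup>2 - x\<^sup>2) \<le> c * ((1 + r\<^sup>2) * (1 - x))"
    using exists_poly_U by blast
  have "r\<^sup>2 < 1" using r by (simp add: power_less_one_iff)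
  hence R1: "0 < poly R 1" using r by (simp add: R)
  note f = weighted_le_1_imp[OF assms(2)]
  have "\<bar>res u v\<bar> \<le> (c * (1 + r\<^sup>2)) / poly R 1"
  proof (rule abs_res_le[OF assms(1) R(1) R1 f(1)])
    show "(\<Sum>k<N. (coord k v)\<^sup>2) \<le> 1"
      using assms by (simp add: dot_self_coords)
    fix k assume k: "k < N"
    let ?f = "\<bar>coord k u / sqrt (c\<^sup>2 - (e k)\<^sup>2)\<bar>"
    have "\<bar>coord k u * coord k v * poly R (e k)\<bar>
        = ?f * \<bar>coord k v\<bar> * (\<bar>poly R (e k)\<bar> * sqrt (c\<^sup>2 - (e k)\<^sup>2))"
      by (simp only: abs_mult f(2)[OF k]) (simp add: mult_ac)
    also have "\<dots> \<le> ?f * \<bar>coord k v\<bar> * (c * ((1 + r\<^sup>2) * (1 - e k)))"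
      using k by (intro mult_left_mono le spectrum) auto
    finally show "\<bar>coord k u * coord k v * poly R (e k)\<bar>
        \<le> ?f * \<bar>coord k v\<bar> * (c * (1 + r\<^sup>2) * (1 - e k))"
      by (simp only: mult.assoc)
  qed (use one_plus_r2 c_pos in simp)
  \<comment> \<open>The weight leaves a factor \<open>c\<close>, which supplies one more power of
    \<open>r\<close>: this makes up for the step between an edge and the support of its
    column.\<close>
  also have "c * (1 + r\<^sup>2) = 2 * r" using one_plus_r2 by (simp add: c_eq)
  also have "2 * r / poly R 1 = 2 / (1 - r\<^sup>2) * r ^ Suc n"
    using r by (simp add: R)
  finally show ?thesis .
qed

lemma res_weighted_aux:
  assumes "weighted_le_1 u" "weighted_le_1 v" "separated n u v"
    and R: "degree R \<le> n" "0 < poly R 1" and "0 \<le> K"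
    and le: "\<And>x. \<bar>x\<bar> \<le> c \<Longrightarrow> \<bar>poly R x\<bar> * (c\<^sup>2 - x\<^sup>2) \<le> K * (1 - x)"
  shows "\<bar>res u v\<bar> \<le> K / poly R 1"
proof (rule abs_res_le[OF assms(3) R])
  note f = weighted_le_1_imp[OF assms(1)] and g = weighted_le_1_imp[OF assms(2)]
  show "(\<Sum>k<N. (coord k u / sqrt (c\<^sup>2 - (e k)\<^sup>2))\<^sup>2) \<le> 1"
    "(\<Sum>k<N. (coord k v / sqrt (c\<^sup>2 - (e k)\<^sup>2))\<^sup>2) \<le> 1"
    by (fact f(1), fact g(1))
  fix k assume k: "k < N"
  let ?f = "\<bar>coord k u / sqrt (c\<^sup>2 - (e k)\<^sup>2)\<bar>" and ?g = "\<bar>coord k v / sqrt (c\<^sup>2 - (e k)\<^sup>2)\<bar>"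
  have "\<bar>coord k u * coord k v * poly R (e k)\<bar>
      = ?f * ?g * (\<bar>poly R (e k)\<bar> * (sqrt (c\<^sup>2 - (e k)\<^sup>2) * sqrt (c\<^sup>2 - (e k)\<^sup>2)))"
    by (simp only: abs_mult f(2)[OF k] g(2)[OF k]) (simp only: mult_ac)
  also have "\<dots> = ?f * ?g * (\<bar>poly R (e k)\<bar> * (c\<^sup>2 - (e k)\<^sup>2))"
    using gap_e_nonneg[OF k] by simp
  also have "\<dots> \<le> ?f * ?g * (K * (1 - e k))"
    using k by (intro mult_left_mono le spectrum) auto
  finally show "\<bar>coord k u * coord k v * poly R (e k)\<bar> \<le> ?f * ?g * (K * (1 - e k))" .
qed fact

lemma res_decay_V:
  assumes "weighted_le_1 u" "weighted_le_1 v" "separated n u v"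
  shows "\<bar>res u v\<bar> \<le> 2 * c * r ^ Suc n"
proof -
  obtain R where R: "degree R \<le> n" "poly R 1 = 1 / r ^ n"
    and le: "\<And>x. \<bar>x\<bar> \<le> c \<Longrightarrow> \<bar>poly R x\<bar> * (c\<^sup>2 - x\<^sup>2) \<le> c\<^sup>2 * ((1 + r\<^sup>2) * (1 - x))"
    using exists_poly_V by blast
  have "\<bar>res u v\<bar> \<le> (c\<^sup>2 * (1 + r\<^sup>2)) / poly R 1"
    using r one_plus_r2 le
    by (intro res_weighted_aux[OF assms R(1)]) (auto simp: R mult.assoc)
  also have "\<dots> = c * (c * (1 + r\<^sup>2)) * r ^ n"
    by (simp add: R power2_eq_square)
  also have "c * (1 + r\<^sup>2) = 2 * r" using one_plus_r2 by (simp add: c_eq)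
  finally show ?thesis by (simp add: mult_ac)
qed

text \<open>The constant polynomial, with \<open>c^2 - x^2 <= (1 + x) (1 - x)\<close>. It covers
  distances too short for the decay estimate.\<close>

lemma res_weighted_le:
  assumes "weighted_le_1 u" "weighted_le_1 v"
  shows "\<bar>res u v\<bar> \<le> 1 + c"
proof -
  have "\<bar>res u v\<bar> \<le> (1 + c) / poly [:1 :: real:] 1"
  proof (rule res_weighted_aux[OF assms])
    show "separated 0 u v" by (simp add: separated_def)
    fix x assume x: "\<bar>x\<bar> \<le> c"
    have "c\<^sup>2 - x\<^sup>2 \<le> 1 - x\<^sup>2" using c_pos c_less_1 by (simp add: power_le_one)
    also have "\<dots> = (1 + x) * (1 - x)" by (simp add: power2_eq_square algebra_simps)
    also have "\<dots> \<le> (1 + c) * (1 - x)"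
      using x c_less_1 by (intro mult_right_mono) auto
    finally show "\<bar>poly [:1:] x\<bar> * (c\<^sup>2 - x\<^sup>2) \<le> (1 + c) * (1 - x)" by simp
  qed (use c_pos in auto)
  thus ?thesis by simp
qed

text \<open>
  The hypothesis says that the matrix obtained from \<open>A\<close> by adding the row and the column \<open>u\<close>
  at the isolated vertex \<open>i\<close> also has its spectrum in \<open>[-c, c]\<close>.
\<close>
lemma bordered_weighted_le_1:
  assumes "i < N" and isolated: "\<And>j. j < N \<Longrightarrow> A i j = 0" and "u i = 0"
    and border: "\<And>x. \<bar>dot N x (mapply N A x) + 2 * x i * dot N u x\<bar> \<le> c * dot N x x"
  shows "weighted_le_1 u"
proof -
  \<comment> \<open>Replacing entry \<open>i\<close> of \<open>v\<close> by a free \<open>t\<close>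
    changes neither the form of \<open>A\<close> nor \<open>dot N u v\<close>, because
    \<open>i\<close> is isolated and \<open>u i = 0\<close>. The hypothesis becomes two nonnegative
    quadratics in \<open>t\<close>, and these are their discriminants.\<close>
  have discr: "(dot N u v)\<^sup>2 \<le> c * (c * dot N v v - dot N v (mapply N A v))"
    "(dot N u v)\<^sup>2 \<le> c * (c * dot N v v + dot N v (mapply N A v))" for v
  proof -
    have both: "\<bar>dot N v (mapply N A v) + 2 * t * dot N u v\<bar> \<le> c * (dot N v v + t\<^sup>2)" for t
    proof -
      let ?x = "v(i := t)"
      have A: "mapply N A ?x j = mapply N A v j" if "j < N" for j
        unfolding mapply_def
        using that isolated[OF that] sym[OF that assms(1)] by (intro sum.cong refl) auto
      have "mapply N A v i = 0" by (simp add: mapply_def isolated)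
      hence "dot N ?x (mapply N A ?x) = dot N v (mapply N A v)"
        unfolding dot_def by (intro sum.cong refl) (auto simp: A)
      moreover have "dot N u ?x = dot N u v"
        unfolding dot_def using assms(3) by (intro sum.cong refl) auto
      moreover have "dot N ?x ?x \<le> dot N v v + t\<^sup>2"
      proof -
        have "dot N ?x ?x \<le> (\<Sum>j<N. v j * v j + (if j = i then t\<^sup>2 else 0))"
          unfolding dot_def by (intro sum_mono) (auto simp: power2_eq_square)
        thus ?thesis using assms(1) by (simp add: dot_def sum.distrib)
      qed
      hence "c * dot N ?x ?x \<le> c * (dot N v v + t\<^sup>2)" using c_pos by simp
      ultimately show ?thesis using border[of ?x] by simp
    qed
    have "0 \<le> c * t\<^sup>2 + 2 * t * - dot N u v + (c * dot N v v - dot N v (mapply N A v))" for t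
      using both[of t] by (simp add: algebra_simps)
    from quadratic_discriminant_le[OF this c_pos]
    show "(dot N u v)\<^sup>2 \<le> c * (c * dot N v v - dot N v (mapply N A v))" by simp
    have "0 \<le> c * t\<^sup>2 + 2 * t * dot N u v + (c * dot N v v + dot N v (mapply N A v))" for t
      using both[of t] by (simp add: algebra_simps)
    from quadratic_discriminant_le[OF this c_pos]
    show "(dot N u v)\<^sup>2 \<le> c * (c * dot N v v + dot N v (mapply N A v))" by simp
  qed
  have zero: "coord k u = 0" if "k < N" "\<bar>e k\<bar> = c" for k
  proof -
    have "dot N (q k) (q k) = 1" using coord_basis[OF that(1,1)] by (simp add: coord_def)
    moreover have "dot N (q k) (mapply N A (q k)) = e k"
      by (rule quadratic_form_basis) fact
    ultimately have "(coord k u)\<^sup>2 \<le> c * (c - e k)" "(coord k u)\<^sup>2 \<le> c * (c + e k)"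
      using discr[of "q k"] by (simp_all add: coord_def dot_commute[of N u])
    moreover have "e k = c \<or> e k = - c" using that by linarith
    ultimately have "(coord k u)\<^sup>2 \<le> 0" by auto
    thus ?thesis by simp
  qed
  have half: "(\<Sum>k<N. (coord k u)\<^sup>2 / (c - s * e k)) \<le> c" if s: "s = 1 \<or> s = - 1" for s
  proof -
    define S where "S = (\<Sum>k<N. (coord k u)\<^sup>2 / (c - s * e k))"
    \<comment> \<open>Coordinates of \<open>(c - s A)^-1 u\<close>. For this \<open>v\<close> both
      \<open>dot N u v\<close> and the quadratic form equal \<open>S\<close>, so the discriminant
      bound reads \<open>S^2 <= c * S\<close>. A zero denominator contributes 0 on both
      sides.\<close>
    define b where "b k = coord k u / (c - s * e k)" for k
    define v where "v = (\<lambda>i. \<Sum>k<N. b k * q k i)"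
    have v: "coord k v = b k" if "k < N" for k
      unfolding v_def by (rule coord_combination[OF that])
    have uv: "dot N u v = S"
      unfolding dot_eq_coords S_def by (intro sum.cong refl) (simp add: v b_def power2_eq_square)
    have "c * dot N v v - s * dot N v (mapply N A v) = (\<Sum>k<N. (c - s * e k) * (b k)\<^sup>2)"
      unfolding dot_self_coords quadratic_form sum_distrib_left sum_subtractf[symmetric]
      by (intro sum.cong refl) (simp add: v algebra_simps)
    also have "\<dots> = S"
      unfolding S_def
      by (intro sum.cong refl) (auto simp: b_def power_divide power2_eq_square divide_simps)
    finally have "c * dot N v v - s * dot N v (mapply N A v) = S" .
    hence "S\<^sup>2 \<le> c * S" using discr[of v] s uv by auto
    moreover have "0 \<le> S"
      unfolding S_def using spectrum s
      by (intro sum_nonneg divide_nonneg_nonneg) (auto simp: abs_le_iff)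
    ultimately have "S \<le> c" using c_pos by (cases "S = 0") (auto simp: power2_eq_square)
    thus ?thesis by (simp add: S_def)
  qed
  \<comment> \<open>Partial fractions: \<open>2 c / (c^2 - e^2) = 1 / (c - e) + 1 / (c + e)\<close>;
    at the ends of the interval both sides vanish by \<open>zero\<close>.\<close>
  have "2 * c * (\<Sum>k<N. (coord k u)\<^sup>2 / (c\<^sup>2 - (e k)\<^sup>2))
      = (\<Sum>k<N. (coord k u)\<^sup>2 / (c - 1 * e k) + (coord k u)\<^sup>2 / (c - - 1 * e k))"
    unfolding sum_distrib_left
  proof (intro sum.cong refl)
    fix k assume "k \<in> {..<N}"
    hence k: "k < N" by simp
    show "2 * c * ((coord k u)\<^sup>2 / (c\<^sup>2 - (e k)\<^sup>2))
        = (coord k u)\<^sup>2 / (c - 1 * e k) + (coord k u)\<^sup>2 / (c - - 1 * e k)"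
    proof (cases "\<bar>e k\<bar> = c")
      case True
      thus ?thesis using zero[OF k] by simp
    next
      case False
      hence "c - e k \<noteq> 0" "c + e k \<noteq> 0" using spectrum[OF k] by auto
      moreover have "c\<^sup>2 - (e k)\<^sup>2 = (c - e k) * (c + e k)"
        by (simp add: power2_eq_square algebra_simps)
      ultimately show ?thesis by (simp add: field_simps)
    qed
  qed
  also have "\<dots> \<le> 2 * c * 1" using half[of 1] half[of "- 1"] by (simp add: sum.distrib)
  finally have "(\<Sum>k<N. (coord k u)\<^sup>2 / (c\<^sup>2 - (e k)\<^sup>2)) \<le> 1"
    using c_pos by (subst (asm) mult_le_cancel_left_pos) auto
  thus ?thesis using zero by (simp add: weighted_le_1_def)
qed

end

section \<open>Propagation through a single layer\<close>

definition unit_fun :: "nat \<Rightarrow> nat \<Rightarrow> real" where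
  "unit_fun j i = (if i = j then 1 else 0)"

lemma dot_unit_fun: "j < N \<Longrightarrow> dot N u (unit_fun j) = u j" "j < N \<Longrightarrow> dot N (unit_fun j) u = u j"
  using dot_unit_right[of j N u 1] dot_unit_left[of j N 1 u] by (simp_all add: unit_fun_def[abs_def])

lemma mapply_unit_fun: "j < N \<Longrightarrow> mapply N A (unit_fun j) = (\<lambda>i. A i j)"
  by (rule ext) (simp add: mapply_def unit_fun_def if_distrib cong: if_cong)

lemma linear_form_square_le:
  fixes p q x y M :: real
  assumes "\<bar>x\<bar> \<le> M" "\<bar>y\<bar> \<le> M"
  shows "(p * x + q * y)\<^sup>2 \<le> 2 * M\<^sup>2 * (p\<^sup>2 + q\<^sup>2)"
proof -
  have "\<bar>p * x + q * y\<bar> \<le> \<bar>p\<bar> * M + \<bar>q\<bar> * M"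
    using assms by (intro order_trans[OF abs_triangle_ineq] add_mono) (auto simp: abs_mult mult_left_mono)
  hence "\<bar>p * x + q * y\<bar>\<^sup>2 \<le> (\<bar>p\<bar> * M + \<bar>q\<bar> * M)\<^sup>2" by (rule power_mono) simp
  also have "\<dots> = M\<^sup>2 * (\<bar>p\<bar> + \<bar>q\<bar>)\<^sup>2" by (simp add: power2_eq_square algebra_simps)
  also have "\<dots> \<le> M\<^sup>2 * (2 * (\<bar>p\<bar>\<^sup>2 + \<bar>q\<bar>\<^sup>2))"
    using sum_squares_bound[of "\<bar>p\<bar>" "\<bar>q\<bar>"]
    by (intro mult_left_mono) (simp_all add: power2_sum)
  finally show ?thesis by (simp add: algebra_simps)
qed

text \<open>\<open>E\<close> is the line graph of the intact network, which contains the graph of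
  every layer. The rate \<open>r\<close> belongs to the actual spectral bound \<open>c\<close>,
  whereas \<open>lam\<close>, \<open>C\<close> and \<open>G\<close> are the constants of the final
  estimate and enter only through inequalities.\<close>

locale katz_layer = contraction N A e q c r for N A e q c r +
  fixes E :: "(nat \<times> nat) set" and lam C G :: real
  assumes nonneg: "\<And>i j. i < N \<Longrightarrow> j < N \<Longrightarrow> 0 \<le> A i j"
    and diag: "\<And>i. i < N \<Longrightarrow> A i i = 0"
    and edges: "\<And>i j. i < N \<Longrightarrow> j < N \<Longrightarrow> A i j \<noteq> 0 \<Longrightarrow> (i, j) \<in> E"
    and E_sym: "\<And>i j. (i, j) \<in> E \<Longrightarrow> (j, i) \<in> E"
    and lam: "r \<le> lam" "lam < 1"
    and C: "2 * (1 + r\<^sup>2) / (1 - r\<^sup>2)\<^sup>2 \<le> C"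
    and G: "1 + c \<le> G"
begin

text \<open>Distance at least \<open>n\<close>, phrased by walks so that an infinite distance means
  \<open>far n i j\<close> for all \<open>n\<close>.\<close>

definition far :: "nat \<Rightarrow> nat \<Rightarrow> nat \<Rightarrow> bool" where
  "far n i j \<longleftrightarrow> (\<forall>m<n. (i, j) \<notin> E ^^ m)"

definition present :: "nat \<Rightarrow> (nat \<Rightarrow> real) \<Rightarrow> bool" where
  "present i a \<longleftrightarrow> (\<forall>v<N. a v = A v i)"

text \<open>The last conjunct is the spectral bound of the neighbouring layer that contains the
  edge, in the form required by \<open>bordered_weighted_le_1\<close>.\<close>

definition absent :: "nat \<Rightarrow> (nat \<Rightarrow> real) \<Rightarrow> bool" where
  "absent i a \<longleftrightarrow> (\<forall>v<N. A i v = 0) \<and> a i = 0 \<and> (\<forall>v<N. 0 \<le> a v \<and> (a v \<noteq> 0 \<longrightarrow> (i, v) \<in> E)) \<and>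
     (\<forall>x. \<bar>dot N x (mapply N A x) + 2 * x i * dot N a x\<bar> \<le> c * dot N x x)"

lemma lam_pos: "0 < lam" using r lam by simp

lemma r2_less_1: "r\<^sup>2 < 1" using r by (simp add: power_less_one_iff)

lemma C_ge_1: "1 \<le> C"
proof -
  have "(1 - r\<^sup>2)\<^sup>2 \<le> 1" using r2_less_1 by (intro power_le_one) auto
  hence "(1 - r\<^sup>2)\<^sup>2 \<le> 2 * (1 + r\<^sup>2)" by (smt (verit) zero_le_power2)
  hence "1 \<le> 2 * (1 + r\<^sup>2) / (1 - r\<^sup>2)\<^sup>2" using r2_less_1 by (simp add: le_divide_eq)
  thus ?thesis using C by simp
qed

lemma far_sym:
  assumes "far n i j"
  shows "far n j i"
proof -
  have "(j, i) \<in> E ^^ m \<Longrightarrow> (i, j) \<in> E ^^ m" for m i j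
  proof (induction m arbitrary: i)
    case (Suc m)
    then obtain k where "(j, k) \<in> E ^^ m" "(k, i) \<in> E" by auto
    thus ?case using Suc.IH[of k] E_sym relpow_Suc_I2 by metis
  qed simp
  thus ?thesis using assms by (auto simp: far_def)
qed

lemma far_distinct: "i \<noteq> j \<Longrightarrow> far 1 i j"
  by (simp add: far_def)

lemma walk_of_nonzero:
  assumes "(mapply N A ^^ m) v i \<noteq> 0" "i < N"
  shows "\<exists>j<N. (i, j) \<in> E ^^ m \<and> v j \<noteq> 0"
  using assms
proof (induction m arbitrary: i)
  case (Suc m)
  have "(\<Sum>k<N. A i k * (mapply N A ^^ m) v k) \<noteq> 0"
    using Suc.prems(1) by (simp add: mapply_def[of N A "(mapply N A ^^ m) v"])
  then obtain k where k: "k < N" "A i k \<noteq> 0" "(mapply N A ^^ m) v k \<noteq> 0"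
    by (elim sum.not_neutral_contains_not_neutral) auto
  from Suc.IH[OF k(3,1)] obtain j where "j < N" "(k, j) \<in> E ^^ m" "v j \<noteq> 0" by blast
  thus ?case using edges[OF Suc.prems(2) k(1,2)] relpow_Suc_I2[of i k E j m] by blast
qed auto

lemma separated_of_walks:
  assumes "\<And>m k l. \<lbrakk>m < n; k < N; l < N; u k \<noteq> 0; v l \<noteq> 0\<rbrakk> \<Longrightarrow> (k, l) \<notin> E ^^ m"
  shows "separated n u v"
  unfolding separated_def dot_def
proof (intro allI impI sum.neutral ballI)
  fix m k assume "m < n" "k \<in> {..<N}"
  thus "u k * (mapply N A ^^ m) v k = 0"
    using walk_of_nonzero[of m v k] assms[of m k] by (cases "u k = 0") auto
qed

lemma separated_unit_unit: "far n i j \<Longrightarrow> separated n (unit_fun i) (unit_fun j)"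
  by (rule separated_of_walks) (auto simp: unit_fun_def far_def split: if_splits)

text \<open>The column is supported on neighbours of \<open>i\<close>, so prefixing one step to a
  walk that starts in its support costs one unit of distance.\<close>

lemma separated_absent_unit: "absent i a \<Longrightarrow> far (Suc n) i j \<Longrightarrow> separated n a (unit_fun j)"
  by (rule separated_of_walks)
    (auto simp: unit_fun_def far_def absent_def split: if_splits dest: relpow_Suc_I2)

lemma separated_absent_absent:
  assumes "absent i a" "absent j b" "far (Suc (Suc n)) i j"
  shows "separated n a b"
proof (rule separated_of_walks)
  fix m k l assume *: "m < n" "k < N" "l < N" "a k \<noteq> 0" "b l \<noteq> 0"
  hence "(i, k) \<in> E" "(l, j) \<in> E" using assms E_sym by (auto simp: absent_def)
  hence "(k, l) \<in> E ^^ m \<Longrightarrow> (i, j) \<in> E ^^ Suc (Suc m)"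
    by (meson relpow_Suc_I relpow_Suc_I2)
  thus "(k, l) \<notin> E ^^ m" using assms(3) * by (auto simp: far_def simp del: relpow.simps)
qed

lemma absent_weighted: "i < N \<Longrightarrow> absent i a \<Longrightarrow> weighted_le_1 a"
  by (rule bordered_weighted_le_1[of i]) (auto simp: absent_def)

lemma res_unit_absent:
  assumes "i < N" "absent i a"
  shows "res u (unit_fun i) = u i"
proof -
  have "mapply N A (unit_fun i) v = 0" if "v < N" for v
    using assms that sym[of v i] by (simp add: mapply_unit_fun absent_def)
  thus ?thesis using res_kernel[OF e_neq_1] assms by (simp add: dot_unit_fun)
qed

lemma dot_unit_self: "i < N \<Longrightarrow> dot N (unit_fun i) (unit_fun i) = 1"
  by (simp add: dot_unit_fun) (simp add: unit_fun_def)

text \<open>Distance 0 is outside the range of \<open>res_decay_T\<close>. Instead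
  \<open>1 / (1 - x) <= (1 + x) / (1 - c^2)\<close> on the spectrum, and the linear term drops out
  because the diagonal of \<open>A\<close> is zero.\<close>

lemma res_diagonal_le:
  assumes "i < N"
  shows "res (unit_fun i) (unit_fun i) \<le> C"
proof -
  have c2: "0 < 1 - c\<^sup>2" using c_pos c_less_1 by (simp add: power_less_one_iff)
  have "res (unit_fun i) (unit_fun i) \<le> (\<Sum>k<N. (coord k (unit_fun i))\<^sup>2 * ((1 + e k) / (1 - c\<^sup>2)))"
    unfolding res_def
  proof (intro sum_mono)
    fix k assume "k \<in> {..<N}"
    hence k: "k < N" by simp
    have "1 / (1 - e k) \<le> (1 + e k) / (1 - c\<^sup>2)"
      using gap_e_nonneg[OF k] e_less_1[OF k] c2
      by (simp add: divide_simps) (simp add: power2_eq_square algebra_simps)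
    hence "(coord k (unit_fun i))\<^sup>2 * (1 / (1 - e k)) \<le> (coord k (unit_fun i))\<^sup>2 * ((1 + e k) / (1 - c\<^sup>2))"
      by (rule mult_left_mono) simp
    thus "coord k (unit_fun i) * coord k (unit_fun i) / (1 - e k)
        \<le> (coord k (unit_fun i))\<^sup>2 * ((1 + e k) / (1 - c\<^sup>2))"
      by (simp add: power2_eq_square)
  qed
  also have "\<dots> = (dot N (unit_fun i) (unit_fun i) + dot N (unit_fun i) (mapply N A (unit_fun i))) / (1 - c\<^sup>2)"
    by (simp add: dot_self_coords quadratic_form algebra_simps sum.distrib sum_divide_distrib add_divide_distrib)
  also have "\<dots> = 1 / (1 - c\<^sup>2)"
    using assms by (simp add: dot_unit_self) (simp add: dot_unit_fun mapply_unit_fun diag)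
  also have "1 - c\<^sup>2 = (1 - r\<^sup>2)\<^sup>2 / (1 + r\<^sup>2)\<^sup>2"
    using one_plus_r2 unfolding c_eq power_divide
    by (simp add: divide_simps) (simp add: power2_eq_square algebra_simps)
  also have "1 / ((1 - r\<^sup>2)\<^sup>2 / (1 + r\<^sup>2)\<^sup>2) = (1 + r\<^sup>2) * (1 + r\<^sup>2) / (1 - r\<^sup>2)\<^sup>2"
    by (simp add: power2_eq_square)
  also have "\<dots> \<le> 2 * (1 + r\<^sup>2) / (1 - r\<^sup>2)\<^sup>2"
    using one_plus_r2 r2_less_1 by (intro divide_right_mono mult_right_mono) auto
  finally show ?thesis using C by simp
qed

lemma res_unit_le:
  assumes "far n i j" "i < N" "j < N"
  shows "res (unit_fun i) (unit_fun j) \<le> C * (lam ^ n / lam)"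
proof (cases "i = j")
  case True
  hence n: "n = 0" using assms(1) by (cases n) (auto simp: far_def)
  have "C * 1 \<le> C * (1 / lam)"
    using lam lam_pos C_ge_1 by (intro mult_left_mono) (auto simp: field_simps)
  thus ?thesis using True n res_diagonal_le[OF assms(2)] by simp
next
  case False
  \<comment> \<open>\<open>res_decay_T\<close> needs a positive exponent; distinct vertices have
    distance at least 1 in any case.\<close>
  define m where "m = max n 1"
  have m: "far m i j" "1 \<le> m" "n \<le> m"
    using assms(1) far_distinct[OF False] by (auto simp: m_def max_def)
  have "res (unit_fun i) (unit_fun j) \<le> 2 * (1 + r\<^sup>2) / (1 - r\<^sup>2)\<^sup>2 * r ^ m"
    using res_decay_T[OF separated_unit_unit[OF m(1)] m(2)] assms by (simp add: dot_unit_self)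
  also have "\<dots> \<le> C * (lam ^ n / lam)"
  proof (rule mult_mono[OF C])
    have "r ^ m \<le> lam ^ m" using r lam by (intro power_mono) auto
    also have "\<dots> \<le> lam ^ n" using m lam lam_pos by (intro power_decreasing) auto
    also have "\<dots> \<le> lam ^ n / lam" using lam lam_pos by (simp add: field_simps)
    finally show "r ^ m \<le> lam ^ n / lam" .
  qed (use C_ge_1 r in auto)
  finally show ?thesis .
qed

text \<open>Both columns are images \<open>A e_i\<close> and \<open>A e_j\<close>, so the resolvent
  identity expresses all four entries as the entry at \<open>e_i, e_j\<close> minus nonnegative
  terms. They are nonnegative themselves, hence bounded by that entry.\<close>

lemma res_present_present:
  assumes "far n i j" "i < N" "j < N" "present i a" "present j b"
    and "x \<in> {res a (unit_fun j), res a b, res (unit_fun i) (unit_fun j), res (unit_fun i) b}"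
  shows "\<bar>x\<bar> \<le> C * (lam ^ n / lam)"
proof -
  let ?K = "res (unit_fun i) (unit_fun j)"
  let ?ei = "unit_fun i" and ?ej = "unit_fun j"
  have a: "res a u = res (mapply N A ?ei) u" and b: "res u b = res u (mapply N A ?ej)" for u
    using assms by (auto intro!: res_cong simp: present_def mapply_unit_fun)
  have unit: "0 \<le> unit_fun k v" for k v by (simp add: unit_fun_def)
  have col: "0 \<le> mapply N A (unit_fun k) v" if "k < N" "v < N" for k v
    using that nonneg by (simp add: mapply_unit_fun)
  note pos = res_nonneg[OF nonneg e_less_1]
  have 1: "0 \<le> res a ?ej" unfolding a using col[OF assms(2)] unit by (intro pos) auto
  have 2: "0 \<le> res a b" unfolding a b using col assms by (intro pos) auto
  have 3: "0 \<le> ?K" using unit by (intro pos) auto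
  have 4: "0 \<le> res ?ei b" unfolding b using col[OF assms(3)] unit by (intro pos) auto
  have "res a ?ej = ?K - dot N ?ej ?ei"
    unfolding a using res_mapply_right[OF e_neq_1, of ?ej ?ei] by (simp add: res_commute)
  hence 5: "res a ?ej \<le> ?K" using assms unit by (simp add: dot_unit_fun)
  have "res ?ei b = ?K - dot N ?ei ?ej"
    unfolding b by (rule res_mapply_right[OF e_neq_1])
  hence 6: "res ?ei b \<le> ?K" using assms unit by (simp add: dot_unit_fun)
  have "res a b = res a ?ej - dot N a ?ej"
    unfolding b by (rule res_mapply_right[OF e_neq_1])
  hence 7: "res a b \<le> ?K"
    using 5 assms nonneg[OF assms(3,2)] by (simp add: dot_unit_fun present_def)
  have "\<bar>x\<bar> \<le> ?K" using assms(6) 1 2 3 4 5 6 7 by auto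
  thus ?thesis using res_unit_le[OF assms(1-3)] by linarith
qed

text \<open>An absent edge is an isolated vertex, so the resolvent fixes \<open>e_i\<close>, and the
  entries with \<open>e_i\<close> vanish. Of the other two, \<open>res a b\<close> is
  \<open>res a e_j\<close> minus \<open>a j\<close> and nonnegative. The last two conclusions serve
  the transposed situation.\<close>

lemma res_absent_present:
  assumes "far n i j" "i < N" "j < N" "i \<noteq> j" "absent i a" "present j b"
  shows "\<bar>res a (unit_fun j)\<bar> \<le> sqrt (C * G) * (lam ^ n / lam)"
    and "\<bar>res a b\<bar> \<le> sqrt (C * G) * (lam ^ n / lam)"
    and "res (unit_fun i) (unit_fun j) = 0" "res (unit_fun i) b = 0"
    and "res (unit_fun j) (unit_fun i) = 0" "res b (unit_fun i) = 0"
proof -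
  have b: "res u b = res u (mapply N A (unit_fun j))" for u
    using assms by (auto intro!: res_cong simp: present_def mapply_unit_fun)
  have ki: "res u (unit_fun i) = u i" for u using assms by (intro res_unit_absent)
  show 0: "res (unit_fun j) (unit_fun i) = 0" using assms by (simp add: ki unit_fun_def)
  show 1: "res b (unit_fun i) = 0" using assms by (simp add: ki present_def absent_def)
  show "res (unit_fun i) (unit_fun j) = 0" "res (unit_fun i) b = 0"
    using 0 1 by (simp_all add: res_commute)
  define m where "m = max n 1"
  have m: "far m i j" "1 \<le> m" "n \<le> m"
    using assms(1) far_distinct[OF assms(4)] by (auto simp: m_def max_def)
  obtain k where k: "m = Suc k" using m by (cases m) auto
  have decay: "\<bar>res a (unit_fun j)\<bar> \<le> 2 / (1 - r\<^sup>2) * r ^ Suc k"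
    using separated_absent_unit[OF assms(5) m(1)[unfolded k]] absent_weighted[OF assms(2,5)]
    by (rule res_decay_U) (simp add: dot_unit_self assms)
  \<comment> \<open>One power of \<open>r\<close> is spent here: its square satisfies
    \<open>4 r^2 <= 2 (1 + r^2)\<close>, which brings in the constant \<open>C\<close>.\<close>
  have CG: "2 / (1 - r\<^sup>2) * r \<le> sqrt (C * G)"
  proof (rule real_le_rsqrt)
    have "(2 / (1 - r\<^sup>2) * r)\<^sup>2 = 4 * r\<^sup>2 / (1 - r\<^sup>2)\<^sup>2"
      by (simp add: power_mult_distrib power_divide)
    also have "\<dots> \<le> 2 * (1 + r\<^sup>2) / (1 - r\<^sup>2)\<^sup>2"
      using r2_less_1 by (intro divide_right_mono) auto
    also have "\<dots> \<le> C * 1" using C by simp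
    also have "\<dots> \<le> C * G" using C_ge_1 G c_pos by (intro mult_left_mono) auto
    finally show "(2 / (1 - r\<^sup>2) * r)\<^sup>2 \<le> C * G" .
  qed
  have "r ^ k \<le> lam ^ k" using r lam by (intro power_mono) auto
  also have "lam ^ k = lam ^ m / lam" using lam_pos by (simp add: k)
  also have "\<dots> \<le> lam ^ n / lam"
    using m lam lam_pos by (intro divide_right_mono power_decreasing) auto
  finally have rk: "r ^ k \<le> lam ^ n / lam" .
  have "2 / (1 - r\<^sup>2) * r ^ Suc k = (2 / (1 - r\<^sup>2) * r) * r ^ k" by simp
  also have "\<dots> \<le> sqrt (C * G) * (lam ^ n / lam)"
    using C_ge_1 G c_pos r by (intro mult_mono CG rk) auto
  finally show 2: "\<bar>res a (unit_fun j)\<bar> \<le> sqrt (C * G) * (lam ^ n / lam)" using decay by simp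
  have "0 \<le> res a b"
    unfolding b using assms nonneg
    by (intro res_nonneg[OF nonneg e_less_1]) (auto simp: absent_def mapply_unit_fun)
  moreover have "res a b = res a (unit_fun j) - a j"
    unfolding b using res_mapply_right[OF e_neq_1, of a "unit_fun j"] assms by (simp add: dot_unit_fun)
  moreover have "0 \<le> a j" using assms by (simp add: absent_def)
  ultimately show "\<bar>res a b\<bar> \<le> sqrt (C * G) * (lam ^ n / lam)" using 2 by linarith
qed

text \<open>Both supports are one step away from their edges, so distance \<open>n\<close> separates
  only up to \<open>n - 2\<close>, and \<open>res_decay_V\<close> returns the power
  \<open>n - 1\<close>. For \<open>n < 2\<close> the factor \<open>lam ^ n / lam\<close> is at least
  1 and the trivial bound \<open>1 + c <= G\<close> suffices.\<close>

lemma res_absent_absent: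
  assumes "far n i j" "i < N" "j < N" "absent i a" "absent j b"
  shows "\<bar>res a b\<bar> \<le> G * (lam ^ n / lam)"
proof (cases "2 \<le> n")
  case True
  then obtain k where k: "n = Suc (Suc k)" by (metis add_2_eq_Suc le_Suc_ex)
  note w = absent_weighted[OF assms(2,4)] absent_weighted[OF assms(3,5)]
  have "\<bar>res a b\<bar> \<le> 2 * c * r ^ Suc k"
    by (rule res_decay_V[OF w]) (rule separated_absent_absent[OF assms(4,5) assms(1)[unfolded k]])
  also have "\<dots> \<le> G * lam ^ Suc k"
    using c_pos c_less_1 G r lam by (intro mult_mono power_mono) auto
  also have "lam ^ Suc k = lam ^ n / lam" using lam_pos by (simp add: k)
  finally show ?thesis .
next
  case False
  have "lam ^ 1 \<le> lam ^ n" using False lam lam_pos by (intro power_decreasing) auto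
  hence "1 \<le> lam ^ n / lam" using lam_pos by (simp add: le_divide_eq)
  hence "(1 + c) * 1 \<le> G * (lam ^ n / lam)" using G c_pos by (intro mult_mono) auto
  thus ?thesis
    using res_weighted_le[OF absent_weighted[OF assms(2,4)] absent_weighted[OF assms(3,5)]] by simp
qed

text \<open>
  \<open>z\<close> solves \<open>(1 - A) z = \<plusminus>(p e\<^sub>j + s b)\<close>; the pair of outputs \<open>(a \<bullet> z, z\<^sub>i)\<close> is compared with the
  pair of inputs \<open>(p, s)\<close>.
\<close>
context
  fixes n i j :: nat and a b z :: "nat \<Rightarrow> real" and p s \<sigma> :: real
  assumes far: "far n i j" and ij: "i < N" "j < N" and \<sigma>: "\<sigma> = 1 \<or> \<sigma> = - 1"
    and sol: "\<And>v. v < N \<Longrightarrow> z v - mapply N A z v = \<sigma> * (p * unit_fun j v + s * b v)"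
begin

lemma outputs: "(dot N a z)\<^sup>2 + (z i)\<^sup>2 = (p * res a (unit_fun j) + s * res a b)\<^sup>2
    + (p * res (unit_fun i) (unit_fun j) + s * res (unit_fun i) b)\<^sup>2"
proof -
  have "dot N u z = \<sigma> * (p * res u (unit_fun j) + s * res u b)" for u
    using dot_solution[OF e_neq_1 sol] by (simp add: res_add_right res_scale_right)
  from this[of a] this[of "unit_fun i"] show ?thesis
    using ij \<sigma> by (auto simp: dot_unit_fun power_mult_distrib)
qed

text \<open>All four entries of the matrix may be nonzero and have size at most \<open>M\<close>, so
  its norm is at most \<open>2 * M\<close>. When exactly one of the edges is absent a row or a
  column vanishes, and \<open>sqrt 2 * M\<close> remains.\<close>

lemma step_present_present:
  assumes "present i a" "present j b"
  shows "sqrt ((dot N a z)\<^sup>2 + (z i)\<^sup>2) \<le> sqrt (2 * C) * sqrt (2 * C) * (lam ^ n / lam) * sqrt (p\<^sup>2 + s\<^sup>2)"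
proof -
  define M where "M = C * (lam ^ n / lam)"
  note x = res_present_present[OF far ij assms, folded M_def]
  have "(dot N a z)\<^sup>2 + (z i)\<^sup>2 \<le> 2 * M\<^sup>2 * (p\<^sup>2 + s\<^sup>2) + 2 * M\<^sup>2 * (p\<^sup>2 + s\<^sup>2)"
    unfolding outputs
    by (intro add_mono linear_form_square_le x) auto
  also have "\<dots> = (2 * M)\<^sup>2 * (p\<^sup>2 + s\<^sup>2)" by (simp add: power_mult_distrib)
  finally have "sqrt ((dot N a z)\<^sup>2 + (z i)\<^sup>2) \<le> sqrt ((2 * M)\<^sup>2 * (p\<^sup>2 + s\<^sup>2))" by simp
  also have "\<dots> = 2 * M * sqrt (p\<^sup>2 + s\<^sup>2)"
    using C_ge_1 lam_pos by (simp add: real_sqrt_mult M_def)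
  finally show ?thesis using C_ge_1 by (simp add: M_def mult_ac)
qed

lemma step_absent_present:
  assumes "absent i a" "present j b" "i \<noteq> j"
  shows "sqrt ((dot N a z)\<^sup>2 + (z i)\<^sup>2) \<le> sqrt G * sqrt (2 * C) * (lam ^ n / lam) * sqrt (p\<^sup>2 + s\<^sup>2)"
proof -
  define M where "M = sqrt (C * G) * (lam ^ n / lam)"
  note x = res_absent_present[OF far ij assms(3,1,2), folded M_def]
  have "(dot N a z)\<^sup>2 + (z i)\<^sup>2 \<le> 2 * M\<^sup>2 * (p\<^sup>2 + s\<^sup>2)"
    unfolding outputs x(3,4)
    using linear_form_square_le[OF x(1,2), of p s] by simp
  also have "\<dots> = (sqrt 2 * M)\<^sup>2 * (p\<^sup>2 + s\<^sup>2)" by (simp add: power_mult_distrib)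
  finally have "sqrt ((dot N a z)\<^sup>2 + (z i)\<^sup>2) \<le> sqrt ((sqrt 2 * M)\<^sup>2 * (p\<^sup>2 + s\<^sup>2))" by simp
  also have "\<dots> = sqrt 2 * M * sqrt (p\<^sup>2 + s\<^sup>2)"
    using C_ge_1 G c_pos lam_pos by (simp add: real_sqrt_mult M_def)
  finally show ?thesis by (simp add: M_def real_sqrt_mult mult_ac)
qed

lemma step_present_absent:
  assumes "present i a" "absent j b" "i \<noteq> j"
  shows "sqrt ((dot N a z)\<^sup>2 + (z i)\<^sup>2) \<le> sqrt (2 * C) * sqrt G * (lam ^ n / lam) * sqrt (p\<^sup>2 + s\<^sup>2)"
proof -
  define M where "M = sqrt (C * G) * (lam ^ n / lam)"
  have "far n j i" by (rule far_sym[OF far])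
  note x = res_absent_present[OF this ij(2,1) assms(3)[symmetric] assms(2,1), folded M_def]
  have M: "0 \<le> M" using C_ge_1 G c_pos lam_pos by (simp add: M_def)
  have "\<bar>s * y\<bar> \<le> \<bar>s * M\<bar>" if "\<bar>y\<bar> \<le> M" for y
    unfolding abs_mult[of s] abs_of_nonneg[OF M] using that by (intro mult_left_mono) auto
  hence sq: "(s * y)\<^sup>2 \<le> (s * M)\<^sup>2" if "\<bar>y\<bar> \<le> M" for y
    using that abs_le_square_iff by blast
  have "(dot N a z)\<^sup>2 + (z i)\<^sup>2 \<le> (s * M)\<^sup>2 + (s * M)\<^sup>2"
    unfolding outputs x(5,6)
    using sq[OF x(1)] sq[OF x(2)] by (simp add: res_commute)
  also have "\<dots> \<le> (sqrt 2 * M)\<^sup>2 * (p\<^sup>2 + s\<^sup>2)"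
    by (simp add: power_mult_distrib distrib_left mult.commute)
  finally have "sqrt ((dot N a z)\<^sup>2 + (z i)\<^sup>2) \<le> sqrt ((sqrt 2 * M)\<^sup>2 * (p\<^sup>2 + s\<^sup>2))" by simp
  also have "\<dots> = sqrt 2 * M * sqrt (p\<^sup>2 + s\<^sup>2)"
    using C_ge_1 G c_pos lam_pos by (simp add: real_sqrt_mult M_def)
  finally show ?thesis by (simp add: M_def real_sqrt_mult mult_ac)
qed

text \<open>Each column vanishes at the other edge, so only one entry per row and per column
  survives and the norm is at most \<open>M\<close>, without a factor 2. The entry at
  \<open>e_i, e_j\<close> is 1 for equal edges, where the distance is 0, and 0 otherwise.\<close>

lemma step_absent_absent:
  assumes "absent i a" "absent j b" "a j = 0" "b i = 0"
  shows "sqrt ((dot N a z)\<^sup>2 + (z i)\<^sup>2) \<le> sqrt G * sqrt G * (lam ^ n / lam) * sqrt (p\<^sup>2 + s\<^sup>2)"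
proof -
  define M where "M = G * (lam ^ n / lam)"
  have M: "0 \<le> M" using G c_pos lam_pos by (simp add: M_def)
  have 1: "res a (unit_fun j) = 0" "res (unit_fun i) b = 0"
    using res_unit_absent[OF ij(2) assms(2), of a] res_unit_absent[OF ij(1) assms(1), of b] assms
    by (simp_all add: res_commute)
  have 2: "\<bar>res (unit_fun i) (unit_fun j)\<bar> \<le> M"
  proof (cases "i = j")
    case True
    hence n: "n = 0" using far by (cases n) (auto simp: far_def)
    have "1 * 1 \<le> G * (1 / lam)" using G c_pos lam lam_pos by (intro mult_mono) auto
    thus ?thesis using True n res_unit_absent[OF ij(2) assms(2)] by (simp add: unit_fun_def M_def)
  next
    case False
    thus ?thesis using M res_unit_absent[OF ij(2) assms(2)] by (simp add: unit_fun_def)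
  qed
  have sq: "(t * y)\<^sup>2 \<le> M\<^sup>2 * t\<^sup>2" if "\<bar>y\<bar> \<le> M" for t y :: real
  proof -
    have "\<bar>y\<bar> ^ 2 \<le> M ^ 2" using that by (intro power_mono) auto
    hence "t\<^sup>2 * y\<^sup>2 \<le> t\<^sup>2 * M\<^sup>2" by (intro mult_left_mono) auto
    thus ?thesis by (simp only: power_mult_distrib mult.commute)
  qed
  have "(dot N a z)\<^sup>2 + (z i)\<^sup>2 \<le> M\<^sup>2 * s\<^sup>2 + M\<^sup>2 * p\<^sup>2"
    unfolding outputs 1
    using sq[OF res_absent_absent[OF far ij assms(1,2), folded M_def], of s] sq[OF 2, of p] by simp
  also have "\<dots> = M\<^sup>2 * (p\<^sup>2 + s\<^sup>2)" by (simp add: distrib_left)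
  finally have "sqrt ((dot N a z)\<^sup>2 + (z i)\<^sup>2) \<le> sqrt (M\<^sup>2 * (p\<^sup>2 + s\<^sup>2))" by simp
  also have "\<dots> = M * sqrt (p\<^sup>2 + s\<^sup>2)" using M by (simp add: real_sqrt_mult)
  finally show ?thesis using G c_pos by (simp add: M_def)
qed

end

end

section \<open>Spectra of real symmetric matrices\<close>

abbreviation entries :: "real mat \<Rightarrow> nat \<Rightarrow> nat \<Rightarrow> real" where
  "entries M \<equiv> \<lambda>i j. M $$ (i, j)"

text \<open>A complex eigenvector is expanded in the real eigenbasis; by completeness some
  coordinate \<open>x k\<close> is nonzero, and symmetry gives
  \<open>mu x_k = e_k x_k\<close>.\<close>

lemma spectrum_complexified:
  assumes M: "M \<in> carrier_mat N N"
    and sym: "\<And>i j. i < N \<Longrightarrow> j < N \<Longrightarrow> M $$ (i, j) = M $$ (j, i)"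
    and basis: "eigenbasis N (entries M) e q"
  shows "spectrum (map_mat complex_of_real M) = complex_of_real ` e ` {..<N}"
proof (intro equalityI subsetI)
  fix \<mu> assume "\<mu> \<in> complex_of_real ` e ` {..<N}"
  then obtain k where k: "k < N" "\<mu> = complex_of_real (e k)" by auto
  let ?v = "vec N (\<lambda>i. complex_of_real (q k i))"
  have "dot N (q k) (q k) = 1" using basis k by (simp add: eigenbasis_def)
  then obtain i where "i < N" "q k i \<noteq> 0" using dot_self_eq_0[of N "q k"] by auto
  hence "?v \<noteq> 0\<^sub>v N" by (metis index_vec index_zero_vec(1) of_real_eq_0_iff)
  moreover have "map_mat complex_of_real M *\<^sub>v ?v = \<mu> \<cdot>\<^sub>v ?v"
  proof (rule eq_vecI)
    fix i assume "i < dim_vec (\<mu> \<cdot>\<^sub>v ?v)"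
    hence i: "i < N" by simp
    have "(map_mat complex_of_real M *\<^sub>v ?v) $ i = complex_of_real (mapply N (entries M) (q k) i)"
      using i M by (simp add: scalar_prod_def mapply_def atLeast0LessThan)
    thus "(map_mat complex_of_real M *\<^sub>v ?v) $ i = (\<mu> \<cdot>\<^sub>v ?v) $ i"
      using i k basis by (simp add: eigenbasis_def)
  qed (use M in simp)
  ultimately show "\<mu> \<in> spectrum (map_mat complex_of_real M)"
    using M by (auto simp: spectrum_def eigenvalue_def eigenvector_def intro!: exI[of _ ?v])
next
  fix \<mu> assume "\<mu> \<in> spectrum (map_mat complex_of_real M)"
  then obtain v where v: "v \<in> carrier_vec N" "v \<noteq> 0\<^sub>v N"
    and ev: "map_mat complex_of_real M *\<^sub>v v = \<mu> \<cdot>\<^sub>v v"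
    using M by (auto simp: spectrum_def eigenvalue_def eigenvector_def)
  define x where "x k = (\<Sum>i<N. complex_of_real (q k i) * v $ i)" for k
  have row: "(\<Sum>j<N. complex_of_real (M $$ (i, j)) * v $ j) = \<mu> * v $ i" if "i < N" for i
    using arg_cong[OF ev, of "\<lambda>w. w $ i"] that M v
    by (simp add: scalar_prod_def atLeast0LessThan)
  have eig: "(\<Sum>i<N. q k i * M $$ (i, j)) = e k * q k j" if "k < N" "j < N" for k j
  proof -
    have "(\<Sum>i<N. q k i * M $$ (i, j)) = mapply N (entries M) (q k) j"
      unfolding mapply_def using that sym[of _ j] by (intro sum.cong refl) simp
    thus ?thesis using basis that by (simp add: eigenbasis_def)
  qed
  have "\<mu> * x k = complex_of_real (e k) * x k" if k: "k < N" for k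
  proof -
    have "\<mu> * x k = (\<Sum>i<N. complex_of_real (q k i) * (\<mu> * v $ i))"
      by (simp add: x_def sum_distrib_left mult_ac)
    also have "\<dots> = (\<Sum>i<N. \<Sum>j<N. complex_of_real (q k i * M $$ (i, j)) * v $ j)"
      by (intro sum.cong refl) (simp add: row[symmetric] sum_distrib_left mult_ac)
    also have "\<dots> = (\<Sum>j<N. complex_of_real (\<Sum>i<N. q k i * M $$ (i, j)) * v $ j)"
      unfolding of_real_sum sum_distrib_right by (rule sum.swap)
    also have "\<dots> = (\<Sum>j<N. complex_of_real (e k) * (complex_of_real (q k j) * v $ j))"
      using k by (intro sum.cong refl) (simp add: eig)
    finally show ?thesis by (simp add: x_def sum_distrib_left)
  qed
  moreover obtain k where "k < N" "x k \<noteq> 0"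
  proof (rule ccontr)
    assume "\<not> thesis"
    hence x0: "\<And>k. k < N \<Longrightarrow> x k = 0" using that by blast
    have "v $ i = 0" if i: "i < N" for i
    proof -
      have "0 = (\<Sum>k<N. complex_of_real (q k i) * x k)" by (simp add: x0)
      also have "\<dots> = (\<Sum>k<N. \<Sum>j<N. complex_of_real (q k j * q k i) * v $ j)"
        by (simp add: x_def sum_distrib_left mult_ac)
      also have "\<dots> = (\<Sum>j<N. complex_of_real (\<Sum>k<N. q k j * q k i) * v $ j)"
        unfolding of_real_sum sum_distrib_right by (rule sum.swap)
      also have "\<dots> = (\<Sum>j<N. if j = i then v $ j else 0)"
        using i by (intro sum.cong refl) (simp add: eigenbasis_complete[OF basis])
      finally show ?thesis using i by simp
    qed
    hence "v = 0\<^sub>v N" using v(1) by (intro eq_vecI) auto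
    thus False using v(2) by simp
  qed
  ultimately show "\<mu> \<in> complex_of_real ` e ` {..<N}" by auto
qed

lemma eigenbasis_cong:
  assumes "\<And>i j. i < N \<Longrightarrow> j < N \<Longrightarrow> A i j = A' i j" "eigenbasis N A e q"
  shows "eigenbasis N A' e q"
proof -
  have "mapply N A' x i = mapply N A x i" if "i < N" for x i
    using that assms(1) by (simp add: mapply_def)
  thus ?thesis using assms(2) by (simp add: eigenbasis_def)
qed

lemma eigenbasis_scale:
  assumes "eigenbasis N A e q"
  shows "eigenbasis N (\<lambda>i j. c * A i j) (\<lambda>k. c * e k) q"
proof -
  have "mapply N (\<lambda>i j. c * A i j) x i = c * mapply N A x i" for x i
    by (simp add: mapply_def sum_distrib_left mult_ac)
  thus ?thesis using assms by (simp add: eigenbasis_def)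
qed

lemma eigenbasis_one_minus:
  assumes "eigenbasis N A e q"
  shows "eigenbasis N (\<lambda>i j. of_bool (i = j) - A i j) (\<lambda>k. 1 - e k) q"
proof -
  have "mapply N (\<lambda>i j. of_bool (i = j) - A i j) x i = x i - mapply N A x i" if "i < N" for x i
  proof -
    have "(\<Sum>j<N. of_bool (i = j) * x j) = (\<Sum>j<N. if i = j then x j else 0)"
      by (intro sum.cong refl) simp
    thus ?thesis using that by (simp add: mapply_def left_diff_distrib sum_subtractf)
  qed
  thus ?thesis using assms by (simp add: eigenbasis_def left_diff_distrib)
qed

lemma smallest_spectral_interval_bounds:
  assumes "smallest_spectral_interval a b ((\<lambda>m. 1\<^sub>m N - A m) ` T)"
    and A: "\<And>m. m \<in> T \<Longrightarrow> A m \<in> carrier_mat N N"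
    and sym: "\<And>m i j. m \<in> T \<Longrightarrow> i < N \<Longrightarrow> j < N \<Longrightarrow> A m $$ (i, j) = A m $$ (j, i)"
    and basis: "\<And>m. m \<in> T \<Longrightarrow> eigenbasis N (entries (A m)) (e m) (q m)"
    and ne: "T \<noteq> {}" "0 < N"
  shows "\<And>m k. m \<in> T \<Longrightarrow> k < N \<Longrightarrow> a \<le> 1 - e m k \<and> 1 - e m k \<le> b"
    and "\<And>a' b'. (\<And>m k. m \<in> T \<Longrightarrow> k < N \<Longrightarrow> a' \<le> 1 - e m k \<and> 1 - e m k \<le> b') \<Longrightarrow> a' \<le> a \<and> b \<le> b'"
proof -
  have spec: "spectrum (map_mat complex_of_real (1\<^sub>m N - A m)) = complex_of_real ` (\<lambda>k. 1 - e m k) ` {..<N}"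
    if m: "m \<in> T" for m
  proof (rule spectrum_complexified)
    show "1\<^sub>m N - A m \<in> carrier_mat N N" using A[OF m] by (intro minus_carrier_mat)
    show "(1\<^sub>m N - A m) $$ (i, j) = (1\<^sub>m N - A m) $$ (j, i)" if "i < N" "j < N" for i j
      using A[OF m] sym[OF m that] that by simp
    show "eigenbasis N (entries (1\<^sub>m N - A m)) (\<lambda>k. 1 - e m k) (q m)"
      using A[OF m] by (intro eigenbasis_cong[OF _ eigenbasis_one_minus[OF basis[OF m]]]) simp
  qed
  define \<sigma> where "\<sigma> = (\<Union>M\<in>(\<lambda>m. 1\<^sub>m N - A m) ` T. spectrum (map_mat complex_of_real M))"
  have \<sigma>: "\<sigma> \<subseteq> complex_of_real ` {a..b}"
    "\<And>a' b'. \<sigma> \<subseteq> complex_of_real ` {a'..b'} \<Longrightarrow> {a..b} \<subseteq> {a'..b'}"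
    using assms(1) unfolding smallest_spectral_interval_def Let_def \<sigma>_def[symmetric] by blast+
  have \<sigma>_eq: "\<sigma> = (\<Union>m\<in>T. complex_of_real ` (\<lambda>k. 1 - e m k) ` {..<N})"
    by (simp add: \<sigma>_def spec)
  show 1: "a \<le> 1 - e m k \<and> 1 - e m k \<le> b" if "m \<in> T" "k < N" for m k
  proof -
    have "complex_of_real (1 - e m k) \<in> \<sigma>" unfolding \<sigma>_eq using that by blast
    hence "complex_of_real (1 - e m k) \<in> complex_of_real ` {a..b}" using \<sigma>(1) by blast
    thus ?thesis by (metis atLeastAtMost_iff image_iff of_real_eq_iff)
  qed
  fix a' b' assume *: "\<And>m k. m \<in> T \<Longrightarrow> k < N \<Longrightarrow> a' \<le> 1 - e m k \<and> 1 - e m k \<le> b'"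
  have "\<sigma> \<subseteq> complex_of_real ` {a'..b'}" unfolding \<sigma>_eq using * by fastforce
  hence "{a..b} \<subseteq> {a'..b'}" by (rule \<sigma>(2))
  \<comment> \<open>An inclusion of intervals compares end points only if the smaller one is
    nonempty.\<close>
  moreover have "a \<le> b" using 1 ne by fastforce
  ultimately show "a' \<le> a \<and> b \<le> b'" by simp
qed

section \<open>Line graphs and their layers\<close>

lemma line_adj_index:
  assumes B: "incidence_mat V N B" and ij: "i < N" "j < N"
  shows "line_adj B $$ (i, j) =
    real (card {v. v < V \<and> B $$ (v, i) = 1 \<and> B $$ (v, j) = 1}) - 2 * of_bool (i = j)"
proof -
  have dim: "dim_row B = V" "dim_col B = N" and el: "elements_mat B \<subseteq> {0, 1}"
    using B by (auto simp: incidence_mat_def)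
  have B01: "B $$ (v, i) \<in> {0, 1}" if "v < V" "i < N" for v i
    using el that dim by (metis elements_matI carrier_matI subsetD)
  have "(transpose_mat B * B) $$ (i, j) = (\<Sum>v<V. B $$ (v, i) * B $$ (v, j))"
    using ij dim by (simp add: scalar_prod_def atLeast0LessThan)
  also have "\<dots> = (\<Sum>v<V. if B $$ (v, i) = 1 \<and> B $$ (v, j) = 1 then 1 else 0)"
    using B01 ij by (intro sum.cong refl) fastforce
  also have "\<dots> = real (card {v. v < V \<and> B $$ (v, i) = 1 \<and> B $$ (v, j) = 1})"
    by (simp add: sum.If_cases) (rule arg_cong[where f = card], auto)
  finally show ?thesis using ij dim by (simp add: line_adj_def)
qed

text \<open>Each edge has two end nodes, which \<open>- 2 I\<close> removes from the diagonal;
  distinct columns mean distinct pairs of end nodes, so two edges share at most one node.\<close>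

lemma line_adj_props:
  assumes B: "incidence_mat V N B" and ij: "i < N" "j < N"
  shows "line_adj B $$ (i, j) \<in> {0, 1}" "line_adj B $$ (i, i) = 0"
    "line_adj B $$ (i, j) = line_adj B $$ (j, i)"
proof -
  define I where "I e = {v. v < V \<and> B $$ (v, e) = 1}" for e
  have dim: "dim_row B = V" "dim_col B = N" and el: "elements_mat B \<subseteq> {0, 1}"
    using B by (auto simp: incidence_mat_def)
  have card: "card (I e) = 2" if "e < N" for e
    using B that by (simp add: incidence_mat_def I_def)
  have idx: "line_adj B $$ (i, j) = real (card (I i \<inter> I j)) - 2 * of_bool (i = j)"
    if "i < N" "j < N" for i j
  proof -
    have "I i \<inter> I j = {v. v < V \<and> B $$ (v, i) = 1 \<and> B $$ (v, j) = 1}" by (auto simp: I_def)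
    thus ?thesis by (simp add: line_adj_index[OF B that])
  qed
  show 0: "line_adj B $$ (i, i) = 0" using idx[OF ij(1,1)] card[OF ij(1)] by simp
  show "line_adj B $$ (i, j) = line_adj B $$ (j, i)"
    using idx[OF ij] idx[OF ij(2,1)] by (simp add: Int_commute eq_commute)
  show "line_adj B $$ (i, j) \<in> {0, 1}"
  proof (cases "i = j")
    case False
    have B01: "B $$ (v, e) \<in> {0, 1}" if "v < V" "e < N" for v e
      using el that dim by (metis elements_matI carrier_matI subsetD)
    have fin: "finite (I e)" for e by (simp add: I_def)
    have "I i \<noteq> I j"
    proof
      assume eq: "I i = I j"
      have "col B i = col B j"
      proof (rule eq_vecI)
        fix v assume "v < dim_vec (col B j)"
        hence v: "v < V" using dim by simp
        have "B $$ (v, i) = 1 \<longleftrightarrow> B $$ (v, j) = 1"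
          using eq v by (auto simp: I_def set_eq_iff)
        hence "B $$ (v, i) = B $$ (v, j)" using B01[OF v ij(1)] B01[OF v ij(2)] by auto
        thus "col B i $ v = col B j $ v" using v dim ij by simp
      qed simp
      moreover have "inj_on (col B) {..<N}" using B by (simp add: incidence_mat_def)
      ultimately show False using False ij by (auto dest: inj_onD)
    qed
    hence "I i \<inter> I j \<subset> I i"
      using card_subset_eq[OF fin, of "I i" j] card[OF ij(1)] card[OF ij(2)] by auto
    hence "card (I i \<inter> I j) < 2" using psubset_card_mono[OF fin] card[OF ij(1)] by metis
    thus ?thesis using idx[OF ij] False by auto
  qed (use 0 in simp)
qed

lemma unscaled_layer_carrier: "unscaled_layer B S t \<in> carrier_mat (dim_col B) (dim_col B)"
  unfolding unscaled_layer_def intact_mat_def line_adj_def by (intro carrier_matI) simp_all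

lemma unscaled_layer_index:
  assumes "i < dim_col B" "j < dim_col B"
  shows "unscaled_layer B S t $$ (i, j)
    = (if i \<in> S t \<and> j \<in> S t then line_adj B $$ (i, j) else 0)"
proof -
  let ?N = "dim_col B"
  have Lm: "line_adj B \<in> carrier_mat ?N ?N"
    unfolding line_adj_def by (intro carrier_matI) simp_all
  have 1: "(intact_mat ?N (S t) * line_adj B) $$ (i, j)
      = (if i \<in> S t then line_adj B $$ (i, j) else 0)" if "i < ?N" "j < ?N" for i j
  proof -
    have "(intact_mat ?N (S t) * line_adj B) $$ (i, j)
        = (\<Sum>k<?N. (if i = k \<and> i \<in> S t then 1 else 0) * line_adj B $$ (k, j))"
      using that Lm by (simp add: intact_mat_def scalar_prod_def atLeast0LessThan)
    also have "\<dots> = (\<Sum>k<?N. if i = k then (if i \<in> S t then line_adj B $$ (k, j) else 0) else 0)"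
      by (intro sum.cong refl) auto
    finally show ?thesis using that by simp
  qed
  have "unscaled_layer B S t $$ (i, j)
      = (\<Sum>k<?N. (intact_mat ?N (S t) * line_adj B) $$ (i, k) * (if k = j \<and> k \<in> S t then 1 else 0))"
    using assms Lm
    by (simp add: unscaled_layer_def intact_mat_def scalar_prod_def atLeast0LessThan)
  also have "\<dots> = (\<Sum>k<?N. if k = j then (if j \<in> S t then (intact_mat ?N (S t) * line_adj B) $$ (i, j) else 0) else 0)"
    by (intro sum.cong refl) auto
  finally show ?thesis using assms by (simp add: 1)
qed

lemma row_sum_le_max_degree:
  assumes B: "incidence_mat V N B" and i: "i < N"
  shows "(\<Sum>j<N. line_adj B $$ (i, j)) \<le> real (max_degree (line_adj B))"
proof -
  have dim: "dim_row (line_adj B) = N" using B by (auto simp: line_adj_def incidence_mat_def)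
  have "(\<Sum>j<N. line_adj B $$ (i, j)) = (\<Sum>j<N. if line_adj B $$ (i, j) \<noteq> 0 then 1 else 0)"
    using line_adj_props(1)[OF B i] by (intro sum.cong refl) auto
  also have "\<dots> = real (card {j. j < N \<and> line_adj B $$ (i, j) \<noteq> 0})"
    by (simp add: sum.If_cases) (rule arg_cong[where f = card], auto)
  also have "\<dots> \<le> real (max_degree (line_adj B))"
    unfolding max_degree_def of_nat_le_iff dim using i by (intro Max_ge) auto
  finally show ?thesis .
qed

lemma eigenvalue_le_row_sum:
  assumes "eigenbasis N A e q" "k < N"
    and "\<And>i. i < N \<Longrightarrow> (\<Sum>j<N. \<bar>A i j\<bar>) \<le> g"
  shows "\<bar>e k\<bar> \<le> g"
proof -
  define m where "m = Max ((\<lambda>i. \<bar>q k i\<bar>) ` {..<N})"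
  have "m \<in> (\<lambda>i. \<bar>q k i\<bar>) ` {..<N}" unfolding m_def using assms(2) by (intro Max_in) auto
  then obtain i where i: "i < N" "m = \<bar>q k i\<bar>" by auto
  have le: "\<bar>q k j\<bar> \<le> m" if "j < N" for j
    unfolding m_def using that by (intro Max_ge) auto
  have "m \<noteq> 0"
  proof
    assume "m = 0"
    hence "dot N (q k) (q k) = 0" using le by (simp add: dot_self_eq_0)
    thus False using assms(1,2) by (simp add: eigenbasis_def)
  qed
  hence m: "0 < m" using i by simp
  have "\<bar>e k\<bar> * m = \<bar>mapply N A (q k) i\<bar>"
    using assms(1,2) i by (simp add: eigenbasis_def abs_mult)
  also have "\<dots> \<le> (\<Sum>j<N. \<bar>A i j\<bar> * m)"
    unfolding mapply_def
    by (intro order_trans[OF sum_abs] sum_mono) (simp add: abs_mult le mult_left_mono)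
  also have "\<dots> \<le> g * m"
    unfolding sum_distrib_right[symmetric] using m assms(3)[OF i(1)] by (intro mult_right_mono) auto
  finally show ?thesis using m by simp
qed

section \<open>Block back substitution\<close>

lemma katz_inverse:
  fixes M :: "real mat"
  assumes "M \<in> carrier_mat n n"
    and inj: "\<And>v. v \<in> carrier_vec n \<Longrightarrow> (1\<^sub>m n - M) *\<^sub>v v = 0\<^sub>v n \<Longrightarrow> v = 0\<^sub>v n"
  shows "katz M \<in> carrier_mat n n" "(1\<^sub>m n - M) * katz M = 1\<^sub>m n"
proof -
  have I: "1\<^sub>m n - M \<in> carrier_mat n n" using assms(1) by (rule minus_carrier_mat)
  have "det (1\<^sub>m n - M) \<noteq> 0" using inj by (subst det_0_iff_vec_prod_zero_field[OF I]) auto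
  hence "1\<^sub>m n - M \<in> Units (ring_mat TYPE(real) n ())" by (rule det_non_zero_imp_unit[OF I])
  then obtain K where K: "mat_inverse (1\<^sub>m n - M) = Some K"
    using mat_inverse(1)[OF I, where b = "()"] by (cases "mat_inverse (1\<^sub>m n - M)") auto
  have "katz M = K" using K assms(1) by (auto simp: katz_def)
  thus "katz M \<in> carrier_mat n n" "(1\<^sub>m n - M) * katz M = 1\<^sub>m n"
    using mat_inverse(2)[OF I K] by auto
qed

lemma sum_lessThan_add:
  fixes f :: "nat \<Rightarrow> real"
  shows "(\<Sum>p<a + b. f p) = (\<Sum>p<a. f p) + (\<Sum>j<b. f (a + j))"
  by (induction b) simp_all

lemma sum_blocks:
  fixes f :: "nat \<Rightarrow> real"
  shows "(\<Sum>p<N * L. f p) = (\<Sum>t<L. \<Sum>j<N. f (t * N + j))"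
proof (induction L)
  case (Suc L)
  have "(\<Sum>p<N * Suc L. f p) = (\<Sum>p<N * L + N. f p)" by (simp add: add.commute)
  also have "\<dots> = (\<Sum>p<N * L. f p) + (\<Sum>j<N. f (N * L + j))"
    by (rule sum_lessThan_add)
  finally show ?case using Suc by (simp add: mult.commute)
qed simp

lemma one_minus_mult_vec_index:
  fixes M :: "real mat"
  assumes "M \<in> carrier_mat n n" "v \<in> carrier_vec n" "p < n"
  shows "((1\<^sub>m n - M) *\<^sub>v v) $ p = v $ p - (\<Sum>q<n. M $$ (p, q) * v $ q)"
proof -
  have "((1\<^sub>m n - M) *\<^sub>v v) $ p = (\<Sum>q<n. (of_bool (p = q) - M $$ (p, q)) * v $ q)"
    using assms by (simp add: scalar_prod_def atLeast0LessThan of_bool_def)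
  also have "\<dots> = (\<Sum>q<n. (if p = q then v $ q else 0) - M $$ (p, q) * v $ q)"
    by (intro sum.cong refl) (simp add: left_diff_distrib)
  finally show ?thesis using assms by (simp add: sum_subtractf)
qed

definition block_fun :: "nat \<Rightarrow> real vec \<Rightarrow> nat \<Rightarrow> nat \<Rightarrow> real" where
  "block_fun N v s i = v $ ((s - 1) * N + i)"

lemma block_index_less:
  fixes N L s i :: nat
  assumes "s \<in> {1..L}" "i < N"
  shows "(s - 1) * N + i < N * L"
proof -
  have "(s - 1) * N + i < (s - 1) * N + N" using assms by simp
  also have "\<dots> = s * N" using assms by (cases s) auto
  also have "\<dots> \<le> L * N" using assms by (intro mult_right_mono) auto
  finally show ?thesis by (simp add: mult.commute)
qed

lemma supra_row:
  assumes v: "v \<in> carrier_vec (N * L)" and s: "s \<in> {1..L}" and i: "i < N"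
  shows "((1\<^sub>m (N * L) - supra_adj N L A W) *\<^sub>v v) $ ((s - 1) * N + i)
    = block_fun N v s i - mapply N (entries (A s)) (block_fun N v s) i
      - (if s < L then mapply N (entries (W s)) (block_fun N v (s + 1)) i else 0)"
proof -
  let ?p = "(s - 1) * N + i"
  let ?X = "mapply N (entries (A s)) (block_fun N v s) i"
  let ?Y = "mapply N (entries (W s)) (block_fun N v (s + 1)) i"
  have p: "?p < N * L" by (rule block_index_less[OF s i])
  have M: "supra_adj N L A W \<in> carrier_mat (N * L) (N * L)" by (simp add: supra_adj_def)
  have pm: "?p div N + 1 = s" "?p mod N = i" using s i by auto
  have "(\<Sum>q<N * L. supra_adj N L A W $$ (?p, q) * v $ q)
      = (\<Sum>t<L. \<Sum>j<N. supra_adj N L A W $$ (?p, t * N + j) * v $ (t * N + j))"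
    by (rule sum_blocks)
  \<comment> \<open>Blocks \<open>t\<close> count from 0 and times from 1, so
    \<open>t = s - 1\<close> is the diagonal block and \<open>t = s\<close> the superdiagonal one,
    which is out of range for \<open>s = L\<close>.\<close>
  also have "\<dots> = (\<Sum>t<L. (if t = s - 1 then ?X else 0) + (if t = s then ?Y else 0))"
  proof (intro sum.cong refl)
    fix t assume "t \<in> {..<L}"
    hence t: "t < L" by simp
    have "supra_adj N L A W $$ (?p, t * N + j) * v $ (t * N + j)
        = (if t = s - 1 then A s $$ (i, j) * block_fun N v s j else 0)
          + (if t = s then W s $$ (i, j) * block_fun N v (s + 1) j else 0)" if j: "j < N" for j
    proof -
      have "t * N + j < N * L" using block_index_less[of "t + 1" L j N] t j by simp
      moreover have "(t * N + j) div N + 1 = t + 1" "(t * N + j) mod N = j" using j by auto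
      ultimately have "supra_adj N L A W $$ (?p, t * N + j)
          = (if t + 1 = s then A s $$ (i, j) else if t + 1 = s + 1 then W s $$ (i, j) else 0)"
        using p unfolding supra_adj_def by (simp only: index_mat split Let_def pm)
      thus ?thesis using s by (auto simp: block_fun_def)
    qed
    thus "(\<Sum>j<N. supra_adj N L A W $$ (?p, t * N + j) * v $ (t * N + j))
        = (if t = s - 1 then ?X else 0) + (if t = s then ?Y else 0)"
      by (simp add: mapply_def sum.distrib)
  qed
  also have "\<dots> = ?X + (if s < L then ?Y else 0)"
    using s by (simp add: sum.distrib) linarith
  finally show ?thesis
    using one_minus_mult_vec_index[OF M v p] by (simp add: block_fun_def)
qed

text \<open>Block \<open>k\<close> of the solution whose right-hand side is the indicator of block
  \<open>l\<close> is the row sum vector in question. Solving upwards from the last block gives both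
  the invertibility of the supra matrix and the vanishing of all blocks after
  \<open>l\<close>.\<close>

lemma supra_katz_block:
  assumes kl: "k \<in> {1..L}" "l \<in> {1..L}"
    and inj: "\<And>s z. s \<in> {1..L} \<Longrightarrow> (\<And>i. i < N \<Longrightarrow> z i - mapply N (entries (A s)) z i = 0) \<Longrightarrow>
      (\<And>i. i < N \<Longrightarrow> z i = 0)"
  shows "\<exists>z. (\<forall>i<N. (block_mat N (katz (supra_adj N L A W)) k l *\<^sub>v ones N) $ i = z k i) \<and>
    (\<forall>i<N. z l i - mapply N (entries (A l)) (z l) i = 1) \<and>
    (\<forall>s\<in>{1..<l}. \<forall>i<N. z s i - mapply N (entries (A s)) (z s) i = mapply N (entries (W s)) (z (s + 1)) i)"
proof -
  let ?n = "N * L"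
  let ?M = "supra_adj N L A W"
  have M: "?M \<in> carrier_mat ?n ?n" by (simp add: supra_adj_def)
  have downward: "\<forall>i<N. block_fun N v s i = 0"
    if v: "v \<in> carrier_vec ?n" and t: "t \<in> {1..L}"
      and zero: "\<And>s i. s \<in> {t..L} \<Longrightarrow> i < N \<Longrightarrow> ((1\<^sub>m ?n - ?M) *\<^sub>v v) $ ((s - 1) * N + i) = 0"
      and s: "s \<in> {t..L}" for v t s
  proof -
    have "\<forall>i<N. block_fun N v (L - d) i = 0" if "d \<le> L - t" for d
      using that
    proof (induction d rule: less_induct)
      case (less d)
      let ?s = "L - d"
      have s: "?s \<in> {1..L}" "?s \<in> {t..L}" using less.prems t by auto
      show ?case
      proof (intro allI impI, rule inj[OF s(1)])
        fix i assume i: "i < N"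
        have "(if ?s < L then mapply N (entries (W ?s)) (block_fun N v (?s + 1)) i else 0) = 0"
        proof (cases "?s < L")
          case True
          have "?s + 1 = L - (d - 1)" "d - 1 < d" using True s by auto
          hence "\<forall>i<N. block_fun N v (?s + 1) i = 0" using less.IH[of "d - 1"] less.prems by simp
          thus ?thesis by (simp add: mapply_def)
        qed simp
        thus "block_fun N v ?s i - mapply N (entries (A ?s)) (block_fun N v ?s) i = 0"
          using supra_row[OF v s(1) i, of A W] zero[OF s(2) i] by linarith
      qed
    qed
    from this[of "L - s"] s show ?thesis by (simp add: diff_le_mono2)
  qed
  have "v = 0\<^sub>v ?n" if v: "v \<in> carrier_vec ?n" and 0: "(1\<^sub>m ?n - ?M) *\<^sub>v v = 0\<^sub>v ?n" for v
  proof (rule eq_vecI)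
    fix p assume "p < dim_vec (0\<^sub>v ?n :: real vec)"
    hence p: "p < ?n" by simp
    hence N: "0 < N" by (cases N) auto
    have pd: "p div N < L" using p by (simp add: less_mult_imp_div_less mult.commute)
    have "\<forall>i<N. block_fun N v (p div N + 1) i = 0"
    proof (rule downward[OF v])
      show "1 \<in> {1..L}" "p div N + 1 \<in> {1..L}" using pd by auto
      fix s i assume "s \<in> {1..L}" "i < N"
      thus "((1\<^sub>m ?n - ?M) *\<^sub>v v) $ ((s - 1) * N + i) = 0"
        unfolding 0 using block_index_less[of s L i N] by simp
    qed
    hence "block_fun N v (p div N + 1) (p mod N) = 0" using N by simp
    thus "v $ p = 0\<^sub>v ?n $ p" using p by (simp add: block_fun_def)
  qed (use v in simp)
  from katz_inverse[OF M this]
  have K: "katz ?M \<in> carrier_mat ?n ?n" and inv: "(1\<^sub>m ?n - ?M) * katz ?M = 1\<^sub>m ?n" by auto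
  define b where "b = vec ?n (\<lambda>p. if p div N + 1 = l then 1 else 0 :: real)"
  define u where "u = katz ?M *\<^sub>v b"
  have b: "b \<in> carrier_vec ?n" by (simp add: b_def)
  have u: "u \<in> carrier_vec ?n" using K b by (simp add: u_def)
  have "(1\<^sub>m ?n - ?M) *\<^sub>v u = ((1\<^sub>m ?n - ?M) * katz ?M) *\<^sub>v b"
    unfolding u_def using M K b by (intro assoc_mult_mat_vec[symmetric]) auto
  hence eq: "(1\<^sub>m ?n - ?M) *\<^sub>v u = b" using inv b by simp
  have bidx: "b $ ((s - 1) * N + i) = (if s = l then 1 else 0)" if "s \<in> {1..L}" "i < N" for s i
    using block_index_less[OF that] that by (auto simp: b_def)
  have row: "block_fun N u s i - mapply N (entries (A s)) (block_fun N u s) i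
      - (if s < L then mapply N (entries (W s)) (block_fun N u (s + 1)) i else 0)
      = (if s = l then 1 else 0)" if "s \<in> {1..L}" "i < N" for s i
    using supra_row[OF u that, of A W] bidx[OF that] eq by simp
  have 1: "(block_mat N (katz ?M) k l *\<^sub>v ones N) $ i = block_fun N u k i" if i: "i < N" for i
  proof -
    have pi: "(k - 1) * N + i < ?n" by (rule block_index_less[OF kl(1) i])
    have "block_fun N u k i = (\<Sum>q<?n. katz ?M $$ ((k - 1) * N + i, q) * b $ q)"
      using pi K b by (simp add: block_fun_def u_def scalar_prod_def atLeast0LessThan)
    also have "\<dots> = (\<Sum>t<L. \<Sum>j<N. katz ?M $$ ((k - 1) * N + i, t * N + j) * b $ (t * N + j))"
      by (rule sum_blocks)
    also have "\<dots> = (\<Sum>t<L. if t = l - 1 then \<Sum>j<N. katz ?M $$ ((k - 1) * N + i, t * N + j) else 0)"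
    proof (intro sum.cong refl)
      fix t assume "t \<in> {..<L}"
      hence "b $ (t * N + j) = (if t = l - 1 then 1 else 0)" if "j < N" for j
        using bidx[of "t + 1" j] kl that by auto
      thus "(\<Sum>j<N. katz ?M $$ ((k - 1) * N + i, t * N + j) * b $ (t * N + j))
        = (if t = l - 1 then \<Sum>j<N. katz ?M $$ ((k - 1) * N + i, t * N + j) else 0)" by simp
    qed
    also have "\<dots> = (\<Sum>j<N. katz ?M $$ ((k - 1) * N + i, (l - 1) * N + j))"
    proof -
      have "l - 1 < L" using kl by auto
      thus ?thesis by simp
    qed
    also have "\<dots> = (block_mat N (katz ?M) k l *\<^sub>v ones N) $ i"
      using i by (simp add: block_mat_def ones_def scalar_prod_def atLeast0LessThan)
    finally show ?thesis by simp
  qed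
  \<comment> \<open>Hence row \<open>l\<close> has no coupling term, and \<open>z l\<close> is the
    Katz vector of layer \<open>l\<close> alone.\<close>
  have beyond: "mapply N (entries (W l)) (block_fun N u (l + 1)) i = 0" if "l < L" for i
  proof -
    have "\<forall>j<N. block_fun N u (l + 1) j = 0"
    proof (rule downward[OF u])
      show "l + 1 \<in> {1..L}" "l + 1 \<in> {l + 1..L}" using that by auto
      fix s i assume "s \<in> {l + 1..L}" "i < N"
      thus "((1\<^sub>m ?n - ?M) *\<^sub>v u) $ ((s - 1) * N + i) = 0" unfolding eq by (subst bidx) auto
    qed
    thus ?thesis by (simp add: mapply_def)
  qed
  have 2: "block_fun N u l i - mapply N (entries (A l)) (block_fun N u l) i = 1" if "i < N" for i
    using row[OF kl(2) that] beyond by (auto split: if_splits)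
  have 3: "block_fun N u s i - mapply N (entries (A s)) (block_fun N u s) i
      = mapply N (entries (W s)) (block_fun N u (s + 1)) i" if "s \<in> {1..<l}" "i < N" for s i
    using row[of s i] that kl by (auto split: if_splits)
  show ?thesis using 1 2 3 by (intro exI[of _ "block_fun N u"]) blast
qed

section \<open>Constants\<close>

text \<open>The right-hand side equals \<open>(1 / sqrt b + 1 / sqrt (1 - c))^2 / 2\<close>, which
  decreases in \<open>b\<close>; at \<open>b = 1 + c\<close> it is the constant on the left.\<close>

lemma chebyshev_constant_le:
  assumes c: "0 < c" "c < 1" and b: "0 < b" "b \<le> 1 + c"
  defines "r \<equiv> chebyshev_rate c"
  shows "2 * (1 + r\<^sup>2) / (1 - r\<^sup>2)\<^sup>2 \<le> (1 + sqrt (b / (1 - c)))\<^sup>2 / (2 * b)"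
proof -
  have F: "(1 + sqrt (x / (1 - c)))\<^sup>2 / (2 * x) = (1 / sqrt x + 1 / sqrt (1 - c))\<^sup>2 / 2" if "0 < x" for x
  proof -
    have "1 / sqrt x + 1 / sqrt (1 - c) = (1 + sqrt (x / (1 - c))) / sqrt x"
      using that c by (simp add: real_sqrt_divide field_simps)
    thus ?thesis using that by (simp add: power_divide)
  qed
  define s where "s = sqrt ((1 + c) / (1 - c))"
  have s: "1 < s" using c by (simp add: s_def field_simps)
  have s2: "s\<^sup>2 = (1 + c) / (1 - c)" using c by (simp add: s_def)
  have c1: "1 + c = 2 * s\<^sup>2 / (s\<^sup>2 + 1)" unfolding s2 using c by (simp add: field_simps)
  have r: "r = (s - 1) / (s + 1)" by (simp add: r_def chebyshev_rate_def s_def)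
  have "1 + r\<^sup>2 = 2 * (s\<^sup>2 + 1) / (s + 1)\<^sup>2"
    using s unfolding r power_divide by (simp add: add_divide_eq_iff)
      (simp add: power2_eq_square algebra_simps)
  moreover have "1 - r\<^sup>2 = 4 * s / (s + 1)\<^sup>2"
    using s unfolding r power_divide by (simp add: diff_divide_eq_iff)
      (simp add: power2_eq_square algebra_simps)
  ultimately have "2 * (1 + r\<^sup>2) / (1 - r\<^sup>2)\<^sup>2
      = 2 * (2 * (s\<^sup>2 + 1) / (s + 1)\<^sup>2) / (4 * s / (s + 1)\<^sup>2)\<^sup>2" by simp
  also have "\<dots> = (1 + s)\<^sup>2 * (s\<^sup>2 + 1) / (4 * s\<^sup>2)"
  proof -
    have "2 * (2 * t / w\<^sup>2) / (4 * s / w\<^sup>2)\<^sup>2 = w\<^sup>2 * t / (4 * s\<^sup>2)" if "0 < w" for w t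
      using s that by (simp add: field_simps power2_eq_square)
    from this[of "s + 1" "s\<^sup>2 + 1"] show ?thesis using s by (simp add: add.commute)
  qed
  also have "\<dots> = (1 + s)\<^sup>2 / (2 * (1 + c))"
    unfolding c1 using s by simp
  also have "\<dots> = (1 / sqrt (1 + c) + 1 / sqrt (1 - c))\<^sup>2 / 2"
    unfolding s_def by (rule F) (use c in simp)
  also have "\<dots> \<le> (1 / sqrt b + 1 / sqrt (1 - c))\<^sup>2 / 2"
    using b c by (intro divide_right_mono power_mono add_mono divide_left_mono) auto
  also have "\<dots> = (1 + sqrt (b / (1 - c)))\<^sup>2 / (2 * b)" by (rule F[OF b(1), symmetric])
  finally show ?thesis .
qed

lemma epowr_nonneg: "0 \<le> epowr x s"
  by (simp add: epowr_def)

lemma epowr_add: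
  assumes "0 < x" "s \<noteq> - \<infinity>" "t \<noteq> - \<infinity>"
  shows "epowr x (s + t) = epowr x s * epowr x t"
  using assms by (cases s; cases t) (auto simp: epowr_def powr_add)

lemma epowr_sum:
  assumes "0 < x" "finite T" "\<And>m. m \<in> T \<Longrightarrow> s m \<noteq> - \<infinity>"
  shows "epowr x (\<Sum>m\<in>T. s m) = (\<Prod>m\<in>T. epowr x (s m)) \<and> (\<Sum>m\<in>T. s m) \<noteq> - \<infinity>"
  using assms(2,3)
proof (induction T rule: finite_induct)
  case empty
  show ?case using assms(1) by (simp add: epowr_def)
next
  case (insert m T)
  thus ?case using epowr_add[OF assms(1), of "s m" "\<Sum>m\<in>T. s m"]
    by (cases "s m"; cases "\<Sum>m\<in>T. s m") auto
qed

section \<open>Temporal networks with single-edge changes\<close>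

locale temporal_network =
  fixes V N L k l :: nat and B :: "real mat" and S :: "nat \<Rightarrow> nat set" and i :: "nat \<Rightarrow> nat"
    and ca a b :: real
  assumes incidence: "incidence_mat V N B"
    and ca: "0 < ca" "ca < 1"
    and kl: "1 \<le> k" "k < l" "l \<le> L"
    and change: "\<And>m. m \<in> {k..<l} \<Longrightarrow>
      i m < N \<and> (removal (S m) (S (m + 1)) (i m) \<or> restoration (S m) (S (m + 1)) (i m))"
    and interval: "smallest_spectral_interval a b ((\<lambda>m. 1\<^sub>m N - layer ca B S L m) ` {k..l})"
begin

definition \<alpha> :: real where "\<alpha> = scaling ca B S L"

definition A :: "nat \<Rightarrow> nat \<Rightarrow> nat \<Rightarrow> real" where "A t = entries (layer ca B S L t)"

definition adj :: "nat \<Rightarrow> nat \<Rightarrow> real" where "adj = entries (line_adj B)"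

definition E :: "(nat \<times> nat) set" where
  "E = {(u, v). u < dim_row (line_adj B) \<and> v < dim_row (line_adj B) \<and> line_adj B $$ (u, v) \<noteq> 0}"

definition gmax :: real where "gmax = real (max_degree (line_adj B))"

text \<open>The basis is chosen for the unscaled layer, so its eigenvalues can be compared with the
  spectral radii in the scaling; multiplication by \<alpha> gives those of the layer.\<close>

definition eigen :: "nat \<Rightarrow> (nat \<Rightarrow> real) \<times> (nat \<Rightarrow> nat \<Rightarrow> real)" where
  "eigen t = (SOME p. eigenbasis N (entries (unscaled_layer B S t)) (fst p) (snd p))"

abbreviation "e t \<equiv> \<lambda>j. \<alpha> * fst (eigen t) j"
abbreviation "q t \<equiv> snd (eigen t)"

lemma dims: "dim_col B = N" "dim_row (line_adj B) = N"
  using incidence by (auto simp: incidence_mat_def line_adj_def)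

lemma N_pos: "0 < N"
  using change[of k] kl by auto

lemma adj: "u < N \<Longrightarrow> v < N \<Longrightarrow> adj u v \<in> {0, 1}" "u < N \<Longrightarrow> adj u u = 0"
  "u < N \<Longrightarrow> v < N \<Longrightarrow> adj u v = adj v u"
  using line_adj_props[OF incidence] unfolding adj_def by blast+

lemma adj_nonneg: "u < N \<Longrightarrow> v < N \<Longrightarrow> 0 \<le> adj u v"
  using adj(1)[of u v] by auto

lemma unscaled_index:
  "u < N \<Longrightarrow> v < N \<Longrightarrow> unscaled_layer B S t $$ (u, v) = (if u \<in> S t \<and> v \<in> S t then adj u v else 0)"
  using unscaled_layer_index[of u B v S t] by (simp add: dims adj_def)

lemma unscaled_carrier: "unscaled_layer B S t \<in> carrier_mat N N"
  using unscaled_layer_carrier[of B S t] by (simp add: dims)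

lemma layer_carrier: "layer ca B S L t \<in> carrier_mat N N"
  using unscaled_carrier[of t] by (simp add: layer_def)

lemma A_index:
  "u < N \<Longrightarrow> v < N \<Longrightarrow> A t u v = (if u \<in> S t \<and> v \<in> S t then \<alpha> * adj u v else 0)"
  using unscaled_carrier[of t] by (simp add: A_def layer_def \<alpha>_def unscaled_index)

lemma A_sym: "u < N \<Longrightarrow> v < N \<Longrightarrow> A t u v = A t v u"
  by (auto simp: A_index adj(3))

lemma unscaled_basis: "eigenbasis N (entries (unscaled_layer B S t)) (fst (eigen t)) (q t)"
proof -
  have "\<exists>e q. eigenbasis N (entries (unscaled_layer B S t)) e q"
    by (rule exists_eigenbasis) (auto simp: unscaled_index adj(3))
  hence "\<exists>p. eigenbasis N (entries (unscaled_layer B S t)) (fst p) (snd p)" by auto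
  thus ?thesis unfolding eigen_def by (rule someI_ex)
qed

lemma basis: "eigenbasis N (A t) (e t) (q t)"
  by (rule eigenbasis_cong[OF _ eigenbasis_scale[OF unscaled_basis]])
    (auto simp: A_index unscaled_index)

lemma system: "symmetric_system N (A t) (e t) (q t)"
  by unfold_locales (use A_sym basis in auto)

definition max_radius :: real where
  "max_radius = Max ((\<lambda>t. spectral_radius (map_mat complex_of_real (unscaled_layer B S t))) ` {1..L})"

lemma abs_unscaled_le:
  assumes "t \<in> {1..L}" "j < N"
  shows "\<bar>fst (eigen t) j\<bar> \<le> max_radius"
proof -
  let ?U = "map_mat complex_of_real (unscaled_layer B S t)"
  have "spectrum ?U = complex_of_real ` fst (eigen t) ` {..<N}"
    by (rule spectrum_complexified[OF unscaled_carrier _ unscaled_basis])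
      (auto simp: unscaled_index adj(3))
  hence "norm (complex_of_real (fst (eigen t) j)) \<in> norm ` spectrum ?U" using assms by blast
  hence "\<bar>fst (eigen t) j\<bar> \<le> spectral_radius ?U"
    using spectral_radius_mem_max(2)[of ?U N] unscaled_carrier[of t] N_pos by simp
  also have "\<dots> \<le> max_radius"
    unfolding max_radius_def using assms by (intro Max_ge) auto
  finally show ?thesis .
qed

lemma max_radius_nonneg: "0 \<le> max_radius"
  using abs_unscaled_le[of l 0] kl N_pos by force

lemma \<alpha>_eq: "\<alpha> = ca / max_radius"
  by (simp add: \<alpha>_def scaling_def max_radius_def)

lemma \<alpha>_nonneg: "0 \<le> \<alpha>"
  using max_radius_nonneg ca by (simp add: \<alpha>_eq)

lemma abs_e_le_ca: "t \<in> {1..L} \<Longrightarrow> j < N \<Longrightarrow> \<bar>e t j\<bar> \<le> ca"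
proof (cases "max_radius = 0")
  case False
  assume "t \<in> {1..L}" "j < N"
  hence "\<alpha> * \<bar>fst (eigen t) j\<bar> \<le> \<alpha> * max_radius"
    by (intro mult_left_mono abs_unscaled_le \<alpha>_nonneg)
  moreover have "\<bar>e t j\<bar> = \<alpha> * \<bar>fst (eigen t) j\<bar>" using \<alpha>_nonneg by (simp add: abs_mult)
  ultimately show ?thesis using False by (simp add: \<alpha>_eq)
\<comment> \<open>If all spectral radii vanish, division by zero makes \<alpha> equal to 0, and so
  are all scaled eigenvalues.\<close>
qed (use ca in \<open>simp add: \<alpha>_eq\<close>)

lemma A_nonneg: "u < N \<Longrightarrow> v < N \<Longrightarrow> 0 \<le> A t u v"
  using adj_nonneg \<alpha>_nonneg by (simp add: A_index)

lemma adj_row_sum: "u < N \<Longrightarrow> (\<Sum>v<N. adj u v) \<le> gmax"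
  using row_sum_le_max_degree[OF incidence] by (simp add: adj_def gmax_def)

lemma abs_e_le_degree:
  assumes "j < N"
  shows "\<bar>e t j\<bar> \<le> \<alpha> * gmax"
proof (rule eigenvalue_le_row_sum[OF basis assms])
  fix u assume u: "u < N"
  have "(\<Sum>v<N. \<bar>A t u v\<bar>) \<le> (\<Sum>v<N. \<alpha> * adj u v)"
    using u adj_nonneg \<alpha>_nonneg by (intro sum_mono) (simp add: A_index)
  also have "\<dots> \<le> \<alpha> * gmax"
    unfolding sum_distrib_left[symmetric] using adj_row_sum[OF u] \<alpha>_nonneg by (intro mult_left_mono)
  finally show "(\<Sum>v<N. \<bar>A t u v\<bar>) \<le> \<alpha> * gmax" .
qed

section \<open>The spectral interval of the layers from \<open>k\<close> to \<open>l\<close>\<close>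

definition c :: real where "c = 1 - a"

lemma spectral_interval:
  shows "\<And>m j. m \<in> {k..l} \<Longrightarrow> j < N \<Longrightarrow> a \<le> 1 - e m j \<and> 1 - e m j \<le> b"
    and "\<And>a' b'. (\<And>m j. m \<in> {k..l} \<Longrightarrow> j < N \<Longrightarrow> a' \<le> 1 - e m j \<and> 1 - e m j \<le> b') \<Longrightarrow> a' \<le> a \<and> b \<le> b'"
proof -
  have sym: "layer ca B S L m $$ (u, v) = layer ca B S L m $$ (v, u)" if "u < N" "v < N" for m u v
    using A_sym[OF that, of m] by (simp add: A_def)
  have basis': "eigenbasis N (entries (layer ca B S L m)) (e m) (q m)" for m
    using basis[of m] by (simp add: A_def)
  note D = smallest_spectral_interval_bounds[where e = e and q = q, OF interval layer_carrier sym basis']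
  have ne: "{k..l} \<noteq> {}" using kl by simp
  show "\<And>m j. m \<in> {k..l} \<Longrightarrow> j < N \<Longrightarrow> a \<le> 1 - e m j \<and> 1 - e m j \<le> b"
    using D(1) ne N_pos by blast
  show "\<And>a' b'. (\<And>m j. m \<in> {k..l} \<Longrightarrow> j < N \<Longrightarrow> a' \<le> 1 - e m j \<and> 1 - e m j \<le> b') \<Longrightarrow> a' \<le> a \<and> b \<le> b'"
    using D(2) ne N_pos by blast
qed

text \<open>The end point \<open>a\<close> bounds the eigenvalues of the layers from above only by
  \<open>1 - a\<close>; the lower bound comes from nonnegativity, through
  \<open>eigenvalue_lower_bound\<close>.\<close>

lemma abs_e_le_c:
  assumes "m \<in> {k..l}" "j < N"
  shows "\<bar>e m j\<bar> \<le> c"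
proof -
  interpret symmetric_system N "A m" "e m" "q m" by (rule system)
  have le: "e m j \<le> c" if "j < N" for j using spectral_interval(1)[OF assms(1) that] by (simp add: c_def)
  from eigenvalue_lower_bound[OF A_nonneg le assms(2)] le[OF assms(2)] show ?thesis by simp
qed

lemma c_nonneg: "0 \<le> c"
  using abs_e_le_c[of k 0] kl N_pos by force

lemma c_le_ca: "c \<le> ca"
proof -
  have "1 - ca \<le> a \<and> b \<le> 1 + ca"
  proof (rule spectral_interval(2))
    fix m j assume "m \<in> {k..l}" "j < N"
    thus "1 - ca \<le> 1 - e m j \<and> 1 - e m j \<le> 1 + ca" using abs_e_le_ca[of m j] kl by auto
  qed
  thus ?thesis by (simp add: c_def)
qed

text \<open>Minimality of the interval, tested with the row sum bound. This is the source of the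
  factor \<open>G\<close>: the trivial estimate \<open>1 + c\<close> becomes
  \<open>1 + \<alpha> * gmax\<close>.\<close>

lemma c_le_degree: "c \<le> \<alpha> * gmax"
proof -
  have "1 - \<alpha> * gmax \<le> a \<and> b \<le> 1 + \<alpha> * gmax"
  proof (rule spectral_interval(2))
    fix m j assume "m \<in> {k..l}" "j < N"
    thus "1 - \<alpha> * gmax \<le> 1 - e m j \<and> 1 - e m j \<le> 1 + \<alpha> * gmax" using abs_e_le_degree[of j m] by auto
  qed
  thus ?thesis by (simp add: c_def)
qed

lemma b_bounds: "0 < b" "b \<le> 1 + c"
proof -
  have "1 - c \<le> a \<and> b \<le> 1 + c"
  proof (rule spectral_interval(2))
    fix m j assume "m \<in> {k..l}" "j < N"
    thus "1 - c \<le> 1 - e m j \<and> 1 - e m j \<le> 1 + c" using abs_e_le_c[of m j] by auto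
  qed
  thus "b \<le> 1 + c" by simp
  have "a \<le> b" using spectral_interval(1)[of k 0] kl N_pos by auto
  thus "0 < b" using c_le_ca ca by (simp add: c_def)
qed

definition C :: real where "C = (1 + sqrt (b / a))\<^sup>2 / (2 * b)"
definition lam :: real where "lam = chebyshev_rate ca"
definition G :: real where "G = 1 + \<alpha> * gmax"
definition r :: real where "r = chebyshev_rate c"

lemma katz_layer:
  assumes "0 < c" "t \<in> {k..l}"
  shows "katz_layer N (A t) (e t) (q t) c r E lam C G"
proof -
  have c: "0 < c" "c < 1" using assms c_le_ca ca by auto
  have cheb: "chebyshev_interval c r" unfolding r_def by (rule chebyshev_interval_rate[OF c])
  have "2 * (1 + r\<^sup>2) / (1 - r\<^sup>2)\<^sup>2 \<le> C"
    using chebyshev_constant_le[OF c b_bounds] by (simp add: C_def r_def c_def)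
  moreover have "r \<le> lam" "lam < 1"
    using chebyshev_rate_mono[of c ca] chebyshev_rate_bounds[of ca] c c_le_ca ca
    by (auto simp: r_def lam_def)
  moreover have "1 + c \<le> G" using c_le_degree by (simp add: G_def)
  moreover have "(u, v) \<in> E" if "u < N" "v < N" "A t u v \<noteq> 0" for u v
    using that by (auto simp: E_def dims A_index adj_def split: if_splits)
  moreover have "(v, u) \<in> E" if "(u, v) \<in> E" for u v
    using that adj(3)[of u v] by (auto simp: E_def dims adj_def)
  ultimately show ?thesis
    using cheb system[of t] abs_e_le_c[OF assms(2)] A_nonneg adj(2)
    by (intro katz_layer.intro contraction.intro contraction_axioms.intro katz_layer_axioms.intro)
      (auto simp: A_index)
qed

text \<open>The column of the edge changed at step \<open>m\<close>, in the layer that contains this edge.\<close>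
definition col_of :: "nat \<Rightarrow> nat \<Rightarrow> real" where
  "col_of m v = (if v \<in> S m \<union> S (m + 1) then \<alpha> * adj v (i m) else 0)"

lemma change_cases:
  assumes "m \<in> {k..<l}"
  obtains t t' where "{t, t'} = {m, m + 1}" "i m \<notin> S t" "i m \<in> S t'" "S t' = insert (i m) (S t)"
    "S m \<union> S (m + 1) = S t'"
proof -
  from change[OF assms] consider "removal (S m) (S (m + 1)) (i m)" | "restoration (S m) (S (m + 1)) (i m)"
    by blast
  thus ?thesis
  proof cases
    case 1
    thus ?thesis by (intro that[of "m + 1" m]) (auto simp: removal_def)
  next
    case 2
    thus ?thesis by (intro that[of m "m + 1"]) (auto simp: restoration_def)
  qed
qed

lemma change_iff: "m \<in> {k..<l} \<Longrightarrow> i m \<in> S (m + 1) \<longleftrightarrow> i m \<notin> S m"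
  using change[of m] by (auto simp: removal_def restoration_def)

lemma i_less: "m \<in> {k..<l} \<Longrightarrow> i m < N"
  using change[of m] by blast

lemma col_of_present:
  assumes "m \<in> {k..<l}" "t \<in> {m, m + 1}" "i m \<in> S t" "v < N"
  shows "col_of m v = A t v (i m)"
proof -
  have "S m \<union> S (m + 1) = S t"
    using change[OF assms(1)] assms(2,3) by (auto simp: removal_def restoration_def)
  thus ?thesis using assms i_less[OF assms(1)] by (simp add: col_of_def A_index)
qed

lemma col_of_nonneg: "m \<in> {k..<l} \<Longrightarrow> v < N \<Longrightarrow> 0 \<le> col_of m v"
  using adj_nonneg[of v "i m"] \<alpha>_nonneg i_less[of m] by (simp add: col_of_def)

lemma col_of_self: "m \<in> {k..<l} \<Longrightarrow> col_of m (i m) = 0"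
  using adj(2)[of "i m"] i_less[of m] by (simp add: col_of_def)

lemma col_of_eq_0:
  assumes "m \<in> {k..<l}" "t \<in> {m, m + 1}" "i m \<notin> S t" "v \<notin> S t"
  shows "col_of m v = 0"
proof (cases "v = i m")
  case False
  have "S m \<union> S (m + 1) \<subseteq> insert (i m) (S t)"
    using change[OF assms(1)] assms(2,3) by (auto simp: removal_def restoration_def)
  thus ?thesis using assms(4) False by (auto simp: col_of_def)
qed (use col_of_self[OF assms(1)] in simp)

text \<open>\<open>t\<close> is the layer without the changed edge and \<open>t'\<close> the one
  with it. Leaving their order open treats removal and restoration at once.\<close>

lemma bordered_entry:
  assumes m: "m \<in> {k..<l}" and t: "{t, t'} = {m, m + 1}" "i m \<notin> S t" and uv: "u < N" "v < N"
  shows "A t' u v = A t u v + (if u = i m then col_of m v else 0) + (if v = i m then col_of m u else 0)"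
proof -
  have t': "S t' = insert (i m) (S t)" "S m \<union> S (m + 1) = S t'"
    using change[OF m] t by (auto simp: doubleton_eq_iff removal_def restoration_def)
  have im: "i m < N" by (rule i_less[OF m])
  show ?thesis
    using t t' uv im adj(2)[of u] adj(3)[of u v] by (auto simp: A_index col_of_def)
qed

lemma bordered_mapply:
  assumes m: "m \<in> {k..<l}" and t: "{t, t'} = {m, m + 1}" "i m \<notin> S t" and u: "u < N"
  shows "mapply N (A t') x u = mapply N (A t) x u
    + (unit_fun (i m) u * dot N (col_of m) x + col_of m u * x (i m))"
proof -
  have "mapply N (A t') x u = (\<Sum>v<N. A t u v * x v + unit_fun (i m) u * (col_of m v * x v)
      + (if v = i m then col_of m u * x v else 0))"
    unfolding mapply_def using u
    by (intro sum.cong refl) (simp add: bordered_entry[OF m t] unit_fun_def algebra_simps)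
  thus ?thesis using i_less[OF m]
    by (simp add: sum.distrib mapply_def dot_def sum_distrib_left algebra_simps)
qed

lemma bordered_quadratic_form:
  assumes m: "m \<in> {k..<l}" and t: "{t, t'} = {m, m + 1}" "i m \<notin> S t"
  shows "dot N x (mapply N (A t') x) = dot N x (mapply N (A t) x) + 2 * x (i m) * dot N (col_of m) x"
proof -
  let ?d = "dot N (col_of m) x"
  have "dot N x (mapply N (A t') x)
      = dot N x (\<lambda>u. mapply N (A t) x u + (?d * unit_fun (i m) u + x (i m) * col_of m u))"
    by (rule dot_cong) (simp_all add: bordered_mapply[OF m t] mult.commute)
  also have "\<dots> = dot N x (mapply N (A t) x) + (?d * x (i m) + x (i m) * dot N x (col_of m))"
    using i_less[OF m] by (simp only: dot_add_right dot_scale_right dot_unit_fun)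
  finally show ?thesis by (simp add: dot_commute[of N x "col_of m"])
qed

lemma present:
  assumes "0 < c" "m \<in> {k..<l}" "t \<in> {m, m + 1}" "i m \<in> S t"
  shows "katz_layer.present N (A t) (i m) (col_of m)"
proof -
  have "t \<in> {k..l}" using assms by auto
  then interpret katz_layer N "A t" "e t" "q t" c r E lam C G by (rule katz_layer[OF assms(1)])
  show ?thesis unfolding present_def using col_of_present[OF assms(2-4)] by blast
qed

lemma absent:
  assumes "0 < c" "m \<in> {k..<l}" "t \<in> {m, m + 1}" "i m \<notin> S t"
  shows "katz_layer.absent N (A t) c E (i m) (col_of m)"
proof -
  have tr: "t \<in> {k..l}" using assms by auto
  interpret katz_layer N "A t" "e t" "q t" c r E lam C G by (rule katz_layer[OF assms(1) tr])
  \<comment> \<open>The layer on the other side of the change. It also lies between \<open>k\<close>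
    and \<open>l\<close>, so its spectral bound supplies the border condition.\<close>
  define t' where "t' = (if t = m then m + 1 else m)"
  have t': "{t, t'} = {m, m + 1}" using assms(3) by (auto simp: t'_def)
  have tr': "t' \<in> {k..l}" using assms by (auto simp: t'_def)
  interpret t': symmetric_system N "A t'" "e t'" "q t'" by (rule system)
  have im: "i m < N" by (rule i_less[OF assms(2)])
  have "\<bar>dot N x (mapply N (A t) x) + 2 * x (i m) * dot N (col_of m) x\<bar> \<le> c * dot N x x" for x
    using t'.quadratic_form_le[OF abs_e_le_c[OF tr'], of x]
    by (simp add: bordered_quadratic_form[OF assms(2) t' assms(4)])
  moreover have "(i m, v) \<in> E" if "v < N" "col_of m v \<noteq> 0" for v
    using that im adj(3)[of v "i m"] by (auto simp: col_of_def E_def dims adj_def split: if_splits)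
  ultimately show ?thesis
    unfolding absent_def using im assms(4) col_of_self[OF assms(2)] col_of_nonneg[OF assms(2)]
    by (auto simp: A_index)
qed

text \<open>The column is the image of a unit vector under a symmetric matrix whose eigenvalues have
  modulus at most \<open>c < 1\<close>.\<close>

lemma dot_col_of_le_1:
  assumes "m \<in> {k..<l}"
  shows "dot N (col_of m) (col_of m) \<le> 1"
proof -
  from change_cases[OF assms] obtain t where t: "t \<in> {m, m + 1}" "i m \<in> S t" by blast
  hence tr: "t \<in> {k..l}" using assms by auto
  interpret symmetric_system N "A t" "e t" "q t" by (rule system)
  have im: "i m < N" by (rule i_less[OF assms])
  have "dot N (col_of m) (col_of m) = dot N (mapply N (A t) (unit_fun (i m))) (mapply N (A t) (unit_fun (i m)))"
    using col_of_present[OF assms t] im by (intro dot_cong) (simp_all add: mapply_unit_fun)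
  also have "\<dots> = (\<Sum>j<N. (e t j)\<^sup>2 * (coord j (unit_fun (i m)))\<^sup>2)"
    unfolding dot_self_coords by (intro sum.cong refl) (simp add: coord_mapply power_mult_distrib)
  also have "\<dots> \<le> (\<Sum>j<N. 1 * (coord j (unit_fun (i m)))\<^sup>2)"
  proof (intro sum_mono mult_right_mono)
    fix j assume "j \<in> {..<N}"
    hence "\<bar>e t j\<bar> \<le> 1" using abs_e_le_c[OF tr, of j] c_le_ca ca by simp
    thus "(e t j)\<^sup>2 \<le> 1" by (simp only: abs_square_le_1)
  qed simp
  also have "\<dots> = dot N (unit_fun (i m)) (unit_fun (i m))" by (simp add: dot_self_coords)
  also have "\<dots> = 1" using im by (simp add: dot_unit_fun) (simp add: unit_fun_def)
  finally show ?thesis .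
qed

lemma coupling_mapply:
  assumes "m \<in> {k..<l}"
  shows "\<exists>\<sigma>. (\<sigma> = 1 \<or> \<sigma> = - 1) \<and> (\<forall>u<N. mapply N (entries (coupling (layer ca B S L) m)) x u
    = \<sigma> * (dot N (col_of m) x * unit_fun (i m) u + x (i m) * col_of m u))"
proof -
  have W: "mapply N (entries (coupling (layer ca B S L) m)) x u = mapply N (A (m + 1)) x u - mapply N (A m) x u"
    if "u < N" for u
  proof -
    have "coupling (layer ca B S L) m $$ (u, v) = A (m + 1) u v - A m u v" if "v < N" for v
      using layer_carrier[of m] layer_carrier[of "m + 1"] \<open>u < N\<close> that by (simp add: coupling_def A_def)
    thus ?thesis by (simp add: mapply_def left_diff_distrib sum_subtractf)
  qed
  show ?thesis
  proof (cases "i m \<in> S m")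
    case True
    hence "i m \<notin> S (m + 1)" using change_iff[OF assms] by simp
    with True show ?thesis
      using bordered_mapply[OF assms, of "m + 1" m]
      by (intro exI[of _ "- 1"]) (simp add: W insert_commute)
  next
    case False
    thus ?thesis
      using bordered_mapply[OF assms, of m "m + 1"] by (intro exI[of _ 1]) (simp add: W)
  qed
qed

lemma layer_inj:
  assumes "s \<in> {1..L}" "\<And>u. u < N \<Longrightarrow> z u - mapply N (A s) z u = 0" "u < N"
  shows "z u = 0"
proof -
  interpret symmetric_system N "A s" "e s" "q s" by (rule system)
  have ne: "e s j \<noteq> 1" if "j < N" for j using abs_e_le_ca[OF assms(1) that] ca by auto
  have "dot N (unit_fun u) z = res (unit_fun u) (\<lambda>u. 0)"
    by (rule dot_solution[OF ne assms(2)])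
  thus ?thesis using assms(3) by (simp add: dot_unit_fun) (simp add: res_def coord_def dot_def)
qed

lemma far_of_graph_dist:
  assumes "enat n \<le> graph_dist (line_adj B) u v"
  shows "\<forall>m<n. (u, v) \<notin> E ^^ m"
proof (intro allI impI notI)
  fix m assume "m < n" "(u, v) \<in> E ^^ m"
  hence "graph_dist (line_adj B) u v \<le> enat m"
    unfolding graph_dist_def E_def[symmetric] by (intro INF_lower) simp
  with assms have "enat n \<le> enat m" by (rule order_trans)
  thus False using \<open>m < n\<close> by simp
qed

section \<open>The recursion for the pairs seen by the couplings\<close>

definition weight :: "nat \<Rightarrow> nat \<Rightarrow> real" where
  "weight m t = (if i m \<in> S t then sqrt (2 * C) else sqrt G)"

definition decay :: "nat \<Rightarrow> real" where
  "decay m = epowr lam (ereal_of_enat (graph_dist (line_adj B) (i m) (i (m + 1))) - 1)"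

context
  fixes z :: "nat \<Rightarrow> nat \<Rightarrow> real"
  assumes z_last: "\<And>u. u < N \<Longrightarrow> z l u - mapply N (A l) (z l) u = 1"
    and z_step: "\<And>s u. s \<in> {k..<l} \<Longrightarrow> u < N \<Longrightarrow> z s u - mapply N (A s) (z s) u
      = mapply N (entries (coupling (layer ca B S L) s)) (z (s + 1)) u"
begin

definition height :: "nat \<Rightarrow> real" where
  "height m = sqrt ((dot N (col_of m) (z (m + 1)))\<^sup>2 + (z (m + 1) (i m))\<^sup>2)"

lemma height_nonneg: "0 \<le> height m"
  by (simp add: height_def)

text \<open>Layer \<open>m + 1\<close> lies between the changes \<open>m\<close> and
  \<open>m + 1\<close>. The cases record which of the two edges it contains, so both weights are
  taken at \<open>m + 1\<close>.\<close>

lemma height_step_far: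
  assumes c: "0 < c" and m: "k \<le> m" "m + 1 < l"
    and n: "\<forall>j<n. (i m, i (m + 1)) \<notin> E ^^ j"
  shows "height m \<le> weight m (m + 1) * weight (m + 1) (m + 1) * (lam ^ n / lam) * height (m + 1)"
proof -
  have m1: "m \<in> {k..<l}" and m2: "m + 1 \<in> {k..<l}" and tr: "m + 1 \<in> {k..l}" using m by auto
  interpret katz_layer N "A (m + 1)" "e (m + 1)" "q (m + 1)" c r E lam C G by (rule katz_layer[OF c tr])
  have ij: "i m < N" "i (m + 1) < N" using i_less m1 m2 by auto
  have far: "far n (i m) (i (m + 1))" using n by (simp add: far_def)
  obtain \<sigma> where \<sigma>: "\<sigma> = 1 \<or> \<sigma> = - 1"
    and W: "\<And>u. u < N \<Longrightarrow> mapply N (entries (coupling (layer ca B S L) (m + 1))) (z (m + 2)) u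
      = \<sigma> * (dot N (col_of (m + 1)) (z (m + 2)) * unit_fun (i (m + 1)) u + z (m + 2) (i (m + 1)) * col_of (m + 1) u)"
    using coupling_mapply[OF m2] by blast
  have sol: "z (m + 1) u - mapply N (A (m + 1)) (z (m + 1)) u
      = \<sigma> * (dot N (col_of (m + 1)) (z (m + 2)) * unit_fun (i (m + 1)) u + z (m + 2) (i (m + 1)) * col_of (m + 1) u)"
    if "u < N" for u
    using z_step[OF m2 that] W[OF that] by (simp add: add.assoc)
  have h: "height m = sqrt ((dot N (col_of m) (z (m + 1)))\<^sup>2 + (z (m + 1) (i m))\<^sup>2)"
    "height (m + 1) = sqrt ((dot N (col_of (m + 1)) (z (m + 2)))\<^sup>2 + (z (m + 2) (i (m + 1)))\<^sup>2)"
    by (simp_all add: height_def add.assoc)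
  show ?thesis
  proof (cases "i m \<in> S (m + 1)"; cases "i (m + 1) \<in> S (m + 1)")
    assume 1: "i m \<in> S (m + 1)" "i (m + 1) \<in> S (m + 1)"
    show ?thesis
      unfolding h using step_present_present[OF far ij \<sigma> sol present[OF c m1 _ 1(1)] present[OF c m2 _ 1(2)]] 1
      by (simp add: weight_def)
  next
    assume 1: "i m \<in> S (m + 1)" "i (m + 1) \<notin> S (m + 1)"
    hence "i m \<noteq> i (m + 1)" by auto
    thus ?thesis
      unfolding h using step_present_absent[OF far ij \<sigma> sol present[OF c m1 _ 1(1)] absent[OF c m2 _ 1(2)]] 1
      by (simp add: weight_def)
  next
    assume 1: "i m \<notin> S (m + 1)" "i (m + 1) \<in> S (m + 1)"
    hence "i m \<noteq> i (m + 1)" by auto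
    thus ?thesis
      unfolding h using step_absent_present[OF far ij \<sigma> sol absent[OF c m1 _ 1(1)] present[OF c m2 _ 1(2)]] 1
      by (simp add: weight_def)
  next
    assume 1: "i m \<notin> S (m + 1)" "i (m + 1) \<notin> S (m + 1)"
    have "col_of m (i (m + 1)) = 0" by (rule col_of_eq_0[OF m1 _ 1]) simp
    moreover have "col_of (m + 1) (i m) = 0" by (rule col_of_eq_0[OF m2 _ 1(2,1)]) simp
    ultimately show ?thesis
      unfolding h using step_absent_absent[OF far ij \<sigma> sol absent[OF c m1 _ 1(1)] absent[OF c m2 _ 1(2)]] 1
      by (simp add: weight_def)
  qed
qed

lemma height_step:
  assumes c: "0 < c" and m: "k \<le> m" "m + 1 < l"
  shows "height m \<le> weight m (m + 1) * weight (m + 1) (m + 1) * decay m * height (m + 1)"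
proof (cases "graph_dist (line_adj B) (i m) (i (m + 1))")
  case (enat n)
  have "lam > 0" using chebyshev_rate_bounds ca by (simp add: lam_def)
  moreover have "ereal_of_enat (enat n) - 1 = ereal (real n - 1)" by (simp add: one_ereal_def)
  ultimately have "decay m = lam ^ n / lam"
    unfolding decay_def enat by (simp add: epowr_def powr_diff powr_realpow)
  thus ?thesis
    using height_step_far[OF c m far_of_graph_dist[of n]] unfolding enat by simp
next
  case infinity
  have lam: "0 < lam" "lam < 1" using chebyshev_rate_bounds ca by (auto simp: lam_def)
  \<comment> \<open>At infinite distance the finite estimate holds for every \<open>n\<close>; its
    limit gives 0, which is the value of \<open>decay m\<close>.\<close>
  have "(\<lambda>n. weight m (m + 1) * weight (m + 1) (m + 1) * (lam ^ n / lam) * height (m + 1))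
      \<longlonglongrightarrow> weight m (m + 1) * weight (m + 1) (m + 1) * (0 / lam) * height (m + 1)"
    using lam by (intro tendsto_intros LIMSEQ_realpow_zero) auto
  moreover have "height m \<le> weight m (m + 1) * weight (m + 1) (m + 1) * (lam ^ n / lam) * height (m + 1)" for n
    using height_step_far[OF c m far_of_graph_dist[of n]] unfolding infinity by simp
  ultimately have "height m \<le> weight m (m + 1) * weight (m + 1) (m + 1) * (0 / lam) * height (m + 1)"
    by (intro LIMSEQ_le_const) auto
  moreover have "decay m = 0" unfolding decay_def infinity by (simp add: epowr_def)
  ultimately show ?thesis by simp
qed

lemma z_last_ge_1:
  assumes "u < N"
  shows "1 \<le> z l u"
proof -
  interpret symmetric_system N "A l" "e l" "q l" by (rule system)
  have less: "e l j < 1" if "j < N" for j using abs_e_le_c[of l j] that c_le_ca ca kl by auto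
  have "0 \<le> z l v" if "v < N" for v
    by (rule solution_nonneg[OF A_nonneg less z_last _ that]) auto
  hence "0 \<le> mapply N (A l) (z l) u"
    unfolding mapply_def using A_nonneg assms by (intro sum_nonneg) simp
  thus ?thesis using z_last[OF assms] by simp
qed

text \<open>The source in layer \<open>l\<close> is the all-ones vector. If the edge is present, its
  column tests \<open>z l\<close> to \<open>z l i - 1\<close>, and the pair has length at most
  \<open>sqrt 2 * cmax\<close>. If it is absent, the degree bound gives at most
  \<open>G * cmax\<close>, so one more \<open>sqrt G\<close> appears.\<close>

lemma height_last:
  assumes "0 < c" and cmax: "\<And>u. u < N \<Longrightarrow> z l u \<le> cmax"
  shows "height (l - 1) \<le> weight (l - 1) l * sqrt G * cmax"
proof -
  have m: "l - 1 \<in> {k..<l}" and l: "l - 1 + 1 = l" "l \<in> {k..l}" using kl by auto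
  interpret katz_layer N "A l" "e l" "q l" c r E lam C G by (rule katz_layer[OF assms(1) l(2)])
  let ?i = "i (l - 1)" and ?p = "dot N (col_of (l - 1)) (z l)"
  have im: "?i < N" by (rule i_less[OF m])
  have cm: "1 \<le> cmax" "z l ?i \<le> cmax" "1 \<le> z l ?i"
    using cmax[OF im] z_last_ge_1[OF im] by auto
  have p0: "0 \<le> ?p"
    unfolding dot_def using col_of_nonneg[OF m] z_last_ge_1
    by (intro sum_nonneg mult_nonneg_nonneg) (auto intro: order_trans[of 0 1])
  have r2: "(z l ?i)\<^sup>2 \<le> cmax\<^sup>2" using cm by (intro power_mono) auto
  have G1: "1 \<le> G" using G c_pos by simp
  have h: "height (l - 1) = sqrt (?p\<^sup>2 + (z l ?i)\<^sup>2)" using l by (simp add: height_def)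
  show ?thesis
  proof (cases "?i \<in> S l")
    case True
    have "?p = mapply N (A l) (z l) ?i"
      unfolding dot_def mapply_def
      using col_of_present[OF m, of l] True l im A_sym[OF im] by (intro sum.cong refl) auto
    hence "?p \<le> cmax" using z_last[OF im] cm by simp
    hence "?p\<^sup>2 \<le> cmax\<^sup>2" using p0 by (intro power_mono)
    hence "height (l - 1) \<le> sqrt (2 * cmax\<^sup>2)" unfolding h using r2 by simp
    also have "\<dots> = sqrt (2 * 1) * sqrt 1 * cmax" using cm by (simp add: real_sqrt_mult)
    also have "\<dots> \<le> sqrt (2 * C) * sqrt G * cmax"
      using C_ge_1 G1 cm by (intro mult_mono) auto
    finally show ?thesis using True by (simp add: weight_def)
  next
    case False
    have "?p \<le> (\<Sum>v<N. (\<alpha> * adj ?i v) * cmax)"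
      unfolding dot_def
    proof (intro sum_mono mult_mono)
      fix v assume "v \<in> {..<N}"
      hence v: "v < N" by simp
      show "col_of (l - 1) v \<le> \<alpha> * adj ?i v"
        using adj(3)[OF v im] adj_nonneg[OF im v] \<alpha>_nonneg by (simp add: col_of_def)
      show "z l v \<le> cmax" "0 \<le> z l v" "0 \<le> \<alpha> * adj ?i v"
        using cmax[OF v] z_last_ge_1[OF v] adj_nonneg[OF im v] \<alpha>_nonneg by auto
    qed
    also have "\<dots> = \<alpha> * (\<Sum>v<N. adj ?i v) * cmax"
      by (simp add: sum_distrib_left sum_distrib_right mult_ac)
    also have "\<dots> \<le> \<alpha> * gmax * cmax"
      using adj_row_sum[OF im] \<alpha>_nonneg cm by (intro mult_right_mono mult_left_mono) auto
    finally have p: "?p \<le> \<alpha> * gmax * cmax" .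
    have "?p\<^sup>2 + (z l ?i)\<^sup>2 \<le> (?p + z l ?i)\<^sup>2" using p0 cm by (simp add: power2_sum)
    also have "\<dots> \<le> (G * cmax)\<^sup>2"
      using p p0 cm by (intro power_mono) (auto simp: G_def algebra_simps)
    finally have "height (l - 1) \<le> sqrt ((G * cmax)\<^sup>2)"
      unfolding h by (rule real_sqrt_le_mono)
    also have "\<dots> = sqrt G * sqrt G * cmax" using G1 cm by simp
    finally show ?thesis using False by (simp add: weight_def)
  qed
qed

text \<open>The source \<open>W z\<close> is a combination of the orthogonal vectors
  \<open>e_i\<close> and \<open>a\<close> of length at most 1, so its norm is at most
  \<open>height k\<close>. Applying the resolvent costs at most \<open>1 / (1 - ca)\<close>.\<close>

lemma norm_first_le: "sqrt (dot N (z k) (z k)) \<le> 1 / (1 - ca) * height k"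
proof -
  have k: "k \<in> {k..<l}" "k \<in> {k..l}" using kl by auto
  interpret symmetric_system N "A k" "e k" "q k" by (rule system)
  obtain \<sigma> where \<sigma>: "\<sigma> = 1 \<or> \<sigma> = - 1"
    and W: "\<And>u. u < N \<Longrightarrow> mapply N (entries (coupling (layer ca B S L) k)) (z (k + 1)) u
      = \<sigma> * (dot N (col_of k) (z (k + 1)) * unit_fun (i k) u + z (k + 1) (i k) * col_of k u)"
    using coupling_mapply[OF k(1)] by blast
  define p where "p = dot N (col_of k) (z (k + 1))"
  define s where "s = z (k + 1) (i k)"
  define w where "w = (\<lambda>u. \<sigma> * (p * unit_fun (i k) u + s * col_of k u))"
  have im: "i k < N" by (rule i_less[OF k(1)])
  have sol: "z k u - mapply N (A k) (z k) u = w u" if "u < N" for u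
    using z_step[OF k(1) that] W[OF that] by (simp add: w_def p_def s_def)
  have "dot N w w = \<sigma> * \<sigma> * (p\<^sup>2 + s\<^sup>2 * dot N (col_of k) (col_of k))"
    unfolding w_def using im col_of_self[OF k(1)]
    by (simp add: dot_linear dot_unit_fun power2_eq_square algebra_simps) (simp add: unit_fun_def)
  also have "\<dots> \<le> p\<^sup>2 + s\<^sup>2"
    using \<sigma> dot_col_of_le_1[OF k(1)] mult_left_mono[of _ 1 "s\<^sup>2"] by auto
  finally have w: "dot N w w \<le> (height k)\<^sup>2" by (simp add: height_def p_def s_def)
  have "(1 - ca)\<^sup>2 * dot N (z k) (z k) \<le> dot N w w"
    unfolding dot_self_coords sum_distrib_left
  proof (intro sum_mono)
    fix j assume "j \<in> {..<N}"
    hence j: "j < N" by simp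
    have "coord j w = coord j (\<lambda>u. z k u - mapply N (A k) (z k) u)"
      by (rule coord_cong) (simp add: sol)
    hence cw: "coord j w = (1 - e k j) * coord j (z k)"
      using j by (simp add: coord_linear coord_mapply algebra_simps)
    have "(1 - ca)\<^sup>2 \<le> (1 - e k j)\<^sup>2"
      using abs_e_le_c[OF k(2) j] c_le_ca ca by (intro power_mono) auto
    thus "(1 - ca)\<^sup>2 * (coord j (z k))\<^sup>2 \<le> (coord j w)\<^sup>2"
      unfolding cw power_mult_distrib by (intro mult_right_mono) auto
  qed
  with w have "(1 - ca)\<^sup>2 * dot N (z k) (z k) \<le> (height k)\<^sup>2" by simp
  hence "sqrt ((1 - ca)\<^sup>2 * dot N (z k) (z k)) \<le> sqrt ((height k)\<^sup>2)"
    by (rule real_sqrt_le_mono)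
  hence "(1 - ca) * sqrt (dot N (z k) (z k)) \<le> height k"
    using ca height_nonneg[of k] by (simp add: real_sqrt_mult)
  thus ?thesis using ca by (simp add: field_simps)
qed

lemma first_layer_bound:
  assumes c: "0 < c" and cmax: "\<And>u. u < N \<Longrightarrow> z l u \<le> cmax"
  shows "height k \<le> (2 * G * C) powr (real l / 2) * cmax * (\<Prod>m\<in>{k..l - 2}. decay m)"
proof -
  define P where "P = sqrt (2 * C) * sqrt G"
  have "l \<in> {k..l}" using kl by simp
  then interpret katz_layer N "A l" "e l" "q l" c r E lam C G by (rule katz_layer[OF c])
  have G1: "1 \<le> G" using G c_pos by simp
  have P1: "1 \<le> P" "sqrt G \<le> P"
  proof -
    have "1 \<le> sqrt (2 * C)" "1 \<le> sqrt G" using C_ge_1 G1 by auto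
    thus "1 \<le> P" "sqrt G \<le> P"
      unfolding P_def using mult_mono[of 1 "sqrt (2 * C)" 1 "sqrt G"]
        mult_right_mono[of 1 "sqrt (2 * C)" "sqrt G"] by auto
  qed
  have cm: "1 \<le> cmax" using z_last_ge_1[OF N_pos] cmax[OF N_pos] by simp
  have weight1: "1 \<le> weight m t" for m t using C_ge_1 G1 by (simp add: weight_def)
  \<comment> \<open>The change flips the state of its edge, so one of these two weights is
    \<open>sqrt (2 * C)\<close> and the other \<open>sqrt G\<close>.\<close>
  have weight2: "weight m m * weight m (m + 1) = P" if "m \<in> {k..<l}" for m
    using change_iff[OF that] by (auto simp: weight_def P_def)
  have dec: "0 \<le> decay m" for m by (simp add: decay_def epowr_nonneg)
  have "weight (l - 1 - d) (l - 1 - d) * height (l - 1 - d)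
      \<le> P ^ Suc d * sqrt G * cmax * (\<Prod>m\<in>{l - 1 - d..<l - 1}. decay m)" if "d \<le> l - 1 - k" for d
    using that
  proof (induction d)
    case 0
    have "weight (l - 1) (l - 1) * height (l - 1) \<le> weight (l - 1) (l - 1) * (weight (l - 1) l * sqrt G * cmax)"
      using weight1[of "l - 1" "l - 1"] by (intro mult_left_mono height_last[OF c cmax]) auto
    also have "\<dots> = P * sqrt G * cmax" using weight2[of "l - 1"] kl by simp
    finally show ?case by simp
  next
    case (Suc d)
    let ?m = "l - 1 - Suc d"
    have m: "k \<le> ?m" "?m + 1 < l" "?m + 1 = l - 1 - d" "?m \<in> {k..<l}" using Suc.prems kl by auto
    have "weight ?m ?m * height ?m
        \<le> weight ?m ?m * (weight ?m (?m + 1) * weight (?m + 1) (?m + 1) * decay ?m * height (?m + 1))"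
      using weight1[of ?m ?m] by (intro mult_left_mono height_step[OF c m(1,2)]) auto
    also have "\<dots> = P * decay ?m * (weight (?m + 1) (?m + 1) * height (?m + 1))"
      unfolding weight2[OF m(4), symmetric] by (simp only: mult_ac)
    also have "\<dots> \<le> P * decay ?m * (P ^ Suc d * sqrt G * cmax * (\<Prod>m\<in>{l - 1 - d..<l - 1}. decay m))"
      using Suc P1 dec[of ?m] unfolding m(3) by (intro mult_left_mono) auto
    also have "\<dots> = P ^ Suc (Suc d) * sqrt G * cmax * (decay ?m * (\<Prod>m\<in>{l - 1 - d..<l - 1}. decay m))"
      by simp
    also have "decay ?m * (\<Prod>m\<in>{l - 1 - d..<l - 1}. decay m) = (\<Prod>m\<in>{?m..<l - 1}. decay m)"
      using prod.atLeast_Suc_lessThan[of ?m "l - 1" decay] m by simp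
    finally show ?case .
  qed
  from this[of "l - 1 - k"] kl
  have *: "weight k k * height k \<le> P ^ (l - k) * sqrt G * cmax * (\<Prod>m\<in>{k..<l - 1}. decay m)"
    by (simp add: Suc_diff_Suc)
  \<comment> \<open>Because \<open>1 <= k < l\<close>, the subtraction \<open>l - 2\<close> does not
    truncate; for \<open>l = k + 1\<close> both ranges are empty.\<close>
  have "{k..<l - 1} = {k..l - 2}" using kl by auto
  hence "1 * height k \<le> P ^ (l - k) * sqrt G * cmax * (\<Prod>m\<in>{k..l - 2}. decay m)"
    using * mult_right_mono[OF weight1[of k k] height_nonneg[of k]] by simp
  also have "\<dots> \<le> P ^ l * cmax * (\<Prod>m\<in>{k..l - 2}. decay m)"
  proof (intro mult_right_mono prod_nonneg ballI dec)
    \<comment> \<open>The spare \<open>sqrt G\<close> of the last layer is rounded up to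
      \<open>P\<close>, and \<open>k >= 1\<close> gives \<open>l - k + 1 <= l\<close>; this is where
      the exponent \<open>l / 2\<close> comes from.\<close>
    have "P ^ (l - k) * sqrt G \<le> P ^ (l - k) * P" using P1 by (intro mult_left_mono) auto
    also have "\<dots> = P ^ Suc (l - k)" by simp
    also have "\<dots> \<le> P ^ l" using P1 kl by (intro power_increasing) auto
    finally show "P ^ (l - k) * sqrt G \<le> P ^ l" .
  qed (use cm in simp)
  also have "P ^ l = (2 * G * C) powr (real l / 2)"
  proof -
    have pos: "0 < 2 * G * C" using G1 C_ge_1 by simp
    have "P = sqrt (2 * G * C)" by (simp add: P_def real_sqrt_mult)
    also have "\<dots> = (2 * G * C) powr (1 / 2)" using pos by (simp add: powr_half_sqrt)
    finally have "P powr real l = (2 * G * C) powr (real l / 2)" by (simp add: powr_powr)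
    thus ?thesis using P1 by (simp add: powr_realpow)
  qed
  finally show ?thesis by simp
qed

text \<open>All eigenvalues of the layers from \<open>k\<close> to \<open>l\<close> are 0, so these
  layers and the coupling between \<open>k\<close> and \<open>k + 1\<close> vanish. The Chebyshev
  rate would be 0 here, which the polynomial estimates exclude.\<close>

lemma first_zero:
  assumes "c = 0" "u < N"
  shows "z k u = 0"
proof -
  have zero: "mapply N (A t) x v = 0" if t: "t \<in> {k..l}" and v: "v < N" for t x v
  proof -
    interpret symmetric_system N "A t" "e t" "q t" by (rule system)
    have "\<forall>v<N. mapply N (A t) x v = 0"
    proof (rule eq_iff_coords[THEN iffD2], intro allI impI)
      fix j assume "j < N"
      thus "coord j (mapply N (A t) x) = coord j (\<lambda>v. 0)"
        using abs_e_le_c[OF t, of j] assms(1) by (simp add: coord_mapply) (simp add: coord_def dot_def)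
    qed
    thus ?thesis using v by simp
  qed
  have k: "k \<in> {k..<l}" "k \<in> {k..l}" "k + 1 \<in> {k..l}" using kl by auto
  have "mapply N (entries (coupling (layer ca B S L) k)) x u = mapply N (A (k + 1)) x u - mapply N (A k) x u" for x
  proof -
    have "coupling (layer ca B S L) k $$ (u, v) = A (k + 1) u v - A k u v" if "v < N" for v
      using layer_carrier[of k] layer_carrier[of "k + 1"] assms(2) that by (simp add: coupling_def A_def)
    thus ?thesis by (simp add: mapply_def left_diff_distrib sum_subtractf)
  qed
  thus ?thesis using z_step[OF k(1) assms(2)] assms(2) k by (simp add: zero)
qed

lemma norm_first_bound:
  assumes cmax: "\<And>u. u < N \<Longrightarrow> z l u \<le> cmax"
  shows "sqrt (dot N (z k) (z k))
    \<le> 1 / (1 - ca) * (2 * G * C) powr (real l / 2) * cmax * (\<Prod>m\<in>{k..l - 2}. decay m)"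
proof (cases "0 < c")
  case True
  have "sqrt (dot N (z k) (z k)) \<le> 1 / (1 - ca) * height k" by (rule norm_first_le)
  also have "\<dots> \<le> 1 / (1 - ca) * ((2 * G * C) powr (real l / 2) * cmax * (\<Prod>m\<in>{k..l - 2}. decay m))"
    using ca by (intro mult_left_mono first_layer_bound[OF True cmax]) auto
  finally show ?thesis by (simp only: mult.assoc)
next
  case False
  hence "c = 0" using c_nonneg by simp
  hence "dot N (z k) (z k) = 0" using first_zero by (simp add: dot_def)
  moreover have "0 \<le> cmax" using z_last_ge_1[OF N_pos] cmax[OF N_pos] by simp
  hence "0 \<le> 1 / (1 - ca) * (2 * G * C) powr (real l / 2) * cmax * (\<Prod>m\<in>{k..l - 2}. decay m)"
    using ca by (intro mult_nonneg_nonneg prod_nonneg) (auto simp: decay_def epowr_nonneg)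
  ultimately show ?thesis by simp
qed

end

text \<open>Uniqueness of the solution identifies the last block of the back substitution with the
  Katz centrality vector, whose maximum is \<open>cmax\<close>.\<close>

lemma katz_row_sums:
  assumes z: "\<And>u. u < N \<Longrightarrow> z u - mapply N (A l) z u = 1"
  shows "katz (layer ca B S L l) *\<^sub>v ones N = vec N z"
proof -
  let ?A = "layer ca B S L l"
  have A: "?A \<in> carrier_mat N N" by (rule layer_carrier)
  have l: "l \<in> {1..L}" using kl by simp
  have row: "((1\<^sub>m N - ?A) *\<^sub>v v) $ u = v $ u - mapply N (A l) (($) v) u" if "v \<in> carrier_vec N" "u < N" for v u
    using one_minus_mult_vec_index[OF A that] by (simp add: mapply_def A_def)
  have "v = 0\<^sub>v N" if v: "v \<in> carrier_vec N" "(1\<^sub>m N - ?A) *\<^sub>v v = 0\<^sub>v N" for v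
  proof (rule eq_vecI)
    fix u assume "u < dim_vec (0\<^sub>v N :: real vec)"
    hence u: "u < N" by simp
    have "v $ u = 0"
    proof (rule layer_inj[OF l _ u])
      fix u assume "u < N"
      thus "v $ u - mapply N (A l) (($) v) u = 0" using row[OF v(1)] v(2) by simp
    qed
    thus "v $ u = 0\<^sub>v N $ u" using u by simp
  qed (use v in simp)
  note K = katz_inverse[OF A this]
  define x where "x = katz ?A *\<^sub>v ones N"
  have x: "x \<in> carrier_vec N" using K(1) by (simp add: x_def ones_def)
  have "(1\<^sub>m N - ?A) *\<^sub>v x = ((1\<^sub>m N - ?A) * katz ?A) *\<^sub>v ones N"
    unfolding x_def using A K(1) by (intro assoc_mult_mat_vec[symmetric]) (auto simp: ones_def)
  hence eq: "(1\<^sub>m N - ?A) *\<^sub>v x = ones N" using K(2) by (simp add: ones_def)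
  have "x $ u - z u = 0" if u: "u < N" for u
  proof (rule layer_inj[OF l _ u])
    fix u assume u: "u < N"
    have "x $ u - mapply N (A l) (($) x) u = 1" using row[OF x u] eq u by (simp add: ones_def)
    thus "x $ u - z u - mapply N (A l) (\<lambda>u. x $ u - z u) u = 0"
      using z[OF u] by (simp add: mapply_diff)
  qed
  thus ?thesis using x unfolding x_def[symmetric] by (intro eq_vecI) auto
qed

lemma block_norm_bound:
  defines "X \<equiv> block_mat N (katz (supra_adj N L (layer ca B S L) (coupling (layer ca B S L)))) k l"
    and "cmax \<equiv> Max (vec_set (katz (layer ca B S L l) *\<^sub>v ones N))"
  shows "norm2 (X *\<^sub>v ones N) \<le> 1 / (1 - ca) * (2 * G * C) powr (real l / 2) * cmax
    * epowr lam (\<Sum>m\<in>{k..l - 2}. ereal_of_enat (graph_dist (line_adj B) (i m) (i (m + 1))) - 1)"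
proof -
  have kl': "k \<in> {1..L}" "l \<in> {1..L}" using kl by auto
  obtain z where X: "\<And>u. u < N \<Longrightarrow> (X *\<^sub>v ones N) $ u = z k u"
    and last: "\<And>u. u < N \<Longrightarrow> z l u - mapply N (A l) (z l) u = 1"
    and step: "\<And>s u. s \<in> {1..<l} \<Longrightarrow> u < N \<Longrightarrow> z s u - mapply N (A s) (z s) u
      = mapply N (entries (coupling (layer ca B S L) s)) (z (s + 1)) u"
    using supra_katz_block[OF kl', of N "layer ca B S L" "coupling (layer ca B S L)"] layer_inj
    unfolding X_def A_def by blast
  have step': "z s u - mapply N (A s) (z s) u
      = mapply N (entries (coupling (layer ca B S L) s)) (z (s + 1)) u" if "s \<in> {k..<l}" "u < N" for s u
    using step[of s u] that kl by simp
  have katz: "katz (layer ca B S L l) *\<^sub>v ones N = vec N (z l)"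
    by (rule katz_row_sums) (rule last)
  have "z l u \<le> cmax" if "u < N" for u
    unfolding cmax_def katz vec_set_def using that by (intro Max_ge) auto
  note bound = norm_first_bound[OF last step' this]
  have "dim_vec (X *\<^sub>v ones N) = N" by (simp add: X_def block_mat_def)
  hence "norm2 (X *\<^sub>v ones N) = sqrt (dot N (z k) (z k))"
    unfolding norm2_def L2_set_def dot_def power2_eq_square
    by (intro arg_cong[where f = sqrt] sum.cong) (simp_all only: X lessThan_iff)
  moreover have "epowr lam (\<Sum>m\<in>{k..l - 2}. ereal_of_enat (graph_dist (line_adj B) (i m) (i (m + 1))) - 1)
      = (\<Prod>m\<in>{k..l - 2}. decay m)"
  proof -
    have "ereal_of_enat x - 1 \<noteq> - \<infinity>" for x by (cases x) (auto simp: one_ereal_def)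
    moreover have "0 < lam" using chebyshev_rate_bounds ca by (simp add: lam_def)
    ultimately show ?thesis unfolding decay_def by (simp add: epowr_sum)
  qed
  ultimately show ?thesis using bound by simp
qed

end

theorem proposition4p7:
  fixes V N L k l :: nat
    and B :: "real mat"
    and S :: "nat \<Rightarrow> nat set"
    and i :: "nat \<Rightarrow> nat"
    and ca \<alpha> a b C cmax lam Cbar :: real
    and gmax :: nat
    and A W :: "nat \<Rightarrow> real mat"
    and X :: "real mat"
  assumes "incidence_mat V N B"
    and "\<And>t. t \<in> {1..L} \<Longrightarrow> S t \<subseteq> {..<N}"
    and "0 < ca" "ca < 1"
    and "\<alpha> = scaling ca B S L"
    and "A = layer ca B S L"
    and "W = coupling A"
    and "1 \<le> k" "k < l" "l \<le> L"
    and "X = block_mat N (katz (supra_adj N L A W)) k l"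
    and "\<And>m. m \<in> {k..<l} \<Longrightarrow>
           i m < N \<and> (removal (S m) (S (m + 1)) (i m) \<or> restoration (S m) (S (m + 1)) (i m))"
    and "smallest_spectral_interval a b ((\<lambda>m. 1\<^sub>m N - A m) ` {k..l})"
    and "C = (1 + sqrt (b / a))\<^sup>2 / (2 * b)"
    and "cmax = Max (vec_set (katz (A l) *\<^sub>v ones N))"
    and "gmax = max_degree (line_adj B)"
    and "lam = (sqrt ((1 + ca) / (1 - ca)) - 1) / (sqrt ((1 + ca) / (1 - ca)) + 1)"
    and "Cbar = 1 / (1 - ca) * (2 * (1 + \<alpha> * real gmax) * C) powr (real l / 2) * cmax"
  shows "norm2 (X *\<^sub>v ones N) \<le>
           Cbar * epowr lam (\<Sum>m\<in>{k..l - 2}. ereal_of_enat (graph_dist (line_adj B) (i m) (i (m + 1))) - 1)"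
proof -
  interpret temporal_network V N L k l B S i ca a b
    using assms by unfold_locales auto
  show ?thesis
    using block_norm_bound assms
    by (simp add: C_def G_def gmax_def \<alpha>_def lam_def chebyshev_rate_def mult_ac)
qed

end
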